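(* Let $0<q<1$. The comultiplication $\Delta_{0+}:\mathscr{L}(\mathbf{X})\to\mathscr{L}(\mathbf{X})\bar\otimes\mathscr{L}(\mathbf{X})$ is determined on $\mathbb{C}[\mathbf{X}]$ by the formula (for $r\in\mathbb{Z}$) $$\Delta_{0+}(v_0^rL_{0+}) = (v_0^r\otimes v_0^r)\cdot \Big(\sum_{p=0}^{\infty} (q^2;q^2)_p^{-1} \;v_0^pL_{0+}b_+^p\otimes v_0^pL_{0+}(-qb_+^* )^p\Big),$$ where the sum in the right hand side converges in norm.
   Context: Notation: $0\in\mathbb{N}$; $(q^2;q^2)_n=\prod_{k=1}^n(1-q^{2k})$, $n\in\mathbb{N}\cup\{\infty\}$; $e_{ij}$ are matrix units in $B(l^2(\mathbb{N}))$; $S$ is the forward bilateral shift on $l^2(\mathbb{Z})$, $Se_k=e_{k+1}$; $\omega_{\xi,\eta}(x)=\langle x\xi,\eta\rangle$. Linking von Neumann algebra between $P$ and $M$: a von Neumann algebra $Q$ with a projection $e$ and identifications $P\cong eQe$, $M\cong(1-e)Q(1-e)$, where $e$ and $1-e$ have central support $1$. A locally compact linking quantum groupoid $\mathbf{L}$ for a locally compact quantum group $\mathbf{G}$ is a linking von Neumann algebra $\mathscr{L}(\mathbf{L})=\begin{pmatrix}\mathscr{L}(\mathbf{H})&\mathscr{L}(\mathbf{X})\\ \mathscr{L}(\overline{\mathbf{X}})&\mathscr{L}(\mathbf{G})\end{pmatrix}$ with a (non-unital) coassociative normal $^*$-homomorphism $\Delta:\mathscr{L}(\mathbf{L})\to\mathscr{L}(\mathbf{L})\bar\otimes\mathscr{L}(\mathbf{L})$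 with $\Delta(e)=e\otimes e$, $\Delta(1-e)=(1-e)\otimes(1-e)$, restricting to the comultiplication of $\mathscr{L}(\mathbf{G})$ on the lower right corner and making $\mathscr{L}(\mathbf{H})$ a von Neumann algebraic quantum group. $\mathscr{L}^\infty(SU_q(2))=\mathscr{L}(\mathbf{G})$ ($\mathbf{G}$ the dual of $SU_q(2)$): the von Neumann algebra generated on $\mathscr{H}_+=l^2(\mathbb{N})\otimes l^2(\mathbb{Z})$ by $a_+=(\sum_{k\ge1}\sqrt{1-q^{2k}}\,e_{k-1,k})\otimes1$ and $b_+=(\sum_{k\ge0}q^ke_{kk})\otimes S$, with $\Delta_+(a_+)=a_+\otimes a_+-q\,b_+^*\otimes b_+$, $\Delta_+(b_+)=b_+\otimes a_++a_+^*\otimes b_+$. Podleś action: let $X=\sum_{k\ge1}q^k\sqrt{1-q^{2k}}\,e_{k-1,k}$, $Z=\sum_{k\ge0}q^{2k}e_{kk}$ in $B(l^2(\mathbb{N}))$; the unital $^*$-algebra generated by $X,Z$ embeds into $\mathscr{L}^\infty(SU_q(2))$ by $j:X\mapsto q\,b_+^*a_+$, $Z\mapsto b_+^*b_+$, and $\alpha:B(l^2(\mathbb{N}))\to\mathscr{L}^\infty(SU_q(2))\bar\otimes B(l^2(\mathbb{N}))$ is the unique normal $^*$-homomorphism with $(\iota\otimes j)\alpha=\Delta_+j$ on this algebra. It is a projective right representation of $SU_q(2)$, and by a known theorem there are a linking quantum groupoid $\mathbf{L}$ for $\mathbf{G}$ and a unitary $\mathcal{G}\in\mathscr{L}(\mathbf{X})\bar\otimes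 B(l^2(\mathbb{N}))$ with $(\Delta\otimes\iota)\mathcal{G}=\mathcal{G}_{[13]}\mathcal{G}_{[23]}$ and $\alpha(x)=\mathcal{G}^*(1\otimes x)\mathcal{G}$. Fix these; $\Delta_{0+}$ is the restriction of $\Delta$ to $\mathscr{L}(\mathbf{X})$. It satisfies $\Delta_{0+}(xy)=\Delta_{0+}(x)\Delta_+(y)$ for $x\in\mathscr{L}(\mathbf{X})$, $y\in\mathscr{L}(\mathbf{G})$. Concrete realization: let $\mathscr{H}_{0+}=l^2(\mathbb{Z})\otimes l^2(\mathbb{Z})$, $v_0=S^*\otimes1$ on $\mathscr{H}_{0+}$, and $L_{0+}:\mathscr{H}_+\to\mathscr{H}_{0+}$, $L_{0+}(e_n\otimes e_k)=\big((q^2;q^2)_\infty/(q^2;q^2)_n\big)^{1/2}e_n\otimes e_k$. Let $\widetilde Q=\begin{pmatrix}B(l^2(\mathbb{Z}))&B(l^2(\mathbb{N}),l^2(\mathbb{Z}))\\ B(l^2(\mathbb{Z}),l^2(\mathbb{N}))&B(l^2(\mathbb{N}))\end{pmatrix}\bar\otimes\mathscr{L}(\mathbb{Z})$ on $\mathscr{H}_{0+}\oplus\mathscr{H}_+$, $\mathscr{L}(\mathbb{Z})$ being the von Neumann algebra generated by $S$; its lower right corner is $\mathscr{L}^\infty(SU_q(2))$. Then $\widetilde Q$ is identified with $\mathscr{L}(\mathbf{L})$ by the unique isomorphism of linking von Neumann algebras which is the identity on $\mathscr{L}(\mathbf{G})$ and sends $(q^2;q^2)_n^{-1/2}v_0^nL_{0+}b_+^n$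 to $(\iota\otimes\omega_{\delta_n,\delta_0})\mathcal{G}$ for all $n\in\mathbb{N}$, where $(\delta_n)$ is the standard basis of $l^2(\mathbb{N})$. In particular $\mathscr{L}(\mathbf{X})=B(l^2(\mathbb{N}),l^2(\mathbb{Z}))\bar\otimes\mathscr{L}(\mathbb{Z})$. Finally $\mathbb{C}[\mathbf{X}]\subseteq\mathscr{L}(\mathbf{X})$ is the $\sigma$-weakly dense linear span of $\{v_0^rL_{0+}b_+^s(b_+^* )^t\mid r\in\mathbb{Z},s,t\in\mathbb{N}\}$, a right module over the $^*$-algebra generated by $a_+,b_+$. *)

theory Defs
  imports "HOL-Analysis.Analysis"
begin

section \<open>The Hilbert spaces \<open>l\<^sup>2(I)\<close>\<close>

typedef 'i ell2 = "{f :: 'i \<Rightarrow> complex. (\<lambda>i. (cmod (f i))\<^sup>2) summable_on UNIV}"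
  morphisms coord Abs_ell2
  by (rule exI[of _ "\<lambda>_. 0"]) simp

setup_lifting type_definition_ell2

lemma ell2_mult_summable:
  assumes "(\<lambda>i. (cmod (f i))\<^sup>2) summable_on UNIV" "(\<lambda>i. (cmod (g i))\<^sup>2) summable_on UNIV"
  shows "(\<lambda>i. f i * cnj (g i)) summable_on UNIV"
proof (rule abs_summable_summable, rule abs_summable_product)
  show "(\<lambda>i. norm (f i * f i)) summable_on UNIV"
    using assms(1) by (simp only: norm_mult power2_eq_square)
  show "(\<lambda>i. norm (cnj (g i) * cnj (g i))) summable_on UNIV"
    using assms(2) by (simp only: norm_mult power2_eq_square complex_mod_cnj)
qed

lemma ell2_add_summable:
  fixes f g :: "'i \<Rightarrow> complex"
  assumes "(\<lambda>i. (cmod (f i))\<^sup>2) summable_on UNIV" "(\<lambda>i. (cmod (g i))\<^sup>2) summable_on UNIV"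
  shows "(\<lambda>i. (cmod (f i + g i))\<^sup>2) summable_on UNIV"
proof (rule summable_on_comparison_test)
  show "(\<lambda>i. 2 * (cmod (f i))\<^sup>2 + 2 * (cmod (g i))\<^sup>2) summable_on UNIV"
    by (intro summable_on_add summable_on_cmult_right assms)
  fix i
  have "(cmod (f i + g i))\<^sup>2 \<le> (cmod (f i) + cmod (g i))\<^sup>2"
    by (simp add: norm_triangle_ineq power_mono)
  also have "\<dots> \<le> 2 * (cmod (f i))\<^sup>2 + 2 * (cmod (g i))\<^sup>2"
    using sum_squares_bound[of "cmod (f i)" "cmod (g i)"] by (simp add: power2_sum)
  finally show "(cmod (f i + g i))\<^sup>2 \<le> 2 * (cmod (f i))\<^sup>2 + 2 * (cmod (g i))\<^sup>2" .
qed simp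

lemma ell2_scale_summable:
  fixes f :: "'i \<Rightarrow> complex"
  assumes "(\<lambda>i. (cmod (f i))\<^sup>2) summable_on UNIV"
  shows "(\<lambda>i. (cmod (c * f i))\<^sup>2) summable_on UNIV"
  using assms by (simp add: norm_mult power_mult_distrib summable_on_cmult_right)

lemma ell2_tensor_summable:
  fixes f :: "'i \<Rightarrow> complex" and g :: "'j \<Rightarrow> complex"
  assumes "(\<lambda>i. (cmod (f i))\<^sup>2) summable_on UNIV" "(\<lambda>i. (cmod (g i))\<^sup>2) summable_on UNIV"
  shows "(\<lambda>ij. (cmod (f (fst ij) * g (snd ij)))\<^sup>2) summable_on UNIV"
proof -
  let ?f = "\<lambda>i. (cmod (f i))\<^sup>2" and ?g = "\<lambda>j. (cmod (g j))\<^sup>2"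
  have "(\<lambda>ij. norm (?f (fst ij) * ?g (snd ij))) summable_on (SIGMA i:UNIV. UNIV)"
    unfolding Infinite_Sum.abs_summable_on_Sigma_iff
  proof (intro conjI ballI)
    fix i
    show "(\<lambda>j. norm (?f (fst (i, j)) * ?g (snd (i, j)))) summable_on UNIV"
      using summable_on_cmult_right[OF assms(2), of "?f i"] by (simp add: norm_mult power_mult_distrib)
  next
    have "(\<lambda>i. norm (\<Sum>\<^sub>\<infinity>j. norm (?f (fst (i, j)) * ?g (snd (i, j)))))
        = (\<lambda>i. ?f i * (\<Sum>\<^sub>\<infinity>j. ?g j))"
      by (simp add: norm_mult abs_mult infsum_cmult_right' infsum_nonneg)
    then show "(\<lambda>i. norm (\<Sum>\<^sub>\<infinity>j. norm (?f (fst (i, j)) * ?g (snd (i, j))))) summable_on UNIV"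
      using summable_on_cmult_left[OF assms(1), of "\<Sum>\<^sub>\<infinity>j. ?g j"] by simp
  qed
  moreover have "(\<lambda>ij. norm (?f (fst ij) * ?g (snd ij))) = (\<lambda>ij. (cmod (f (fst ij) * g (snd ij)))\<^sup>2)"
    by (intro ext) (simp only: norm_mult power_mult_distrib norm_power real_norm_def abs_norm_cancel abs_mult abs_power2)
  ultimately show ?thesis by (simp only: UNIV_Times_UNIV)
qed

instantiation ell2 :: (type) real_inner
begin

lift_definition zero_ell2 :: "'a ell2" is "\<lambda>_. 0" by simp
lift_definition plus_ell2 :: "'a ell2 \<Rightarrow> 'a ell2 \<Rightarrow> 'a ell2" is "\<lambda>f g i. f i + g i"
  by (rule ell2_add_summable)
lift_definition uminus_ell2 :: "'a ell2 \<Rightarrow> 'a ell2" is "\<lambda>f i. - f i" by simp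
lift_definition minus_ell2 :: "'a ell2 \<Rightarrow> 'a ell2 \<Rightarrow> 'a ell2" is "\<lambda>f g i. f i - g i"
  subgoal for f g using ell2_add_summable[of f "\<lambda>i. - g i"] by simp
  done
lift_definition scaleR_ell2 :: "real \<Rightarrow> 'a ell2 \<Rightarrow> 'a ell2" is "\<lambda>r f i. complex_of_real r * f i"
  by (rule ell2_scale_summable)
lift_definition inner_ell2 :: "'a ell2 \<Rightarrow> 'a ell2 \<Rightarrow> real"
  is "\<lambda>f g. Re (\<Sum>\<^sub>\<infinity>i. f i * cnj (g i))" .

definition norm_ell2 :: "'a ell2 \<Rightarrow> real" where "norm_ell2 x = sqrt (inner x x)"
definition dist_ell2 :: "'a ell2 \<Rightarrow> 'a ell2 \<Rightarrow> real" where "dist_ell2 x y = norm (x - y)"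
definition sgn_ell2 :: "'a ell2 \<Rightarrow> 'a ell2" where "sgn_ell2 x = scaleR (inverse (norm x)) x"
definition uniformity_ell2 :: "('a ell2 \<times> 'a ell2) filter"
  where "uniformity_ell2 = (INF e\<in>{0<..}. principal {(x, y). dist x y < e})"
definition open_ell2 :: "'a ell2 set \<Rightarrow> bool"
  where "open_ell2 U = (\<forall>x\<in>U. \<forall>\<^sub>F (x', y) in uniformity. x' = x \<longrightarrow> y \<in> U)"

lemma coord_simps:
  "coord (0 :: 'a ell2) = (\<lambda>_. 0)" "coord (x + y) = (\<lambda>i. coord x i + coord y i)"
  "coord (- x) = (\<lambda>i. - coord x i)" "coord (x - y) = (\<lambda>i. coord x i - coord y i)"
  "coord (r *\<^sub>R x) = (\<lambda>i. complex_of_real r * coord x i)"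
  by (transfer; rule refl)+

lemma ell2_eq_iff: "x = y \<longleftrightarrow> (\<forall>i. coord x i = coord y i)"
  unfolding coord_inject[symmetric] fun_eq_iff ..

instance
proof
  fix x y z :: "'a ell2" and r s :: real
  show "x + y + z = x + (y + z)" "x + y = y + x" "0 + x = x" "- x + x = 0" "x - y = x + - y"
    "r *\<^sub>R (x + y) = r *\<^sub>R x + r *\<^sub>R y" "(r + s) *\<^sub>R x = r *\<^sub>R x + s *\<^sub>R x"
    "r *\<^sub>R s *\<^sub>R x = (r * s) *\<^sub>R x" "1 *\<^sub>R x = x"
    by (simp_all only: ell2_eq_iff coord_simps) (simp_all add: algebra_simps fun_eq_iff)
  show "dist x y = norm (x - y)" by (rule dist_ell2_def)
  show "sgn x = inverse (norm x) *\<^sub>R x" by (rule sgn_ell2_def)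
  show "uniformity = (INF e\<in>{0<..}. principal {(x, y :: 'a ell2). dist x y < e})"
    by (rule uniformity_ell2_def)
  show "open U = (\<forall>x\<in>U. \<forall>\<^sub>F (x', y) in uniformity. x' = x \<longrightarrow> y \<in> U)" for U :: "'a ell2 set"
    by (rule open_ell2_def)
  show "norm x = sqrt (inner x x)" by (rule norm_ell2_def)
  show "inner x y = inner y x"
  proof transfer
    fix f g :: "'a \<Rightarrow> complex"
    have "(\<Sum>\<^sub>\<infinity>i. g i * cnj (f i)) = cnj (\<Sum>\<^sub>\<infinity>i. f i * cnj (g i))"
      by (subst infsum_cnj[symmetric]) (simp add: mult.commute)
    then show "Re (\<Sum>\<^sub>\<infinity>i. f i * cnj (g i)) = Re (\<Sum>\<^sub>\<infinity>i. g i * cnj (f i))" by simp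
  qed
  show "inner (x + y) z = inner x z + inner y z"
  proof transfer
    fix f g h :: "'a \<Rightarrow> complex"
    assume "(\<lambda>i. (cmod (f i))\<^sup>2) summable_on UNIV" "(\<lambda>i. (cmod (g i))\<^sup>2) summable_on UNIV"
      "(\<lambda>i. (cmod (h i))\<^sup>2) summable_on UNIV"
    then have "(\<Sum>\<^sub>\<infinity>i. f i * cnj (h i) + g i * cnj (h i))
        = (\<Sum>\<^sub>\<infinity>i. f i * cnj (h i)) + (\<Sum>\<^sub>\<infinity>i. g i * cnj (h i))"
      by (intro infsum_add ell2_mult_summable)
    then show "Re (\<Sum>\<^sub>\<infinity>i. (f i + g i) * cnj (h i))
        = Re (\<Sum>\<^sub>\<infinity>i. f i * cnj (h i)) + Re (\<Sum>\<^sub>\<infinity>i. g i * cnj (h i))"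
      by (simp add: algebra_simps)
  qed
  show "inner (r *\<^sub>R x) y = r * inner x y"
  proof transfer
    fix r :: real and f g :: "'a \<Rightarrow> complex"
    show "Re (\<Sum>\<^sub>\<infinity>i. complex_of_real r * f i * cnj (g i)) = r * Re (\<Sum>\<^sub>\<infinity>i. f i * cnj (g i))"
      by (simp only: mult.assoc infsum_cmult_right' times_complex.sel Re_complex_of_real
          Im_complex_of_real mult_zero_left diff_zero)
  qed
  have re: "Re (\<Sum>\<^sub>\<infinity>i. f i * cnj (f i)) = (\<Sum>\<^sub>\<infinity>i. (cmod (f i))\<^sup>2)"
    if "(\<lambda>i. (cmod (f i))\<^sup>2) summable_on UNIV" for f :: "'a \<Rightarrow> complex"
    using infsum_Re[OF ell2_mult_summable[OF that that]]
    by (simp only: complex_norm_square[symmetric] Re_complex_of_real)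
  show "0 \<le> inner x x"
  proof transfer
    fix f :: "'a \<Rightarrow> complex" assume "(\<lambda>i. (cmod (f i))\<^sup>2) summable_on UNIV"
    then show "0 \<le> Re (\<Sum>\<^sub>\<infinity>i. f i * cnj (f i))"
      by (subst re) (auto intro: infsum_nonneg)
  qed
  show "inner x x = 0 \<longleftrightarrow> x = 0"
  proof transfer
    fix f :: "'a \<Rightarrow> complex" assume f: "(\<lambda>i. (cmod (f i))\<^sup>2) summable_on UNIV"
    have "f = (\<lambda>_. 0)" if z: "(\<Sum>\<^sub>\<infinity>i. (cmod (f i))\<^sup>2) = 0"
    proof
      fix i
      have "(cmod (f i))\<^sup>2 = 0"
        by (rule nonneg_infsum_le_0D[OF eq_refl[OF z] f]) (rule zero_le_power2, rule UNIV_I)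
      then show "f i = 0" by (simp only: power_eq_0_iff norm_eq_zero)
    qed
    moreover have "(\<Sum>\<^sub>\<infinity>i. (cmod (f i))\<^sup>2) = 0" if z: "f = (\<lambda>_. 0)"
      unfolding z by simp
    ultimately show "(Re (\<Sum>\<^sub>\<infinity>i. f i * cnj (f i)) = 0) = (f = (\<lambda>_. 0))"
      unfolding re[OF f] by (rule iffI)
  qed
qed

end

text \<open>Inner products are linear in the first variable, as needed for
  \<open>\<omega>\<^sub>\<xi>\<^sub>,\<^sub>\<eta>(x) = \<langle>x \<xi>, \<eta>\<rangle>\<close> to be linear in \<open>x\<close>.\<close>

lift_definition cinner :: "'i ell2 \<Rightarrow> 'i ell2 \<Rightarrow> complex" is "\<lambda>f g. \<Sum>\<^sub>\<infinity>i. f i * cnj (g i)" .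

lift_definition cmul :: "complex \<Rightarrow> 'i ell2 \<Rightarrow> 'i ell2" is "\<lambda>c f i. c * f i"
  by (rule ell2_scale_summable)

lift_definition ket :: "'i \<Rightarrow> 'i ell2" is "\<lambda>i j. of_bool (i = j)"
proof -
  fix i :: 'i
  show "(\<lambda>j. (cmod (of_bool (i = j)))\<^sup>2) summable_on UNIV"
    by (rule finite_nonzero_values_imp_summable_on, rule finite_subset[of _ "{i}"])
      (auto split: if_splits)
qed

text \<open>The Hilbert space tensor product of \<open>l\<^sup>2(I)\<close> and \<open>l\<^sup>2(J)\<close> is \<open>l\<^sup>2(I \<times> J)\<close>, and their
  direct sum is \<open>l\<^sup>2(I + J)\<close>.\<close>

lift_definition vtensor :: "'i ell2 \<Rightarrow> 'j ell2 \<Rightarrow> ('i \<times> 'j) ell2" (infixr \<open>\<otimes>\<^sub>v\<close> 70)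
  is "\<lambda>f g ij. f (fst ij) * g (snd ij)"
  by (rule ell2_tensor_summable)


section \<open>Bounded operators\<close>

text \<open>\<^typ>\<open>'i ell2 \<Rightarrow>\<^sub>L 'j ell2\<close> consists of the bounded \<^emph>\<open>real\<close>-linear maps, with the operator norm;
  \<open>bops\<close> is \<open>B(l\<^sup>2(I), l\<^sup>2(J))\<close>.\<close>

type_synonym ('i, 'j) opr = "'i ell2 \<Rightarrow>\<^sub>L 'j ell2"

definition bops :: "('i, 'j) opr set" where
  "bops = {x. \<forall>c \<xi>. blinfun_apply x (cmul c \<xi>) = cmul c (blinfun_apply x \<xi>)}"

definition cscale :: "complex \<Rightarrow> ('i, 'j) opr \<Rightarrow> ('i, 'j) opr" where
  "cscale c x = Blinfun (\<lambda>\<xi>. cmul c (blinfun_apply x \<xi>))"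

definition adj :: "('i, 'j) opr \<Rightarrow> ('j, 'i) opr" where
  "adj x = (THE y. y \<in> bops \<and>
     (\<forall>\<xi> \<eta>. cinner (blinfun_apply x \<xi>) \<eta> = cinner \<xi> (blinfun_apply y \<eta>)))"

definition otensor :: "('i, 'j) opr \<Rightarrow> ('k, 'l) opr \<Rightarrow> ('i \<times> 'k, 'j \<times> 'l) opr"
  (infixr \<open>\<otimes>\<^sub>o\<close> 70) where
  "x \<otimes>\<^sub>o y = (THE z. z \<in> bops \<and>
     (\<forall>\<xi> \<eta>. blinfun_apply z (\<xi> \<otimes>\<^sub>v \<eta>) = blinfun_apply x \<xi> \<otimes>\<^sub>v blinfun_apply y \<eta>))"

definition on_basis :: "('i \<Rightarrow> 'j ell2) \<Rightarrow> ('i, 'j) opr" where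
  "on_basis f = (THE x. x \<in> bops \<and> (\<forall>i. blinfun_apply x (ket i) = f i))"

definition basis_map :: "('i \<Rightarrow> 'j) \<Rightarrow> ('i, 'j) opr" where
  "basis_map f = on_basis (\<lambda>i. ket (f i))"

definition opow :: "('i, 'i) opr \<Rightarrow> nat \<Rightarrow> ('i, 'i) opr" where
  "opow x n = ((\<lambda>y. x o\<^sub>L y) ^^ n) id_blinfun"

definition unitary_op :: "('i, 'j) opr \<Rightarrow> bool" where
  "unitary_op u \<longleftrightarrow> u \<in> bops \<and> adj u o\<^sub>L u = id_blinfun \<and> u o\<^sub>L adj u = id_blinfun"

definition projection :: "('i, 'i) opr \<Rightarrow> bool" where
  "projection p \<longleftrightarrow> p \<in> bops \<and> adj p = p \<and> p o\<^sub>L p = p"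

text \<open>\<open>slice\<^sub>2 \<xi> \<eta> x\<close> is \<open>(\<iota> \<otimes> \<omega>)(x)\<close> for the normal functional \<open>\<omega> = \<Sum>\<^sub>n \<omega>\<^bsub>\<xi> n, \<eta> n\<^esub>\<close>, given by
  square-summable sequences; \<open>slice\<^sub>1\<close> is \<open>(\<omega> \<otimes> \<iota>)(x)\<close>. The single functional \<open>\<omega>\<^bsub>\<xi>, \<eta>\<^esub>\<close> is
  covered by \<open>vec_slice\<^sub>2\<close>.\<close>

definition square_summable :: "(nat \<Rightarrow> 'i ell2) \<Rightarrow> bool" where
  "square_summable \<xi> \<longleftrightarrow> summable (\<lambda>n. (norm (\<xi> n))\<^sup>2)"

definition slice\<^sub>1 ::
  "(nat \<Rightarrow> 'i ell2) \<Rightarrow> (nat \<Rightarrow> 'k ell2) \<Rightarrow> ('i \<times> 'j, 'k \<times> 'l) opr \<Rightarrow> ('j, 'l) opr" where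
  "slice\<^sub>1 \<xi> \<eta> x = (THE z. z \<in> bops \<and> (\<forall>\<zeta> \<zeta>'. cinner (blinfun_apply z \<zeta>) \<zeta>' =
     (\<Sum>n. cinner (blinfun_apply x (\<xi> n \<otimes>\<^sub>v \<zeta>)) (\<eta> n \<otimes>\<^sub>v \<zeta>'))))"

definition slice\<^sub>2 ::
  "(nat \<Rightarrow> 'j ell2) \<Rightarrow> (nat \<Rightarrow> 'l ell2) \<Rightarrow> ('i \<times> 'j, 'k \<times> 'l) opr \<Rightarrow> ('i, 'k) opr" where
  "slice\<^sub>2 \<xi> \<eta> x = (THE z. z \<in> bops \<and> (\<forall>\<zeta> \<zeta>'. cinner (blinfun_apply z \<zeta>) \<zeta>' =
     (\<Sum>n. cinner (blinfun_apply x (\<zeta> \<otimes>\<^sub>v \<xi> n)) (\<zeta>' \<otimes>\<^sub>v \<eta> n))))"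

definition vec_slice\<^sub>2 ::
  "'j ell2 \<Rightarrow> 'l ell2 \<Rightarrow> ('i \<times> 'j, 'k \<times> 'l) opr \<Rightarrow> ('i, 'k) opr" where
  "vec_slice\<^sub>2 \<xi> \<eta> x = (THE z. z \<in> bops \<and> (\<forall>\<zeta> \<zeta>'. cinner (blinfun_apply z \<zeta>) \<zeta>' =
     cinner (blinfun_apply x (\<zeta> \<otimes>\<^sub>v \<xi>)) (\<zeta>' \<otimes>\<^sub>v \<eta>)))"


section \<open>Von Neumann algebras\<close>

definition commutant :: "('i, 'i) opr set \<Rightarrow> ('i, 'i) opr set" where
  "commutant A = {x \<in> bops. \<forall>y\<in>A. x o\<^sub>L y = y o\<^sub>L x}"

definition von_neumann_algebra :: "('i, 'i) opr set \<Rightarrow> bool" where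
  "von_neumann_algebra M \<longleftrightarrow> M \<subseteq> bops \<and> adj ` M \<subseteq> M \<and> commutant (commutant M) = M"

definition vna_gen :: "('i, 'i) opr set \<Rightarrow> ('i, 'i) opr set" where
  "vna_gen A = commutant (commutant (A \<union> adj ` A))"

definition vna_tensor ::
  "('i, 'i) opr set \<Rightarrow> ('j, 'j) opr set \<Rightarrow> ('i \<times> 'j, 'i \<times> 'j) opr set" (infixr \<open>\<otimes>\<^sub>N\<close> 70) where
  "M \<otimes>\<^sub>N N = vna_gen {x \<otimes>\<^sub>o y | x y. x \<in> M \<and> y \<in> N}"

text \<open>The \<open>\<sigma>\<close>-weakly continuous functionals on \<open>B(l\<^sup>2(I))\<close>; those on a von Neumann algebra are
  their restrictions.\<close>

definition normal_functional :: "(('i, 'i) opr \<Rightarrow> complex) \<Rightarrow> bool" where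
  "normal_functional \<omega> \<longleftrightarrow> (\<exists>\<xi> \<eta>. square_summable \<xi> \<and> square_summable \<eta> \<and>
     \<omega> = (\<lambda>x. \<Sum>n. cinner (blinfun_apply x (\<xi> n)) (\<eta> n)))"

definition star_hom ::
  "('i, 'i) opr set \<Rightarrow> ('j, 'j) opr set \<Rightarrow> (('i, 'i) opr \<Rightarrow> ('j, 'j) opr) \<Rightarrow> bool" where
  "star_hom A B \<pi> \<longleftrightarrow>
     \<pi> ` A \<subseteq> B \<and>
     (\<forall>x\<in>A. \<forall>y\<in>A. \<pi> (x + y) = \<pi> x + \<pi> y) \<and>
     (\<forall>c. \<forall>x\<in>A. \<pi> (cscale c x) = cscale c (\<pi> x)) \<and>
     (\<forall>x\<in>A. \<forall>y\<in>A. \<pi> (x o\<^sub>L y) = \<pi> x o\<^sub>L \<pi> y) \<and>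
     (\<forall>x\<in>A. \<pi> (adj x) = adj (\<pi> x))"

definition normal_star_hom ::
  "('i, 'i) opr set \<Rightarrow> ('j, 'j) opr set \<Rightarrow> (('i, 'i) opr \<Rightarrow> ('j, 'j) opr) \<Rightarrow> bool" where
  "normal_star_hom M N \<pi> \<longleftrightarrow> star_hom M N \<pi> \<and>
     (\<forall>\<omega>. normal_functional \<omega> \<longrightarrow> (\<exists>\<omega>'. normal_functional \<omega>' \<and> (\<forall>x\<in>M. \<omega> (\<pi> x) = \<omega>' x)))"

text \<open>\<open>\<Psi>\<close> is the normal extension \<open>\<pi> \<otimes> \<rho>\<close> to \<open>M\<^sub>1 \<otimes> M\<^sub>2\<close>; it is unique on \<open>M\<^sub>1 \<otimes> M\<^sub>2\<close>.\<close>

definition is_tensor_hom ::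
  "('i, 'i) opr set \<Rightarrow> ('j, 'j) opr set \<Rightarrow> ('k, 'k) opr set \<Rightarrow> ('l, 'l) opr set \<Rightarrow>
   (('i, 'i) opr \<Rightarrow> ('k, 'k) opr) \<Rightarrow> (('j, 'j) opr \<Rightarrow> ('l, 'l) opr) \<Rightarrow>
   (('i \<times> 'j, 'i \<times> 'j) opr \<Rightarrow> ('k \<times> 'l, 'k \<times> 'l) opr) \<Rightarrow> bool" where
  "is_tensor_hom M\<^sub>1 M\<^sub>2 N\<^sub>1 N\<^sub>2 \<pi> \<rho> \<Psi> \<longleftrightarrow>
     normal_star_hom (M\<^sub>1 \<otimes>\<^sub>N M\<^sub>2) (N\<^sub>1 \<otimes>\<^sub>N N\<^sub>2) \<Psi> \<and>
     (\<forall>x\<in>M\<^sub>1. \<forall>y\<in>M\<^sub>2. \<Psi> (x \<otimes>\<^sub>o y) = \<pi> x \<otimes>\<^sub>o \<rho> y)"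

text \<open>Threefold tensor products are bracketed as \<open>(I \<times> J) \<times> K\<close>.\<close>

definition reindex :: "('i \<Rightarrow> 'j) \<Rightarrow> ('i, 'i) opr \<Rightarrow> ('j, 'j) opr" where
  "reindex f x = basis_map f o\<^sub>L x o\<^sub>L adj (basis_map f)"

definition assoc_left :: "('i \<times> ('j \<times> 'k), 'i \<times> ('j \<times> 'k)) opr \<Rightarrow> (('i \<times> 'j) \<times> 'k, ('i \<times> 'j) \<times> 'k) opr" where
  "assoc_left = reindex (\<lambda>(i, (j, k)). ((i, j), k))"

definition leg23 :: "('j \<times> 'k, 'j \<times> 'k) opr \<Rightarrow> (('i \<times> 'j) \<times> 'k, ('i \<times> 'j) \<times> 'k) opr" where
  "leg23 x = assoc_left (id_blinfun \<otimes>\<^sub>o x)"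

definition leg13 :: "('i \<times> 'k, 'i \<times> 'k) opr \<Rightarrow> (('i \<times> 'j) \<times> 'k, ('i \<times> 'j) \<times> 'k) opr" where
  "leg13 x = reindex (\<lambda>((i, k), j). ((i, j), k)) (x \<otimes>\<^sub>o id_blinfun)"

definition coassociative ::
  "('i, 'i) opr set \<Rightarrow> (('i, 'i) opr \<Rightarrow> ('i \<times> 'i, 'i \<times> 'i) opr) \<Rightarrow> bool" where
  "coassociative M \<Delta> \<longleftrightarrow> (\<exists>\<Psi> \<Psi>'.
     is_tensor_hom M M (M \<otimes>\<^sub>N M) M \<Delta> (\<lambda>y. y) \<Psi> \<and>
     is_tensor_hom M M M (M \<otimes>\<^sub>N M) (\<lambda>x. x) \<Delta> \<Psi>' \<and>
     (\<forall>x\<in>M. \<Psi> (\<Delta> x) = assoc_left (\<Psi>' (\<Delta> x))))"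

text \<open>Unital \<open>*\<close>-algebra generated by a set of operators.\<close>

inductive_set star_alg :: "('i, 'i) opr set \<Rightarrow> ('i, 'i) opr set" for A where
  one: "id_blinfun \<in> star_alg A"
| gen: "x \<in> A \<Longrightarrow> x \<in> star_alg A"
| add: "x \<in> star_alg A \<Longrightarrow> y \<in> star_alg A \<Longrightarrow> x + y \<in> star_alg A"
| scale: "x \<in> star_alg A \<Longrightarrow> cscale c x \<in> star_alg A"
| mult: "x \<in> star_alg A \<Longrightarrow> y \<in> star_alg A \<Longrightarrow> x o\<^sub>L y \<in> star_alg A"
| star: "x \<in> star_alg A \<Longrightarrow> adj x \<in> star_alg A"


section \<open>Weights and von Neumann algebraic quantum groups\<close>

definition pos :: "('i, 'i) opr set \<Rightarrow> ('i, 'i) opr set" where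
  "pos M = {x \<in> M. \<forall>\<xi>. cinner (blinfun_apply x \<xi>) \<xi> \<in> \<real>\<^sub>\<ge>\<^sub>0}"

definition loewner_le :: "('i, 'i) opr \<Rightarrow> ('i, 'i) opr \<Rightarrow> bool" where
  "loewner_le x y \<longleftrightarrow> (\<forall>\<xi>. cinner (blinfun_apply (y - x) \<xi>) \<xi> \<in> \<real>\<^sub>\<ge>\<^sub>0)"

text \<open>Normal semifinite faithful weights.\<close>

definition nsf_weight :: "('i, 'i) opr set \<Rightarrow> (('i, 'i) opr \<Rightarrow> ennreal) \<Rightarrow> bool" where
  "nsf_weight M \<phi> \<longleftrightarrow>
     (\<forall>x\<in>pos M. \<forall>y\<in>pos M. \<phi> (x + y) = \<phi> x + \<phi> y) \<and>
     (\<forall>x\<in>pos M. \<forall>t\<ge>0. \<phi> (t *\<^sub>R x) = ennreal t * \<phi> x) \<and>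
     (\<forall>D x. D \<subseteq> pos M \<and> D \<noteq> {} \<and>
        (\<forall>d\<in>D. \<forall>d'\<in>D. \<exists>d''\<in>D. loewner_le d d'' \<and> loewner_le d' d'') \<and>
        x \<in> pos M \<and> (\<forall>d\<in>D. loewner_le d x) \<and>
        (\<forall>y\<in>pos M. (\<forall>d\<in>D. loewner_le d y) \<longrightarrow> loewner_le x y)
        \<longrightarrow> \<phi> x = (SUP d\<in>D. \<phi> d)) \<and>
     vna_gen {x \<in> pos M. \<phi> x < \<infinity>} = M \<and>
     (\<forall>x\<in>pos M. \<phi> x = 0 \<longrightarrow> x = 0)"

text \<open>Positive normal functionals are \<open>\<omega> = \<Sum>\<^sub>n \<omega>\<^bsub>\<xi> n, \<xi> n\<^esub>\<close>, with \<open>\<omega>(1) = \<Sum>\<^sub>n \<parallel>\<xi> n\<parallel>\<^sup>2\<close>.\<close>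

definition left_invariant ::
  "('i, 'i) opr set \<Rightarrow> (('i, 'i) opr \<Rightarrow> ('i \<times> 'i, 'i \<times> 'i) opr) \<Rightarrow> (('i, 'i) opr \<Rightarrow> ennreal) \<Rightarrow> bool" where
  "left_invariant M \<Delta> \<phi> \<longleftrightarrow> (\<forall>x\<in>pos M. \<phi> x < \<infinity> \<longrightarrow> (\<forall>\<xi>. square_summable \<xi> \<longrightarrow>
     \<phi> (slice\<^sub>1 \<xi> \<xi> (\<Delta> x)) = ennreal (\<Sum>n. (norm (\<xi> n))\<^sup>2) * \<phi> x))"

definition right_invariant ::
  "('i, 'i) opr set \<Rightarrow> (('i, 'i) opr \<Rightarrow> ('i \<times> 'i, 'i \<times> 'i) opr) \<Rightarrow> (('i, 'i) opr \<Rightarrow> ennreal) \<Rightarrow> bool" where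
  "right_invariant M \<Delta> \<psi> \<longleftrightarrow> (\<forall>x\<in>pos M. \<psi> x < \<infinity> \<longrightarrow> (\<forall>\<xi>. square_summable \<xi> \<longrightarrow>
     \<psi> (slice\<^sub>2 \<xi> \<xi> (\<Delta> x)) = ennreal (\<Sum>n. (norm (\<xi> n))\<^sup>2) * \<psi> x))"

definition vN_quantum_group ::
  "('i, 'i) opr set \<Rightarrow> (('i, 'i) opr \<Rightarrow> ('i \<times> 'i, 'i \<times> 'i) opr) \<Rightarrow> bool" where
  "vN_quantum_group M \<Delta> \<longleftrightarrow>
     von_neumann_algebra M \<and> normal_star_hom M (M \<otimes>\<^sub>N M) \<Delta> \<and> \<Delta> id_blinfun = id_blinfun \<and>
     coassociative M \<Delta> \<and>
     (\<exists>\<phi>. nsf_weight M \<phi> \<and> left_invariant M \<Delta> \<phi>) \<and>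
     (\<exists>\<psi>. nsf_weight M \<psi> \<and> right_invariant M \<Delta> \<psi>)"


section \<open>Linking von Neumann algebras and linking quantum groupoids\<close>

text \<open>A linking von Neumann algebra is taken to act on \<open>l\<^sup>2(H + G) = l\<^sup>2(H) \<oplus> l\<^sup>2(G)\<close>, with \<open>e\<close> the
  projection onto \<open>l\<^sup>2(H)\<close>; its corners are then spaces of operators between \<open>l\<^sup>2(H)\<close> and \<open>l\<^sup>2(G)\<close>.\<close>

abbreviation \<iota>\<^sub>H :: "('h, 'h + 'g) opr" where "\<iota>\<^sub>H \<equiv> basis_map Inl"
abbreviation \<iota>\<^sub>G :: "('g, 'h + 'g) opr" where "\<iota>\<^sub>G \<equiv> basis_map Inr"

definition e_proj :: "('h + 'g, 'h + 'g) opr" where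
  "e_proj = \<iota>\<^sub>H o\<^sub>L adj \<iota>\<^sub>H"

definition corner ::
  "('k, 'i) opr \<Rightarrow> ('l, 'i) opr \<Rightarrow> ('i, 'i) opr set \<Rightarrow> ('l, 'k) opr set" where
  "corner U V Q = (\<lambda>x. adj U o\<^sub>L x o\<^sub>L V) ` Q"

definition corner_comult ::
  "('k, 'i) opr \<Rightarrow> ('l, 'i) opr \<Rightarrow> (('i, 'i) opr \<Rightarrow> ('i \<times> 'i, 'i \<times> 'i) opr) \<Rightarrow>
   ('l, 'k) opr \<Rightarrow> ('l \<times> 'l, 'k \<times> 'k) opr" where
  "corner_comult U V \<Delta> y =
     adj (U \<otimes>\<^sub>o U) o\<^sub>L \<Delta> (U o\<^sub>L y o\<^sub>L adj V) o\<^sub>L (V \<otimes>\<^sub>o V)"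

definition central_support_one :: "('i, 'i) opr set \<Rightarrow> ('i, 'i) opr \<Rightarrow> bool" where
  "central_support_one Q p \<longleftrightarrow>
     (\<forall>z. z \<in> Q \<inter> commutant Q \<and> projection z \<and> z o\<^sub>L p = p \<longrightarrow> z = id_blinfun)"

definition linking_vna :: "('h + 'g, 'h + 'g) opr set \<Rightarrow> bool" where
  "linking_vna Q \<longleftrightarrow> von_neumann_algebra Q \<and> e_proj \<in> Q \<and>
     central_support_one Q e_proj \<and> central_support_one Q (id_blinfun - e_proj)"

definition linking_quantum_groupoid ::
  "('h + 'g, 'h + 'g) opr set \<Rightarrow>
   (('h + 'g, 'h + 'g) opr \<Rightarrow> (('h + 'g) \<times> ('h + 'g), ('h + 'g) \<times> ('h + 'g)) opr) \<Rightarrow>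
   ('g, 'g) opr set \<Rightarrow> (('g, 'g) opr \<Rightarrow> ('g \<times> 'g, 'g \<times> 'g) opr) \<Rightarrow> bool" where
  "linking_quantum_groupoid Q \<Delta> N \<Delta>\<^sub>N \<longleftrightarrow>
     linking_vna Q \<and> vN_quantum_group N \<Delta>\<^sub>N \<and> corner \<iota>\<^sub>G \<iota>\<^sub>G Q = N \<and>
     normal_star_hom Q (Q \<otimes>\<^sub>N Q) \<Delta> \<and> coassociative Q \<Delta> \<and>
     \<Delta> e_proj = e_proj \<otimes>\<^sub>o e_proj \<and>
     \<Delta> (id_blinfun - e_proj) = (id_blinfun - e_proj) \<otimes>\<^sub>o (id_blinfun - e_proj) \<and>
     (\<forall>y\<in>N. corner_comult \<iota>\<^sub>G \<iota>\<^sub>G \<Delta> y = \<Delta>\<^sub>N y) \<and>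
     vN_quantum_group (corner \<iota>\<^sub>H \<iota>\<^sub>H Q) (corner_comult \<iota>\<^sub>H \<iota>\<^sub>H \<Delta>)"


section \<open>Quantum \<open>SU(2)\<close> and the Podles action\<close>

definition bishift :: "(int, int) opr" where
  "bishift = on_basis (\<lambda>k. ket (k + 1))"

text \<open>In \<open>a\<^sub>+\<close> and \<open>X\<close> the coefficient vanishes at \<open>k = 0\<close>.\<close>

definition a_plus :: "real \<Rightarrow> (nat \<times> int, nat \<times> int) opr" where
  "a_plus q = on_basis (\<lambda>k. sqrt (1 - q ^ (2 * k)) *\<^sub>R ket (k - 1)) \<otimes>\<^sub>o id_blinfun"

definition b_plus :: "real \<Rightarrow> (nat \<times> int, nat \<times> int) opr" where
  "b_plus q = on_basis (\<lambda>k. (q ^ k) *\<^sub>R ket k) \<otimes>\<^sub>o bishift"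

definition L_SUq2 :: "real \<Rightarrow> (nat \<times> int, nat \<times> int) opr set" where
  "L_SUq2 q = vna_gen {a_plus q, b_plus q}"

definition pol_SUq2 :: "real \<Rightarrow> (nat \<times> int, nat \<times> int) opr set" where
  "pol_SUq2 q = star_alg {a_plus q, b_plus q}"

definition SUq2_comultiplication ::
  "real \<Rightarrow> ((nat \<times> int, nat \<times> int) opr \<Rightarrow>
     ((nat \<times> int) \<times> (nat \<times> int), (nat \<times> int) \<times> (nat \<times> int)) opr) \<Rightarrow> bool" where
  "SUq2_comultiplication q \<Delta> \<longleftrightarrow>
     normal_star_hom (L_SUq2 q) (L_SUq2 q \<otimes>\<^sub>N L_SUq2 q) \<Delta> \<and> \<Delta> id_blinfun = id_blinfun \<and>
     \<Delta> (a_plus q) = a_plus q \<otimes>\<^sub>o a_plus q - q *\<^sub>R (adj (b_plus q) \<otimes>\<^sub>o b_plus q) \<and>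
     \<Delta> (b_plus q) = b_plus q \<otimes>\<^sub>o a_plus q + adj (a_plus q) \<otimes>\<^sub>o b_plus q"

definition podles_X :: "real \<Rightarrow> (nat, nat) opr" where
  "podles_X q = on_basis (\<lambda>k. (q ^ k * sqrt (1 - q ^ (2 * k))) *\<^sub>R ket (k - 1))"

definition podles_Z :: "real \<Rightarrow> (nat, nat) opr" where
  "podles_Z q = on_basis (\<lambda>k. (q ^ (2 * k)) *\<^sub>R ket k)"

definition podles_alg :: "real \<Rightarrow> (nat, nat) opr set" where
  "podles_alg q = star_alg {podles_X q, podles_Z q}"

definition podles_embedding ::
  "real \<Rightarrow> ((nat, nat) opr \<Rightarrow> (nat \<times> int, nat \<times> int) opr) \<Rightarrow> bool" where
  "podles_embedding q j \<longleftrightarrow>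
     star_hom (podles_alg q) (L_SUq2 q) j \<and> inj_on j (podles_alg q) \<and>
     j id_blinfun = id_blinfun \<and>
     j (podles_X q) = q *\<^sub>R (adj (b_plus q) o\<^sub>L a_plus q) \<and>
     j (podles_Z q) = adj (b_plus q) o\<^sub>L b_plus q"

text \<open>As \<open>j\<close> is only defined on \<open>podles_alg q\<close>, the equation \<open>(\<iota> \<otimes> j) \<alpha> = \<Delta>\<^sub>+ j\<close> says that \<open>\<alpha> x\<close>
  lies in the algebraic tensor product with this algebra, on which \<open>\<iota> \<otimes> j\<close> is evaluated.\<close>

definition podles_action ::
  "real \<Rightarrow> ((nat \<times> int, nat \<times> int) opr \<Rightarrow>
     ((nat \<times> int) \<times> (nat \<times> int), (nat \<times> int) \<times> (nat \<times> int)) opr) \<Rightarrow>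
   ((nat, nat) opr \<Rightarrow> (nat \<times> int, nat \<times> int) opr) \<Rightarrow>
   ((nat, nat) opr \<Rightarrow> ((nat \<times> int) \<times> nat, (nat \<times> int) \<times> nat) opr) \<Rightarrow> bool" where
  "podles_action q \<Delta> j \<alpha> \<longleftrightarrow>
     normal_star_hom bops (L_SUq2 q \<otimes>\<^sub>N bops) \<alpha> \<and>
     (\<forall>x\<in>podles_alg q. \<exists>(n::nat) c d.
        (\<forall>i<n. c i \<in> L_SUq2 q \<and> d i \<in> podles_alg q) \<and>
        \<alpha> x = (\<Sum>i<n. c i \<otimes>\<^sub>o d i) \<and>
        (\<Sum>i<n. c i \<otimes>\<^sub>o j (d i)) = \<Delta> (j x))"


section \<open>The concrete linking algebra\<close>

text \<open>The \<open>q\<close>-shifted factorials \<open>(q\<^sup>2; q\<^sup>2)\<^sub>n\<close> and \<open>(q\<^sup>2; q\<^sup>2)\<^sub>\<infinity>\<close>.\<close>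

definition qpoch :: "real \<Rightarrow> nat \<Rightarrow> real" where
  "qpoch q n = (\<Prod>k=1..n. 1 - q ^ (2 * k))"

definition qpoch_inf :: "real \<Rightarrow> real" where
  "qpoch_inf q = (\<Prod>k. 1 - q ^ (2 * Suc k))"

definition v0 :: "(int \<times> int, int \<times> int) opr" where
  "v0 = adj bishift \<otimes>\<^sub>o id_blinfun"

text \<open>Integer powers of the unitary \<open>v\<^sub>0\<close>.\<close>

definition v0_pow :: "int \<Rightarrow> (int \<times> int, int \<times> int) opr" where
  "v0_pow r = (if 0 \<le> r then opow v0 (nat r) else opow (adj v0) (nat (- r)))"

definition L0plus :: "real \<Rightarrow> (nat \<times> int, int \<times> int) opr" where
  "L0plus q = on_basis (\<lambda>(n, k). sqrt (qpoch_inf q / qpoch q n) *\<^sub>R ket (int n, k))"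

text \<open>The algebra \<open>B(l\<^sup>2(\<int>) \<oplus> l\<^sup>2(\<nat>)) \<otimes> L(\<int>)\<close>, transported to \<open>H\<^sub>0\<^sub>+ \<oplus> H\<^sub>+\<close>.\<close>

definition Qtilde :: "(int \<times> int + nat \<times> int, int \<times> int + nat \<times> int) opr set" where
  "Qtilde = reindex (\<lambda>(m, k). case m of Inl i \<Rightarrow> Inl (i, k) | Inr n \<Rightarrow> Inr (n, k)) `
     ((bops :: (int + nat, int + nat) opr set) \<otimes>\<^sub>N vna_gen {bishift})"

text \<open>An operator from \<open>H\<^sub>+ \<otimes> l\<^sup>2(\<nat>)\<close> to \<open>H\<^sub>0\<^sub>+ \<otimes> l\<^sup>2(\<nat>)\<close>, as an operator on
  \<open>(H\<^sub>0\<^sub>+ \<oplus> H\<^sub>+) \<otimes> l\<^sup>2(\<nat>)\<close> vanishing outside the upper right corner.\<close>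

definition upper_right :: "('g \<times> 'k, 'h \<times> 'k) opr \<Rightarrow> (('h + 'g) \<times> 'k, ('h + 'g) \<times> 'k) opr" where
  "upper_right x = (\<iota>\<^sub>H \<otimes>\<^sub>o id_blinfun) o\<^sub>L x o\<^sub>L adj (\<iota>\<^sub>G \<otimes>\<^sub>o id_blinfun)"

text \<open>The complex linear span of \<open>v\<^sub>0\<^sup>r L\<^sub>0\<^sub>+ b\<^sub>+\<^sup>s (b\<^sub>+\<^sup>*)\<^sup>t\<close>, as a real span.\<close>

definition C_X :: "real \<Rightarrow> (nat \<times> int, int \<times> int) opr set" where
  "C_X q = span {cscale c (v0_pow r o\<^sub>L L0plus q o\<^sub>L opow (b_plus q) s o\<^sub>L opow (adj (b_plus q)) t)
     | c r s t. True}"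

definition Delta_term :: "real \<Rightarrow> nat \<Rightarrow>
    ((nat \<times> int) \<times> (nat \<times> int), (int \<times> int) \<times> (int \<times> int)) opr" where
  "Delta_term q p = (1 / qpoch q p) *\<^sub>R
     ((v0_pow (int p) o\<^sub>L L0plus q o\<^sub>L opow (b_plus q) p) \<otimes>\<^sub>o
      (v0_pow (int p) o\<^sub>L L0plus q o\<^sub>L opow ((- q) *\<^sub>R adj (b_plus q)) p))"

end

theory Submission
  imports Defs
begin

text \<open>
  Let \<open>A\<close>, \<open>B\<close> be the operators on \<open>l\<^sup>2(\<nat>)\<close> with \<open>a\<^sub>+ = A \<otimes> 1\<close> and \<open>b\<^sub>+ = B \<otimes> S\<close>, so that
  \<open>X = q B A\<close>, and put \<open>C = b\<^sub>+\<^sup>* \<otimes> A\<^sup>* + a\<^sub>+ \<otimes> B\<close> and \<open>D = a\<^sub>+ \<otimes> A - q b\<^sub>+\<^sup>* \<otimes> B\<close>. Then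
  \<open>\<alpha>(X) = q C D\<close> and \<open>D C = q C D\<close>, and an induction over the rows of \<open>\<G>\<close>, started by the given
  row \<open>(\<iota> \<otimes> \<omega>\<^bsub>\<delta> n, \<delta> 0\<^esub>) \<G>\<close>, yields \<open>(v\<^sub>0 \<otimes> B) \<G> = \<G> C\<close>. Since \<open>B\<close> is injective,
  \<open>(1 \<otimes> X) \<G> = \<G> \<alpha>(X)\<close> then gives \<open>(v\<^sub>0\<^sup>* \<otimes> A) \<G> = \<G> D\<close>. The second relation determines the column
  \<open>(\<iota> \<otimes> \<omega>\<^bsub>\<delta> 0, \<delta> k\<^esub>) \<G>\<close>, so that the corepresentation property
  \<open>\<Delta>(\<G>\<^sub>0\<^sub>0) = \<Sum>\<^sub>k \<G>\<^sub>0\<^sub>k \<otimes> \<G>\<^sub>k\<^sub>0\<close> is the stated series for \<open>r = 0\<close>. Both relations together with the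
  corepresentation property show that \<open>v\<^sub>0 \<otimes> v\<^sub>0\<close> implements the passage from \<open>\<Delta>(\<G>\<^sub>0\<^sub>n)\<close> to
  \<open>\<Delta>(\<G>\<^sub>0\<^sub>,\<^sub>n\<^sub>+\<^sub>1)\<close>; with \<open>1 = a\<^sub>+\<^sup>* a\<^sub>+ + b\<^sub>+ b\<^sub>+\<^sup>*\<close> this extends to all \<open>v\<^sub>0\<^sup>n L\<^sub>0\<^sub>+\<close>, \<open>n \<ge> 0\<close>, and negative
  powers are covered by \<open>v\<^sub>0\<^sup>* L\<^sub>0\<^sub>+ = L\<^sub>0\<^sub>+ a\<^sub>+\<^sup>*\<close>.
\<close>

section \<open>Hilbert space preliminaries\<close>

text \<open>The action supplies only a product relation, \<open>\<alpha>(X) = q C D\<close>, and the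
  difficulty is to split it. On polynomials, setting the phase \<open>S\<close> of the second leg to
  1 sends \<open>j(x)\<close> to \<open>x\<close>, \<open>\<Delta>_+(adj b_+)\<close> to
  \<open>C\<close> and \<open>\<Delta>_+(a_+)\<close> to \<open>D\<close>. Thus
  \<open>C adj C = \<alpha>(B B)\<close>, but \<open>C\<close> is not positive and differs from
  \<open>\<alpha>(B)\<close> by a phase. The relation \<open>(v0 \<otimes> B) \<G> = \<G> C\<close>
  says that this phase is \<open>v0\<close>, transported by \<open>\<G>\<close>; the given row of
  \<open>\<G>\<close> is what pins it down.

  The series comes from inserting the sum of the matrix units \<open>e_kk\<close> between
  \<open>\<G>_13\<close> and \<open>\<G>_23\<close>. This resolution of the identity converges only
  strongly; norm convergence is gained afterwards from the factor \<open>q^p\<close> hidden in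
  \<open>(-q adj b_+)^p\<close>.

  The corepresentation property controls \<open>\<Delta>\<close> only on the entries
  \<open>\<G>_0n\<close>, which are multiples of \<open>v0^n L b_+^n\<close>, whereas the formula
  concerns \<open>v0^n L\<close>. Removing the powers of \<open>b_+\<close> is the purpose of the
  last induction.\<close>

lemma coord_summable: "(\<lambda>i. (cmod (coord x i))\<^sup>2) summable_on UNIV"
  using coord[of x] by simp

lemma coord_cmul [simp]: "coord (cmul c x) i = c * coord x i"
  by transfer (rule refl)

lemma coord_ket: "coord (ket i) j = of_bool (i = j)"
  by transfer (rule refl)

lemma coord_vtensor [simp]: "coord (x \<otimes>\<^sub>v y) (i, j) = coord x i * coord y j"
  by transfer simp

lemma ell2_eqI: "(\<And>i. coord x i = coord y i) \<Longrightarrow> x = y"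
  by (simp add: ell2_eq_iff)

lemma cinner_coord: "cinner x y = (\<Sum>\<^sub>\<infinity>i. coord x i * cnj (coord y i))"
  by transfer (rule refl)

lemma cinner_summable: "(\<lambda>i. coord x i * cnj (coord y i)) summable_on UNIV"
  by (rule ell2_mult_summable coord_summable)+

lemma inner_eq_Re_cinner: "inner x y = Re (cinner x y)"
  by transfer (rule refl)

lemma cinner_self: "cinner x x = of_real ((norm x)\<^sup>2)"
  and norm_coord: "(norm x)\<^sup>2 = (\<Sum>\<^sub>\<infinity>i. (cmod (coord x i))\<^sup>2)"
proof -
  have 1: "cinner x x = of_real (\<Sum>\<^sub>\<infinity>i. (cmod (coord x i))\<^sup>2)"
    unfolding cinner_coord complex_norm_square[symmetric]
    by (rule infsumI) (simp add: has_sum_of_real_iff has_sum_infsum coord_summable del: of_real_power)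
  have 2: "(norm x)\<^sup>2 = Re (cinner x x)"
    by (simp add: power2_norm_eq_inner inner_eq_Re_cinner)
  show "cinner x x = of_real ((norm x)\<^sup>2)" "(norm x)\<^sup>2 = (\<Sum>\<^sub>\<infinity>i. (cmod (coord x i))\<^sup>2)"
    using 1 2 by simp_all
qed

lemma cinner_commute: "cinner y x = cnj (cinner x y)"
  unfolding cinner_coord infsum_cnj[symmetric] by (simp add: mult.commute)

lemma cinner_add_left: "cinner (x + y) z = cinner x z + cinner y z"
  unfolding cinner_coord coord_simps distrib_right
  by (rule infsum_add; rule cinner_summable)

lemma cinner_cmul_left: "cinner (cmul c x) y = c * cinner x y"
  by (simp add: cinner_coord mult.assoc infsum_cmult_right')

lemma cinner_add_right: "cinner x (y + z) = cinner x y + cinner x z"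
  by (subst (1 2 3) cinner_commute) (simp add: cinner_add_left)

lemma cinner_cmul_right: "cinner x (cmul c y) = cnj c * cinner x y"
  by (subst (1 2) cinner_commute) (simp add: cinner_cmul_left)

lemma scaleR_cmul: "r *\<^sub>R x = cmul (of_real r) x" for x :: "'i ell2"
  by (rule ell2_eqI) (simp add: coord_simps)

lemma cmul_simps [simp]: "cmul 1 x = x" "cmul 0 x = 0" "cmul c 0 = 0" "cmul c (cmul d x) = cmul (c * d) x"
  "cmul c (x + y) = cmul c x + cmul c y" "cmul c (x - y) = cmul c x - cmul c y"
  "cmul c (r *\<^sub>R x) = r *\<^sub>R cmul c x" "cmul c (- x) = - cmul c x"
  by (auto intro!: ell2_eqI simp: coord_simps algebra_simps)

lemma norm_cmul [simp]: "norm (cmul c x) = cmod c * norm x"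
proof -
  have "(norm (cmul c x))\<^sup>2 = (cmod c * norm x)\<^sup>2"
    by (simp add: norm_coord norm_mult power_mult_distrib infsum_cmult_right')
  then show ?thesis by (simp add: power2_eq_iff_nonneg)
qed

text \<open>Rotating \<open>x\<close> by a unit scalar makes the inner product real and nonnegative,
  so the estimate is that of the real inner product \<open>inner\<close>.\<close>

lemma cinner_cauchy_schwarz: "cmod (cinner x y) \<le> norm x * norm y"
proof (cases "cinner x y = 0")
  case False
  define c where "c = cnj (cinner x y) / of_real (cmod (cinner x y))"
  have c: "cmod c = 1" using False by (simp add: c_def norm_divide)
  have "c * cinner x y = of_real (cmod (cinner x y))"
    using False complex_norm_square[of "cinner x y"]
    by (simp add: c_def field_simps power2_eq_square)
  then have "cmod (cinner x y) = Re (cinner (cmul c x) y)"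
    by (simp add: cinner_cmul_left)
  also have "\<dots> \<le> norm (cmul c x) * norm y"
    unfolding inner_eq_Re_cinner[symmetric] by (rule norm_cauchy_schwarz)
  finally show ?thesis by (simp add: c)
qed simp

lemma bounded_bilinear_cinner: "bounded_bilinear cinner"
proof
  show "\<exists>K. \<forall>a b. cmod (cinner a b) \<le> norm a * norm b * K"
    by (rule exI[of _ 1]) (simp add: cinner_cauchy_schwarz)
qed (simp_all add: cinner_add_left cinner_add_right scaleR_cmul cinner_cmul_left cinner_cmul_right
      scaleR_conv_of_real)

interpretation cinner: bounded_bilinear cinner by (rule bounded_bilinear_cinner)

lemma cinner_ket_right [simp]: "cinner x (ket i) = coord x i"
proof -
  have "cinner x (ket i) = (\<Sum>\<^sub>\<infinity>j. coord x j * of_bool (i = j))"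
    by (simp add: cinner_coord coord_ket of_bool_def if_distrib cong: if_cong)
  also have "\<dots> = coord x i" by (subst infsum_cong_neutral[where T = "{i}" and g = "coord x"]) auto
  finally show ?thesis .
qed

lemma cinner_ket_left [simp]: "cinner (ket i) x = cnj (coord x i)"
  by (subst cinner_commute) simp

lemma norm_ket [simp]: "norm (ket i) = 1"
proof -
  have "of_real ((norm (ket i))\<^sup>2) = (1::complex)"
    by (simp only: cinner_self[symmetric]) (simp add: coord_ket)
  then have "(norm (ket i))\<^sup>2 = 1" by (simp only: of_real_eq_1_iff)
  then show ?thesis by (simp add: power2_eq_1_iff) (metis norm_ge_zero not_one_le_zero neg_0_le_iff_le)
qed

lemma bounded_linear_coord: "bounded_linear (\<lambda>x. coord x i)"
  using cinner.bounded_linear_left[of "ket i"] by simp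

lemma coord_sum: "coord (sum f A) i = (\<Sum>k\<in>A. coord (f k) i)"
  by (rule linear_sum[OF bounded_linear.linear[OF bounded_linear_coord]])

text \<open>The squared distance of \<open>x\<close> from a finite partial sum is the squared norm
  of \<open>x\<close> minus the finite sum of squared moduli of coordinates. Convergence therefore
  reduces to that of the scalar sum defining the norm.\<close>

lemma ket_expansion: "((\<lambda>i. cmul (coord x i) (ket i)) has_sum x) UNIV"
proof -
  let ?s = "\<lambda>F. \<Sum>i\<in>F. cmul (coord x i) (ket i)"
  have tail: "norm (?s F - x) = sqrt ((norm x)\<^sup>2 - (\<Sum>i\<in>F. (cmod (coord x i))\<^sup>2))" if F: "finite F" for F
  proof -
    have c: "coord (?s F - x) i = (if i \<in> F then 0 else - coord x i)" for i
      using F by (simp add: coord_simps coord_sum coord_ket if_distrib sum.delta of_bool_def cong: if_cong)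
    have "(norm (?s F - x))\<^sup>2 = (\<Sum>\<^sub>\<infinity>i. if i \<in> F then 0 else (cmod (coord x i))\<^sup>2)"
      unfolding norm_coord c by (rule infsum_cong) auto
    also have "\<dots> = (\<Sum>\<^sub>\<infinity>i\<in>UNIV - F. (cmod (coord x i))\<^sup>2)"
      by (rule infsum_cong_neutral) auto
    also have "\<dots> = (norm x)\<^sup>2 - (\<Sum>i\<in>F. (cmod (coord x i))\<^sup>2)"
      unfolding norm_coord using F by (subst infsum_Diff) (auto simp: coord_summable)
    finally show ?thesis by (metis norm_ge_zero real_sqrt_abs abs_of_nonneg)
  qed
  have "((\<lambda>F. \<Sum>i\<in>F. (cmod (coord x i))\<^sup>2) \<longlongrightarrow> (norm x)\<^sup>2) (finite_subsets_at_top UNIV)"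
    using has_sum_infsum[OF coord_summable[of x]] by (simp add: has_sum_def norm_coord)
  then have "((\<lambda>F. sqrt ((norm x)\<^sup>2 - (\<Sum>i\<in>F. (cmod (coord x i))\<^sup>2))) \<longlongrightarrow> sqrt ((norm x)\<^sup>2 - (norm x)\<^sup>2))
      (finite_subsets_at_top UNIV)"
    by (intro tendsto_intros)
  then have "((\<lambda>F. norm (?s F - x)) \<longlongrightarrow> 0) (finite_subsets_at_top UNIV)"
    by (subst tendsto_cong[OF eventually_finite_subsets_at_top_weakI[OF tail]]) simp_all
  then show ?thesis
    unfolding has_sum_def by (simp add: LIM_zero_iff tendsto_norm_zero_iff)
qed

section \<open>Bounded complex-linear operators and their adjoints\<close>

lemma bops_apply: "x \<in> bops \<Longrightarrow> blinfun_apply x (cmul c \<xi>) = cmul c (blinfun_apply x \<xi>)"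
  by (simp add: bops_def)

lemma bops_expansion:
  assumes "x \<in> bops"
  shows "((\<lambda>i. cmul (coord \<xi> i) (blinfun_apply x (ket i))) has_sum blinfun_apply x \<xi>) UNIV"
  using has_sum_bounded_linear[OF blinfun.bounded_linear_right[of x] ket_expansion[of \<xi>]]
  by (simp add: o_def bops_apply[OF assms])

lemma bops_eqI:
  assumes "x \<in> bops" "y \<in> bops" "\<And>i. blinfun_apply x (ket i) = blinfun_apply y (ket i)"
  shows "x = y"
proof (rule blinfun_eqI)
  fix \<xi>
  show "blinfun_apply x \<xi> = blinfun_apply y \<xi>"
    using bops_expansion[OF assms(1), of \<xi>] bops_expansion[OF assms(2), of \<xi>]
    by (simp add: assms(3) has_sum_unique)
qed

lemma bops_Blinfun:
  assumes "\<And>x y. f (x + y) = f x + f y" "\<And>c x. f (cmul c x) = cmul c (f x)"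
    and "\<And>x. norm (f x) \<le> K * norm x"
  obtains T where "T \<in> bops" "\<And>\<xi>. blinfun_apply T \<xi> = f \<xi>" "norm T \<le> K"
proof -
  have "bounded_linear f"
    by (rule bounded_linear_intro[where K = K]) (simp_all add: assms scaleR_cmul mult.commute)
  then have a: "blinfun_apply (Blinfun f) \<xi> = f \<xi>" for \<xi>
    by (simp add: bounded_linear_Blinfun_apply)
  have "0 \<le> K" using assms(3)[of "ket undefined"] by (simp add: order.trans[OF norm_ge_zero])
  then have "norm (Blinfun f) \<le> K"
    using assms(3) by (intro norm_blinfun_bound) (simp_all add: a)
  then show ?thesis by (rule that[OF _ a, rotated]) (simp add: bops_def a assms(2))
qed

lemma bops_add [simp]: "x \<in> bops \<Longrightarrow> y \<in> bops \<Longrightarrow> x + y \<in> bops"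
  and bops_diff [simp]: "x \<in> bops \<Longrightarrow> y \<in> bops \<Longrightarrow> x - y \<in> bops"
  and bops_uminus [simp]: "x \<in> bops \<Longrightarrow> - x \<in> bops"
  and bops_scaleR [simp]: "x \<in> bops \<Longrightarrow> r *\<^sub>R x \<in> bops"
  and bops_zero [simp]: "0 \<in> bops"
  and bops_id [simp]: "id_blinfun \<in> bops"
  by (auto simp: bops_def blinfun.bilinear_simps)

lemma bops_compose [simp]: "x \<in> bops \<Longrightarrow> y \<in> bops \<Longrightarrow> x o\<^sub>L y \<in> bops"
  by (auto simp: bops_def)

lemma bops_sum [simp]: "(\<And>i. i \<in> I \<Longrightarrow> f i \<in> bops) \<Longrightarrow> sum f I \<in> bops"
  by (induction I rule: infinite_finite_induct) auto

lemma cscale_apply [simp]: "blinfun_apply (cscale c x) \<xi> = cmul c (blinfun_apply x \<xi>)"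
  unfolding cscale_def
proof (subst bounded_linear_Blinfun_apply)
  have "bounded_linear (cmul c :: 'a ell2 \<Rightarrow> _)"
    by (rule bounded_linear_intro[where K = "cmod c"]) (simp_all add: mult.commute)
  from bounded_linear_compose[OF this blinfun.bounded_linear_right]
  show "bounded_linear (\<lambda>\<xi>. cmul c (blinfun_apply x \<xi>))" .
qed simp

lemma bops_cscale [simp]: "x \<in> bops \<Longrightarrow> cscale c x \<in> bops"
  by (simp add: bops_def mult.commute)

lemma cscale_of_real: "cscale (of_real r) x = r *\<^sub>R x"
  by (rule blinfun_eqI) (simp add: scaleR_cmul blinfun.bilinear_simps)

lemma opow_0 [simp]: "opow x 0 = id_blinfun"
  and opow_Suc: "opow x (Suc n) = x o\<^sub>L opow x n"
  by (simp_all add: opow_def)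

lemma bops_opow [simp]: "x \<in> bops \<Longrightarrow> opow x n \<in> bops"
  by (induction n) (simp_all add: opow_Suc)

lemma blinfun_compose_assoc: "(x o\<^sub>L y) o\<^sub>L z = x o\<^sub>L (y o\<^sub>L z)"
  by (rule blinfun_eqI) simp

lemma blinfun_compose_id [simp]: "x o\<^sub>L id_blinfun = x" "id_blinfun o\<^sub>L x = x"
  by (rule blinfun_eqI, simp)+

lemma opow_Suc2: "opow x (Suc n) = opow x n o\<^sub>L x"
  by (induction n) (simp_all add: opow_Suc blinfun_compose_assoc[symmetric])

text \<open>The value of the adjoint at \<eta> must have the coordinates \<open>f \<eta> i\<close>,
  the inner products of \<eta> with the images of the basis vectors. Only their square summability
  is in question, and it follows by testing \<open>x\<close> on the finite vector with these
  coordinates.\<close>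

lemma adj_exists:
  fixes x :: "('i, 'j) opr"
  assumes "x \<in> bops"
  shows "\<exists>y\<in>bops. \<forall>\<xi> \<eta>. cinner (blinfun_apply x \<xi>) \<eta> = cinner \<xi> (blinfun_apply y \<eta>)"
proof -
  define f where "f \<eta> i = cinner \<eta> (blinfun_apply x (ket i))" for \<eta> i
  have bound: "(\<Sum>i\<in>F. (cmod (f \<eta> i))\<^sup>2) \<le> (norm x * norm \<eta>)\<^sup>2" if F: "finite F" for F \<eta>
  proof -
    define \<zeta> where "\<zeta> = (\<Sum>i\<in>F. cmul (f \<eta> i) (ket i))"
    define s where "s = (\<Sum>i\<in>F. (cmod (f \<eta> i))\<^sup>2)"
    have s0: "0 \<le> s" unfolding s_def by (rule sum_nonneg) simp
    have c: "coord \<zeta> i = (if i \<in> F then f \<eta> i else 0)" for i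
      unfolding \<zeta>_def coord_sum coord_cmul coord_ket using F
      by (simp add: of_bool_def if_distrib cong: if_cong)
    have n\<zeta>: "(norm \<zeta>)\<^sup>2 = s"
    proof -
      have "(norm \<zeta>)\<^sup>2 = (\<Sum>\<^sub>\<infinity>i\<in>F. (cmod (f \<eta> i))\<^sup>2)"
        unfolding norm_coord c by (rule infsum_cong_neutral) auto
      then show ?thesis using F by (simp add: s_def)
    qed
    have "cinner (blinfun_apply x \<zeta>) \<eta> = (\<Sum>i\<in>F. f \<eta> i * cinner (blinfun_apply x (ket i)) \<eta>)"
      by (simp add: \<zeta>_def blinfun.sum_right cinner.sum_left bops_apply[OF assms] cinner_cmul_left)
    also have "\<dots> = of_real s"
      unfolding s_def f_def of_real_sum
      by (rule sum.cong) (use complex_norm_square cinner_commute in metis)+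
    finally have "s = cmod (cinner (blinfun_apply x \<zeta>) \<eta>)" using s0 by simp
    also have "\<dots> \<le> norm (blinfun_apply x \<zeta>) * norm \<eta>" by (rule cinner_cauchy_schwarz)
    also have "\<dots> \<le> norm x * norm \<zeta> * norm \<eta>" by (intro mult_right_mono norm_blinfun) simp
    \<comment> \<open>The partial sum to be bounded is itself the squared norm of \<zeta>, so one
      factor \<open>norm \<zeta>\<close> cancels.\<close>
    finally have "(norm \<zeta>)\<^sup>2 \<le> (norm x * norm \<eta>) * norm \<zeta>" by (simp add: n\<zeta> mult_ac)
    then have "norm \<zeta> \<le> norm x * norm \<eta>"
      by (cases "norm \<zeta> = 0") (auto simp: power2_eq_square mult_le_cancel_right)
    then show ?thesis unfolding s_def[symmetric] n\<zeta>[symmetric] by (rule power_mono) simp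
  qed
  have sm: "(\<lambda>i. (cmod (f \<eta> i))\<^sup>2) summable_on UNIV" for \<eta>
    by (rule nonneg_bdd_above_summable_on) (auto intro!: bdd_aboveI2[where M="(norm x * norm \<eta>)\<^sup>2"] bound)
  define g where "g \<eta> = Abs_ell2 (f \<eta>)" for \<eta>
  have cg: "coord (g \<eta>) i = f \<eta> i" for \<eta> i
    unfolding g_def by (subst Abs_ell2_inverse) (simp_all add: sm)
  obtain y where y: "y \<in> bops" "\<And>\<eta>. blinfun_apply y \<eta> = g \<eta>" "norm y \<le> norm x"
  proof (rule bops_Blinfun[of g "norm x"])
    show "g (\<xi> + \<eta>) = g \<xi> + g \<eta>" for \<xi> \<eta>
      by (rule ell2_eqI) (simp add: cg coord_simps f_def cinner_add_left)
    show "g (cmul c \<eta>) = cmul c (g \<eta>)" for c \<eta>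
      by (rule ell2_eqI) (simp add: cg f_def cinner_cmul_left)
    fix \<eta>
    have "(norm (g \<eta>))\<^sup>2 \<le> (norm x * norm \<eta>)\<^sup>2"
      unfolding norm_coord cg by (rule infsum_le_finite_sums[OF sm bound]) simp
    then show "norm (g \<eta>) \<le> norm x * norm \<eta>" by (rule power2_le_imp_le) simp
  qed blast
  show ?thesis
  proof (intro bexI[OF _ y(1)] allI)
    fix \<xi> \<eta>
    have "((\<lambda>i. cinner (cmul (coord \<xi> i) (blinfun_apply x (ket i))) \<eta>) has_sum cinner (blinfun_apply x \<xi>) \<eta>) UNIV"
      using has_sum_bounded_linear[OF cinner.bounded_linear_left bops_expansion[OF assms]] by (simp add: o_def)
    then have "((\<lambda>i. coord \<xi> i * cnj (f \<eta> i)) has_sum cinner (blinfun_apply x \<xi>) \<eta>) UNIV"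
      by (simp add: cinner_cmul_left cinner_cmul_right f_def cinner_commute[of _ \<eta>])
    then show "cinner (blinfun_apply x \<xi>) \<eta> = cinner \<xi> (blinfun_apply y \<eta>)"
      unfolding cinner_coord[of \<xi>] y(2) cg by (metis infsumI)
  qed
qed

lemma cinner_ext: "(\<And>\<xi>. cinner \<xi> \<eta> = cinner \<xi> \<eta>') \<Longrightarrow> \<eta> = \<eta>'"
  by (rule ell2_eqI) (metis cinner_ket_left complex_cnj_cancel_iff)

text \<open>Existence comes from \<open>adj_exists\<close>, uniqueness from nondegeneracy of the
  inner product. The facts are proved together because the definite description yields nothing
  before both are known.\<close>

lemma bops_adj [simp]: "x \<in> bops \<Longrightarrow> adj x \<in> bops"
  and cinner_adj: "x \<in> bops \<Longrightarrow> cinner (blinfun_apply x \<xi>) \<eta> = cinner \<xi> (blinfun_apply (adj x) \<eta>)"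
  and adj_eqI: "y \<in> bops \<Longrightarrow> (\<And>\<xi> \<eta>. cinner (blinfun_apply x \<xi>) \<eta> = cinner \<xi> (blinfun_apply y \<eta>)) \<Longrightarrow> adj x = y"
proof -
  let ?P = "\<lambda>x y. y \<in> bops \<and> (\<forall>\<xi> \<eta>. cinner (blinfun_apply x \<xi>) \<eta> = cinner \<xi> (blinfun_apply y \<eta>))"
  have u: "y = y'" if "?P x y" "?P x y'" for x y y'
    using that by (intro blinfun_eqI cinner_ext) metis
  show eq: "adj x = y" if "y \<in> bops" "\<And>\<xi> \<eta>. cinner (blinfun_apply x \<xi>) \<eta> = cinner \<xi> (blinfun_apply y \<eta>)" for x y
    unfolding adj_def by (rule the_equality) (use that u in blast)+
  assume "x \<in> bops"
  from adj_exists[OF this] obtain y where "?P x y" by blast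
  then show "adj x \<in> bops" "cinner (blinfun_apply x \<xi>) \<eta> = cinner \<xi> (blinfun_apply (adj x) \<eta>)"
    using eq[of y x] by auto
qed

lemma cinner_adj': "x \<in> bops \<Longrightarrow> cinner (blinfun_apply (adj x) \<xi>) \<eta> = cinner \<xi> (blinfun_apply x \<eta>)"
  by (metis cinner_adj cinner_commute)

lemma adj_adj [simp]: "x \<in> bops \<Longrightarrow> adj (adj x) = x"
  by (rule adj_eqI) (simp_all add: cinner_adj')

lemma adj_compose [simp]: "x \<in> bops \<Longrightarrow> y \<in> bops \<Longrightarrow> adj (x o\<^sub>L y) = adj y o\<^sub>L adj x"
  by (rule adj_eqI) (simp_all add: cinner_adj)

lemma adj_id [simp]: "adj id_blinfun = id_blinfun"
  by (rule adj_eqI) simp_all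

lemma adj_add [simp]: "x \<in> bops \<Longrightarrow> y \<in> bops \<Longrightarrow> adj (x + y) = adj x + adj y"
  and adj_diff [simp]: "x \<in> bops \<Longrightarrow> y \<in> bops \<Longrightarrow> adj (x - y) = adj x - adj y"
  and adj_scaleR [simp]: "x \<in> bops \<Longrightarrow> adj (r *\<^sub>R x) = r *\<^sub>R adj x"
  by (rule adj_eqI; simp add: blinfun.bilinear_simps cinner.add_left cinner.add_right cinner.diff_left
      cinner.diff_right cinner.scaleR_left cinner.scaleR_right cinner_adj)+

lemma coord_adj_ket: "x \<in> bops \<Longrightarrow> coord (blinfun_apply (adj x) (ket j)) i = cnj (coord (blinfun_apply x (ket i)) j)"
  by (metis cinner_adj cinner_ket_left cinner_ket_right complex_cnj_cnj)

section \<open>Tensor products of operators\<close>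

lemma ket_vtensor: "ket i \<otimes>\<^sub>v ket j = ket (i, j)"
  by (rule ell2_eqI) (auto simp: coord_ket coord_vtensor split: prod.split)

lemma vtensor_simps:
  "(x + y) \<otimes>\<^sub>v z = x \<otimes>\<^sub>v z + y \<otimes>\<^sub>v z" "z \<otimes>\<^sub>v (x + y) = z \<otimes>\<^sub>v x + z \<otimes>\<^sub>v y"
  "(x - y) \<otimes>\<^sub>v z = x \<otimes>\<^sub>v z - y \<otimes>\<^sub>v z" "z \<otimes>\<^sub>v (x - y) = z \<otimes>\<^sub>v x - z \<otimes>\<^sub>v y"
  "(r *\<^sub>R x) \<otimes>\<^sub>v z = r *\<^sub>R (x \<otimes>\<^sub>v z)" "z \<otimes>\<^sub>v (r *\<^sub>R x) = r *\<^sub>R (z \<otimes>\<^sub>v x)"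
  "0 \<otimes>\<^sub>v z = 0" "z \<otimes>\<^sub>v 0 = 0" "(- x) \<otimes>\<^sub>v z = - (x \<otimes>\<^sub>v z)" "z \<otimes>\<^sub>v (- x) = - (z \<otimes>\<^sub>v x)"
  "(cmul c x) \<otimes>\<^sub>v z = cmul c (x \<otimes>\<^sub>v z)" "z \<otimes>\<^sub>v (cmul c x) = cmul c (z \<otimes>\<^sub>v x)"
  by (rule ell2_eqI, clarify, simp add: coord_simps algebra_simps)+

text \<open>A common source for the explicit operators: shifts, matrix units, isometries,
  \<open>A_op\<close>, \<open>B_op\<close> and \<open>L0plus\<close>. Injectivity is asked only
  where the weight is nonzero, because truncated subtraction sends both 0 and 1 to 0 in
  \<open>A_op\<close> and \<open>podles_X\<close>.\<close>

lemma weighted_basis_map_exists: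
  fixes c :: "'i \<Rightarrow> real" and g :: "'i \<Rightarrow> 'j"
  assumes inj: "inj_on g {i. c i \<noteq> 0}" and K: "\<And>i. \<bar>c i\<bar> \<le> K"
  obtains x where "x \<in> bops" "\<And>i. blinfun_apply x (ket i) = c i *\<^sub>R ket (g i)" "norm x \<le> K"
proof -
  define S where "S = {i. c i \<noteq> 0}"
  define h where "h = inv_into S g"
  have hg: "h (g i) = i" if "i \<in> S" for i
    using inj that unfolding h_def S_def by (rule inv_into_f_f)
  define f where "f \<xi> j = (if j \<in> g ` S then of_real (c (h j)) * coord \<xi> (h j) else 0)" for \<xi> j
  have K0: "0 \<le> K" using K[of undefined] by linarith
  have le: "(cmod (of_real (c i) * coord \<xi> i))\<^sup>2 \<le> K\<^sup>2 * (cmod (coord \<xi> i))\<^sup>2" for \<xi> i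
  proof -
    have "(c i)\<^sup>2 \<le> K\<^sup>2" using power_mono[OF K[of i] abs_ge_zero, of 2] by simp
    then show ?thesis by (simp add: norm_mult power_mult_distrib mult_right_mono)
  qed
  have sK: "(\<lambda>i. K\<^sup>2 * (cmod (coord \<xi> i))\<^sup>2) summable_on A" for \<xi> A
    by (rule summable_on_subset[OF summable_on_cmult_right[OF coord_summable]]) simp
  have sS: "(\<lambda>i. (cmod (of_real (c i) * coord \<xi> i))\<^sup>2) summable_on S" for \<xi>
    by (rule summable_on_comparison_test[OF sK[of \<xi>]]) (use le in auto)
  have sg: "(\<lambda>j. (cmod (f \<xi> j))\<^sup>2) summable_on g ` S" for \<xi>
    by (subst summable_on_reindex)
      (use inj sS[of \<xi>] in \<open>auto simp: S_def[symmetric] o_def f_def hg cong: summable_on_cong\<close>)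
  have sU: "(\<lambda>j. (cmod (f \<xi> j))\<^sup>2) summable_on UNIV" for \<xi>
    using sg[of \<xi>] by (rule summable_on_cong_neutral[THEN iffD1, rotated -1]) (auto simp: f_def)
  define F where "F \<xi> = Abs_ell2 (f \<xi>)" for \<xi>
  have cF: "coord (F \<xi>) j = f \<xi> j" for \<xi> j
    unfolding F_def by (subst Abs_ell2_inverse) (simp_all add: sU)
  have "norm (F \<xi>) \<le> K * norm \<xi>" for \<xi>
  proof -
    have "(norm (F \<xi>))\<^sup>2 = (\<Sum>\<^sub>\<infinity>j\<in>g ` S. (cmod (f \<xi> j))\<^sup>2)"
      unfolding norm_coord cF by (rule infsum_cong_neutral) (auto simp: f_def)
    also have "\<dots> = (\<Sum>\<^sub>\<infinity>i\<in>S. (cmod (of_real (c i) * coord \<xi> i))\<^sup>2)"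
      by (subst infsum_reindex) (use inj in \<open>auto simp: S_def[symmetric] o_def f_def hg intro!: infsum_cong\<close>)
    also have "\<dots> \<le> (\<Sum>\<^sub>\<infinity>i. K\<^sup>2 * (cmod (coord \<xi> i))\<^sup>2)"
      by (rule infsum_mono_neutral[OF sS sK]) (use le in auto)
    also have "\<dots> = (K * norm \<xi>)\<^sup>2"
      by (simp add: infsum_cmult_right' norm_coord power_mult_distrib)
    finally show ?thesis by (rule power2_le_imp_le) (simp add: K0)
  qed
  moreover have "F (x + y) = F x + F y" "F (cmul d x) = cmul d (F x)" for x y d
    by (rule ell2_eqI; simp add: cF f_def coord_simps algebra_simps)+
  ultimately obtain T where T: "T \<in> bops" "\<And>\<xi>. blinfun_apply T \<xi> = F \<xi>" "norm T \<le> K"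
    using bops_Blinfun[of F K] by blast
  have "F (ket i) = c i *\<^sub>R ket (g i)" for i
  proof (rule ell2_eqI)
    fix j
    show "coord (F (ket i)) j = coord (c i *\<^sub>R ket (g i)) j"
    proof (cases "j \<in> g ` S")
      case True
      then obtain k where k: "k \<in> S" "j = g k" by blast
      then have "g i = g k \<longleftrightarrow> i = k" if "i \<in> S"
        using inj that by (auto simp: S_def[symmetric] inj_on_def)
      then show ?thesis using k by (auto simp: cF f_def coord_simps coord_ket hg) (auto simp: S_def)
    next
      case False
      then show ?thesis by (auto simp: cF f_def coord_simps coord_ket) (auto simp: S_def)
    qed
  qed
  with T that show ?thesis by auto
qed

lemma on_basis_weighted:
  fixes c :: "'i \<Rightarrow> real" and g :: "'i \<Rightarrow> 'j"
  assumes f: "\<And>i. f i = c i *\<^sub>R ket (g i)"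
    and inj: "inj_on g {i. c i \<noteq> 0}" and K: "\<And>i. \<bar>c i\<bar> \<le> K"
  shows "on_basis f \<in> bops" "blinfun_apply (on_basis f) (ket i) = f i" "norm (on_basis f) \<le> K"
proof -
  obtain x where x: "x \<in> bops" "\<And>i. blinfun_apply x (ket i) = c i *\<^sub>R ket (g i)" "norm x \<le> K"
    using weighted_basis_map_exists[OF inj K] by blast
  have "on_basis f = x"
    unfolding on_basis_def by (rule the_equality) (auto intro: bops_eqI simp: x f)
  with x f show "on_basis f \<in> bops" "blinfun_apply (on_basis f) (ket i) = f i" "norm (on_basis f) \<le> K"
    by simp_all
qed

lemma basis_map_bops: "inj f \<Longrightarrow> basis_map f \<in> bops"
  and basis_map_ket: "inj f \<Longrightarrow> blinfun_apply (basis_map f) (ket i) = ket (f i)"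
  unfolding basis_map_def
  by (rule on_basis_weighted[where c = "\<lambda>_. 1" and g = f and K = 1]; simp add: inj_on_subset)+

lemma adj_basis_map_ket:
  assumes "inj f"
  shows "blinfun_apply (adj (basis_map f)) (ket (f i)) = ket i"
  by (rule ell2_eqI)
    (use assms in \<open>auto simp: coord_adj_ket basis_map_bops basis_map_ket coord_ket inj_eq\<close>)

lemma coord_basis_map:
  assumes "inj f"
  shows "coord (blinfun_apply (basis_map f) \<xi>) (f i) = coord \<xi> i"
proof -
  have "cinner (blinfun_apply (basis_map f) \<xi>) (ket (f i)) = cinner \<xi> (ket i)"
    using assms by (simp only: cinner_adj[OF basis_map_bops] adj_basis_map_ket)
  then show ?thesis by simp
qed

lemma norm_basis_map: "inj f \<Longrightarrow> norm (basis_map f) \<le> 1"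
  unfolding basis_map_def
  by (rule on_basis_weighted[where c = "\<lambda>_. 1" and g = f]) (simp_all add: inj_on_subset)

lemma basis_map_isometry: "inj f \<Longrightarrow> adj (basis_map f) o\<^sub>L basis_map f = id_blinfun"
  by (rule bops_eqI) (simp_all add: basis_map_bops basis_map_ket adj_basis_map_ket)

lemma basis_map_unitary: "bij f \<Longrightarrow> basis_map f o\<^sub>L adj (basis_map f) = id_blinfun"
proof (rule bops_eqI)
  fix j assume f: "bij f"
  then obtain i where "j = f i" by (metis bij_pointE)
  with f show "blinfun_apply (basis_map f o\<^sub>L adj (basis_map f)) (ket j) = blinfun_apply id_blinfun (ket j)"
    by (simp add: basis_map_ket adj_basis_map_ket bij_is_inj)
qed (simp_all add: basis_map_bops bij_is_inj)

text \<open>A vector \<open>\<Phi>\<close> is a family of rows whose norms are square summable with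
  total \<open>norm \<Phi>\<close> squared. Applying \<open>y\<close> to every row gives
  \<open>1 \<otimes> y\<close> together with its norm bound.\<close>

lemma amplification_exists:
  fixes y :: "('i, 'j) opr"
  assumes y: "y \<in> bops"
  obtains z :: "('k \<times> 'i, 'k \<times> 'j) opr" where "z \<in> bops" "norm z \<le> norm y"
    "\<And>i k. blinfun_apply z (ket (k, i)) = ket k \<otimes>\<^sub>v blinfun_apply y (ket i)"
proof -
  define row :: "('k \<times> 'i) ell2 \<Rightarrow> 'k \<Rightarrow> 'i ell2" where "row \<Phi> k = Abs_ell2 (\<lambda>i. coord \<Phi> (k, i))" for \<Phi> k
  have U: "(\<lambda>(k, i). (cmod (coord \<Phi> (k, i)))\<^sup>2) = (\<lambda>p. (cmod (coord \<Phi> p))\<^sup>2)" for \<Phi> :: "('k \<times> 'l) ell2"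
    by auto
  have "(\<lambda>i. (cmod (coord \<Phi> (k, i)))\<^sup>2) summable_on UNIV" for \<Phi> :: "('k \<times> 'i) ell2" and k
    by (rule summable_on_SigmaD1[where A = UNIV and B = "\<lambda>_. UNIV"]) (simp_all add: U coord_summable)
  then have cr: "coord (row \<Phi> k) i = coord \<Phi> (k, i)" for \<Phi> k i
    unfolding row_def by (subst Abs_ell2_inverse) simp_all
  have hs: "((\<lambda>i. (cmod (coord \<xi> i))\<^sup>2) has_sum (norm \<xi>)\<^sup>2) UNIV" for \<xi> :: "'l ell2"
    unfolding norm_coord by (rule has_sum_infsum[OF coord_summable])
  have nr: "((\<lambda>k. (norm (row \<Phi> k))\<^sup>2) has_sum (norm \<Phi>)\<^sup>2) UNIV" for \<Phi>
    by (rule has_sum_SigmaD[where A = UNIV and B = "\<lambda>_. UNIV" and f = "\<lambda>p. (cmod (coord \<Phi> p))\<^sup>2"])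
      (use hs[of \<Phi>] hs[of "row \<Phi> _"] in \<open>simp_all add: cr\<close>)
  have row_lin: "row (\<Phi> + \<Phi>') k = row \<Phi> k + row \<Phi>' k" "row (cmul c \<Phi>) k = cmul c (row \<Phi> k)" for \<Phi> \<Phi>' k c
    by (rule ell2_eqI; simp add: cr coord_simps)+
  define f where "f \<Phi> p = coord (blinfun_apply y (row \<Phi> (fst p))) (snd p)" for \<Phi> p
  have le: "(norm (blinfun_apply y (row \<Phi> k)))\<^sup>2 \<le> (norm y)\<^sup>2 * (norm (row \<Phi> k))\<^sup>2" for \<Phi> k
    unfolding power_mult_distrib[symmetric] by (rule power_mono[OF norm_blinfun]) simp
  have sK: "(\<lambda>k. (norm y)\<^sup>2 * (norm (row \<Phi> k))\<^sup>2) summable_on UNIV" for \<Phi>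
    using nr by (intro summable_on_cmult_right) (auto simp: summable_on_def)
  have sy: "(\<lambda>k. (norm (blinfun_apply y (row \<Phi> k)))\<^sup>2) summable_on UNIV" for \<Phi>
    by (rule summable_on_comparison_test[OF sK[of \<Phi>]]) (use le in auto)
  have sf: "(\<lambda>p. (cmod (f \<Phi> p))\<^sup>2) summable_on UNIV \<times> UNIV" for \<Phi>
    by (rule summable_on_SigmaI[OF _ sy[of \<Phi>]]) (simp_all add: f_def hs)
  define F where "F \<Phi> = Abs_ell2 (f \<Phi>)" for \<Phi>
  have cF: "coord (F \<Phi>) p = f \<Phi> p" for \<Phi> p
    unfolding F_def using sf[of \<Phi>] by (subst Abs_ell2_inverse) simp_all
  have "norm (F \<Phi>) \<le> norm y * norm \<Phi>" for \<Phi>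
  proof -
    have "(norm (F \<Phi>))\<^sup>2 = (\<Sum>\<^sub>\<infinity>k. (norm (blinfun_apply y (row \<Phi> k)))\<^sup>2)"
      unfolding norm_coord[of "F \<Phi>"] cF UNIV_Times_UNIV[symmetric]
      by (rule infsumI, rule has_sum_SigmaI[OF _ has_sum_infsum[OF sy] sf])
        (simp add: f_def hs)
    also have "\<dots> \<le> (\<Sum>\<^sub>\<infinity>k. (norm y)\<^sup>2 * (norm (row \<Phi> k))\<^sup>2)"
      by (rule infsum_mono[OF sy sK le])
    also have "\<dots> = (norm y * norm \<Phi>)\<^sup>2"
      using infsumI[OF nr[of \<Phi>]] by (simp add: infsum_cmult_right' power_mult_distrib)
    finally show ?thesis by (rule power2_le_imp_le) simp
  qed
  moreover have "F (\<Phi> + \<Phi>') = F \<Phi> + F \<Phi>'" "F (cmul c \<Phi>) = cmul c (F \<Phi>)" for \<Phi> \<Phi>' c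
    by (rule ell2_eqI; simp add: cF f_def coord_simps row_lin blinfun.bilinear_simps bops_apply[OF y])+
  ultimately obtain z where z: "z \<in> bops" "\<And>\<Phi>. blinfun_apply z \<Phi> = F \<Phi>" "norm z \<le> norm y"
    using bops_Blinfun[of F "norm y"] by blast
  have rk: "row (ket (k, i)) k' = (if k = k' then ket i else 0)" for k i k'
    by (rule ell2_eqI) (simp add: cr coord_ket coord_simps)
  have "F (ket (k, i)) = ket k \<otimes>\<^sub>v blinfun_apply y (ket i)" for k i
    by (rule ell2_eqI, clarify) (simp add: cF f_def rk coord_simps coord_ket blinfun.bilinear_simps)
  with z that show ?thesis by auto
qed

text \<open>Expanding both vectors gives a summable double series for each coordinate; summed row by
  row it factors into the two single series.\<close>

lemma blinfun_vtensor_eqI: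
  assumes "z \<in> bops" "x \<in> bops" "y \<in> bops"
    and "\<And>i j. blinfun_apply z (ket (i, j)) = blinfun_apply x (ket i) \<otimes>\<^sub>v blinfun_apply y (ket j)"
  shows "blinfun_apply z (\<xi> \<otimes>\<^sub>v \<eta>) = blinfun_apply x \<xi> \<otimes>\<^sub>v blinfun_apply y \<eta>"
proof (rule ell2_eqI, clarify)
  fix k l
  have "(\<lambda>p. coord (cmul (coord (\<xi> \<otimes>\<^sub>v \<eta>) p) (blinfun_apply z (ket p))) (k, l))
      = (\<lambda>(i, j). coord \<xi> i * coord \<eta> j * (coord (blinfun_apply x (ket i)) k * coord (blinfun_apply y (ket j)) l))"
    by (rule ext) (simp add: assms(4) split: prod.split)
  then have 1: "((\<lambda>(i, j). coord \<xi> i * coord \<eta> j * (coord (blinfun_apply x (ket i)) k * coord (blinfun_apply y (ket j)) l))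
      has_sum coord (blinfun_apply z (\<xi> \<otimes>\<^sub>v \<eta>)) (k, l)) (UNIV \<times> UNIV)"
    using has_sum_bounded_linear[OF bounded_linear_coord bops_expansion[OF assms(1), of "\<xi> \<otimes>\<^sub>v \<eta>"], of "(k, l)"]
    by (simp add: o_def)
  have x: "((\<lambda>i. coord \<xi> i * coord (blinfun_apply x (ket i)) k) has_sum coord (blinfun_apply x \<xi>) k) UNIV"
    using has_sum_bounded_linear[OF bounded_linear_coord bops_expansion[OF assms(2), of \<xi>], of k] by (simp add: o_def)
  have y: "((\<lambda>i. coord \<eta> i * coord (blinfun_apply y (ket i)) l) has_sum coord (blinfun_apply y \<eta>) l) UNIV"
    using has_sum_bounded_linear[OF bounded_linear_coord bops_expansion[OF assms(3), of \<eta>], of l] by (simp add: o_def)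
  have "((\<lambda>i. coord \<xi> i * coord (blinfun_apply x (ket i)) k * coord (blinfun_apply y \<eta>) l)
      has_sum coord (blinfun_apply z (\<xi> \<otimes>\<^sub>v \<eta>)) (k, l)) UNIV"
    by (rule has_sum_SigmaD[OF 1])
      (use has_sum_cmult_right[OF y, of "coord \<xi> _ * coord (blinfun_apply x (ket _)) k"] in \<open>simp add: mult_ac\<close>)
  with has_sum_cmult_left[OF x, of "coord (blinfun_apply y \<eta>) l"]
  show "coord (blinfun_apply z (\<xi> \<otimes>\<^sub>v \<eta>)) (k, l) = coord (blinfun_apply x \<xi> \<otimes>\<^sub>v blinfun_apply y \<eta>) (k, l)"
    by (simp add: has_sum_unique)
qed

text \<open>Only amplifications in the right leg are available, so the left leg is reached by
  flipping: \<open>x \<otimes> y\<close> is the composite of \<open>1 \<otimes> y\<close>, a flip,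
  \<open>1 \<otimes> x\<close> and the flip back.\<close>

lemma otensor_exists:
  fixes x :: "('i, 'j) opr" and y :: "('k, 'l) opr"
  assumes x: "x \<in> bops" and y: "y \<in> bops"
  obtains z where "z \<in> bops" "norm z \<le> norm x * norm y"
    "\<And>\<xi> \<eta>. blinfun_apply z (\<xi> \<otimes>\<^sub>v \<eta>) = blinfun_apply x \<xi> \<otimes>\<^sub>v blinfun_apply y \<eta>"
proof -
  obtain w :: "('i \<times> 'k, 'i \<times> 'l) opr" where w: "w \<in> bops" "norm w \<le> norm y"
    "\<And>i k. blinfun_apply w (ket (k, i)) = ket k \<otimes>\<^sub>v blinfun_apply y (ket i)"
    using amplification_exists[OF y] by blast
  obtain u :: "('l \<times> 'i, 'l \<times> 'j) opr" where u: "u \<in> bops" "norm u \<le> norm x"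
    "\<And>i k. blinfun_apply u (ket (k, i)) = ket k \<otimes>\<^sub>v blinfun_apply x (ket i)"
    using amplification_exists[OF x] by blast
  define s :: "('i \<times> 'l, 'l \<times> 'i) opr" where "s = basis_map prod.swap"
  define t :: "('l \<times> 'j, 'j \<times> 'l) opr" where "t = basis_map prod.swap"
  have s: "s \<in> bops" "norm s \<le> 1" and t: "t \<in> bops" "norm t \<le> 1"
    by (simp_all add: s_def t_def basis_map_bops norm_basis_map)
  have "coord (blinfun_apply s (\<xi> \<otimes>\<^sub>v \<eta>)) (prod.swap p) = coord (\<eta> \<otimes>\<^sub>v \<xi>) (prod.swap p)" for \<xi> \<eta> p
    unfolding s_def by (subst coord_basis_map) (simp_all, cases p, simp)
  then have sv: "blinfun_apply s (\<xi> \<otimes>\<^sub>v \<eta>) = \<eta> \<otimes>\<^sub>v \<xi>" for \<xi> \<eta>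
    by (intro ell2_eqI) (metis swap_swap)
  have "coord (blinfun_apply t (\<xi> \<otimes>\<^sub>v \<eta>)) (prod.swap p) = coord (\<eta> \<otimes>\<^sub>v \<xi>) (prod.swap p)" for \<xi> \<eta> p
    unfolding t_def by (subst coord_basis_map) (simp_all, cases p, simp)
  then have tv: "blinfun_apply t (\<xi> \<otimes>\<^sub>v \<eta>) = \<eta> \<otimes>\<^sub>v \<xi>" for \<xi> \<eta>
    by (intro ell2_eqI) (metis swap_swap)
  have uv: "blinfun_apply u (\<xi> \<otimes>\<^sub>v \<eta>) = \<xi> \<otimes>\<^sub>v blinfun_apply x \<eta>" for \<xi> \<eta>
    using blinfun_vtensor_eqI[OF u(1) bops_id x] u(3) by simp
  have wv: "blinfun_apply w (\<xi> \<otimes>\<^sub>v \<eta>) = \<xi> \<otimes>\<^sub>v blinfun_apply y \<eta>" for \<xi> \<eta>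
    using blinfun_vtensor_eqI[OF w(1) bops_id y] w(3) by simp
  show ?thesis
  proof (rule that)
    show "t o\<^sub>L (u o\<^sub>L (s o\<^sub>L w)) \<in> bops" using t u s w by simp
    have "norm (t o\<^sub>L (u o\<^sub>L (s o\<^sub>L w))) \<le> 1 * (norm x * (1 * norm y))"
      by (intro order.trans[OF norm_blinfun_compose] mult_mono t u s w) auto
    then show "norm (t o\<^sub>L (u o\<^sub>L (s o\<^sub>L w))) \<le> norm x * norm y" by simp
  qed (simp add: tv uv sv wv)
qed

lemma otensor_bops [simp]: "x \<in> bops \<Longrightarrow> y \<in> bops \<Longrightarrow> x \<otimes>\<^sub>o y \<in> bops"
  and otensor_apply [simp]: "x \<in> bops \<Longrightarrow> y \<in> bops \<Longrightarrow>
    blinfun_apply (x \<otimes>\<^sub>o y) (\<xi> \<otimes>\<^sub>v \<eta>) = blinfun_apply x \<xi> \<otimes>\<^sub>v blinfun_apply y \<eta>"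
  and norm_otensor: "x \<in> bops \<Longrightarrow> y \<in> bops \<Longrightarrow> norm (x \<otimes>\<^sub>o y) \<le> norm x * norm y"
proof -
  assume xy: "x \<in> bops" "y \<in> bops"
  obtain z where z: "z \<in> bops" "norm z \<le> norm x * norm y"
    "\<And>\<xi> \<eta>. blinfun_apply z (\<xi> \<otimes>\<^sub>v \<eta>) = blinfun_apply x \<xi> \<otimes>\<^sub>v blinfun_apply y \<eta>"
    using otensor_exists[OF xy] by blast
  have "x \<otimes>\<^sub>o y = z"
    unfolding otensor_def
  proof (rule the_equality)
    fix z'
    assume z': "z' \<in> bops \<and> (\<forall>\<xi> \<eta>. blinfun_apply z' (\<xi> \<otimes>\<^sub>v \<eta>) = blinfun_apply x \<xi> \<otimes>\<^sub>v blinfun_apply y \<eta>)"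
    show "z' = z"
    proof (rule bops_eqI)
      fix p :: "'a \<times> 'c"
      obtain i j where "p = (i, j)" by fastforce
      then show "blinfun_apply z' (ket p) = blinfun_apply z (ket p)"
        using z'[THEN conjunct2] z(3) by (metis ket_vtensor)
    qed (use z z' in auto)
  qed (use z in auto)
  with z show "x \<otimes>\<^sub>o y \<in> bops" "norm (x \<otimes>\<^sub>o y) \<le> norm x * norm y"
    "blinfun_apply (x \<otimes>\<^sub>o y) (\<xi> \<otimes>\<^sub>v \<eta>) = blinfun_apply x \<xi> \<otimes>\<^sub>v blinfun_apply y \<eta>"
    by simp_all
qed

lemma otensor_ket: "x \<in> bops \<Longrightarrow> y \<in> bops \<Longrightarrow>
    blinfun_apply (x \<otimes>\<^sub>o y) (ket (i, j)) = blinfun_apply x (ket i) \<otimes>\<^sub>v blinfun_apply y (ket j)"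
  by (simp flip: ket_vtensor)

lemma bops_vtensor_eqI:
  assumes "x \<in> bops" "y \<in> bops"
    "\<And>i j. blinfun_apply x (ket i \<otimes>\<^sub>v ket j) = blinfun_apply y (ket i \<otimes>\<^sub>v ket j)"
  shows "x = y"
  by (rule bops_eqI) (use assms in \<open>auto simp: ket_vtensor\<close>)

lemma otensor_compose:
  "\<lbrakk>x \<in> bops; y \<in> bops; x' \<in> bops; y' \<in> bops\<rbrakk> \<Longrightarrow> (x \<otimes>\<^sub>o y) o\<^sub>L (x' \<otimes>\<^sub>o y') = (x o\<^sub>L x') \<otimes>\<^sub>o (y o\<^sub>L y')"
  by (rule bops_vtensor_eqI) auto

lemma otensor_id [simp]: "id_blinfun \<otimes>\<^sub>o id_blinfun = id_blinfun"
  by (rule bops_vtensor_eqI) auto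

lemma otensor_linear:
  assumes [simp]: "x \<in> bops" "y \<in> bops" "z \<in> bops"
  shows "(x + y) \<otimes>\<^sub>o z = x \<otimes>\<^sub>o z + y \<otimes>\<^sub>o z" "z \<otimes>\<^sub>o (x + y) = z \<otimes>\<^sub>o x + z \<otimes>\<^sub>o y"
    "(x - y) \<otimes>\<^sub>o z = x \<otimes>\<^sub>o z - y \<otimes>\<^sub>o z" "z \<otimes>\<^sub>o (x - y) = z \<otimes>\<^sub>o x - z \<otimes>\<^sub>o y"
  by (rule bops_vtensor_eqI; simp add: blinfun.bilinear_simps vtensor_simps)+

lemma otensor_scaleR:
  assumes [simp]: "x \<in> bops" "z \<in> bops"
  shows "(r *\<^sub>R x) \<otimes>\<^sub>o z = r *\<^sub>R (x \<otimes>\<^sub>o z)" "z \<otimes>\<^sub>o (r *\<^sub>R x) = r *\<^sub>R (z \<otimes>\<^sub>o x)"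
  by (rule bops_vtensor_eqI; simp add: blinfun.bilinear_simps vtensor_simps)+

lemma otensor_zero [simp]: "x \<in> bops \<Longrightarrow> 0 \<otimes>\<^sub>o x = 0" "x \<in> bops \<Longrightarrow> x \<otimes>\<^sub>o 0 = 0"
  by (rule bops_vtensor_eqI; simp add: blinfun.bilinear_simps vtensor_simps)+

lemma otensor_uminus:
  assumes "x \<in> bops" "z \<in> bops"
  shows "(- x) \<otimes>\<^sub>o z = - (x \<otimes>\<^sub>o z)" "z \<otimes>\<^sub>o (- x) = - (z \<otimes>\<^sub>o x)"
  using otensor_scaleR[OF assms, of "- 1"] by simp_all

lemma otensor_sum_right:
  "x \<in> bops \<Longrightarrow> (\<And>i. i \<in> I \<Longrightarrow> f i \<in> bops) \<Longrightarrow> x \<otimes>\<^sub>o sum f I = (\<Sum>i\<in>I. x \<otimes>\<^sub>o f i)"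
  by (induction I rule: infinite_finite_induct) (auto simp: otensor_linear)

lemma otensor_adj [simp]:
  assumes [simp]: "x \<in> bops" "y \<in> bops"
  shows "adj (x \<otimes>\<^sub>o y) = adj x \<otimes>\<^sub>o adj y"
proof (intro bops_eqI ell2_eqI)
  fix p :: "'b \<times> 'd" and r :: "'a \<times> 'c"
  obtain i j k l where "p = (i, j)" "r = (k, l)" by fastforce
  then show "coord (blinfun_apply (adj (x \<otimes>\<^sub>o y)) (ket p)) r = coord (blinfun_apply (adj x \<otimes>\<^sub>o adj y) (ket p)) r"
    by (simp add: coord_adj_ket otensor_ket)
qed simp_all

lemma otensor_opow: "x \<in> bops \<Longrightarrow> y \<in> bops \<Longrightarrow> opow (x \<otimes>\<^sub>o y) n = opow x n \<otimes>\<^sub>o opow y n"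
  by (induction n) (simp_all add: opow_Suc otensor_compose)

lemmas ocomp_linear =
  bounded_bilinear.add_left[OF bounded_bilinear_blinfun_compose]
  bounded_bilinear.add_right[OF bounded_bilinear_blinfun_compose]
  bounded_bilinear.diff_left[OF bounded_bilinear_blinfun_compose]
  bounded_bilinear.diff_right[OF bounded_bilinear_blinfun_compose]
  bounded_bilinear.minus_left[OF bounded_bilinear_blinfun_compose]
  bounded_bilinear.minus_right[OF bounded_bilinear_blinfun_compose]
  bounded_bilinear.scaleR_left[OF bounded_bilinear_blinfun_compose]
  bounded_bilinear.scaleR_right[OF bounded_bilinear_blinfun_compose]

lemmas ocomp_zero [simp] =
  bounded_bilinear.zero_left[OF bounded_bilinear_blinfun_compose]
  bounded_bilinear.zero_right[OF bounded_bilinear_blinfun_compose]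

lemma ocomp_cong_tail: "x o\<^sub>L y = u \<Longrightarrow> x o\<^sub>L (y o\<^sub>L z) = u o\<^sub>L z"
  by (simp flip: blinfun_compose_assoc)

section \<open>Slicing with matrix units\<close>

definition munit :: "'i \<Rightarrow> 'i \<Rightarrow> ('i, 'i) opr" where
  "munit i j = on_basis (\<lambda>k. of_bool (k = j) *\<^sub>R ket i)"

lemma munit_bops [simp]: "munit i j \<in> bops"
  and munit_ket: "blinfun_apply (munit i j) (ket k) = of_bool (k = j) *\<^sub>R ket i"
  unfolding munit_def
  by (rule on_basis_weighted[where c = "\<lambda>k. of_bool (k = j)" and g = "\<lambda>_. i" and K = 1];
      simp add: inj_on_def)+

lemma adj_munit [simp]: "adj (munit i j) = munit j i"
  by (intro bops_eqI ell2_eqI) (auto simp: coord_adj_ket munit_ket coord_simps coord_ket)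

lemma munit_compose: "munit i j o\<^sub>L munit k l = of_bool (j = k) *\<^sub>R munit i l"
  by (rule bops_eqI) (auto simp: munit_ket blinfun.bilinear_simps)

text \<open>The isometry appending the basis vector \<open>ket n\<close> as second tensor factor.
  Compressing between two of these isometries is slicing with basis vectors, so slices become
  products of operators.\<close>

definition kappa :: "'k \<Rightarrow> ('i, 'i \<times> 'k) opr" where
  "kappa n = basis_map (\<lambda>i. (i, n))"

lemma kappa_bops [simp]: "kappa n \<in> bops"
  by (simp add: kappa_def basis_map_bops inj_def)

lemma kappa_ket: "blinfun_apply (kappa n) (ket i) = ket (i, n)"
  by (simp add: kappa_def basis_map_ket inj_def)

lemma kappa_apply: "blinfun_apply (kappa n) \<xi> = \<xi> \<otimes>\<^sub>v ket n"
proof (rule ell2_eqI, clarify)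
  fix i m
  show "coord (blinfun_apply (kappa n) \<xi>) (i, m) = coord (\<xi> \<otimes>\<^sub>v ket n) (i, m)"
  proof (cases "m = n")
    case True
    then show ?thesis
      using coord_basis_map[of "\<lambda>i. (i, n)" \<xi> i] by (simp add: kappa_def inj_def coord_ket)
  next
    case False
    have "((\<lambda>k. coord (cmul (coord \<xi> k) (blinfun_apply (kappa n) (ket k))) (i, m))
        has_sum coord (blinfun_apply (kappa n) \<xi>) (i, m)) UNIV"
      using has_sum_bounded_linear[OF bounded_linear_coord bops_expansion[OF kappa_bops]] by (simp add: o_def)
    then have "coord (blinfun_apply (kappa n) \<xi>) (i, m) = 0"
      by (rule has_sum_unique) (use False in \<open>auto intro!: has_sum_0 simp: kappa_ket coord_ket\<close>)
    then show ?thesis using False by (simp add: coord_ket)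
  qed
qed

lemma adj_kappa_kappa [simp]: "adj (kappa n) o\<^sub>L kappa n = id_blinfun"
  by (simp add: kappa_def basis_map_isometry inj_def)

lemma adj_kappa_ket: "blinfun_apply (adj (kappa n)) (ket (i, m)) = of_bool (m = n) *\<^sub>R ket i"
  by (rule ell2_eqI) (auto simp: coord_adj_ket kappa_ket coord_ket coord_simps)

lemma otensor_munit: "x \<in> bops \<Longrightarrow> kappa m o\<^sub>L x o\<^sub>L adj (kappa n) = x \<otimes>\<^sub>o munit m n"
  by (rule bops_vtensor_eqI)
    (auto simp: ket_vtensor adj_kappa_ket munit_ket otensor_ket blinfun.bilinear_simps vtensor_simps kappa_apply)

text \<open>Slices are carried along in the form \<open>x \<otimes> munit m n\<close>, which keeps
  them in the tensor product where the relations live; this cancellation recovers \<open>x\<close>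
  at the end.\<close>

lemma otensor_munit_cancel: "x \<in> bops \<Longrightarrow> y \<in> bops \<Longrightarrow> x \<otimes>\<^sub>o munit m n = y \<otimes>\<^sub>o munit m n \<Longrightarrow> x = y"
  by (metis (no_types, lifting) otensor_munit adj_kappa_kappa blinfun_compose_assoc blinfun_compose_id)

lemma vec_slice2_ket:
  assumes "G \<in> bops"
  shows "vec_slice\<^sub>2 (ket n) (ket m) G = adj (kappa m) o\<^sub>L G o\<^sub>L kappa n"
  unfolding vec_slice\<^sub>2_def
proof (rule the_equality)
  show *: "adj (kappa m) o\<^sub>L G o\<^sub>L kappa n \<in> bops \<and> (\<forall>\<zeta> \<zeta>'. cinner (blinfun_apply (adj (kappa m) o\<^sub>L G o\<^sub>L kappa n) \<zeta>) \<zeta>' =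
     cinner (blinfun_apply G (\<zeta> \<otimes>\<^sub>v ket n)) (\<zeta>' \<otimes>\<^sub>v ket m))"
    using assms by (simp add: cinner_adj' kappa_apply)
  fix z
  assume "z \<in> bops \<and> (\<forall>\<zeta> \<zeta>'. cinner (blinfun_apply z \<zeta>) \<zeta>' =
     cinner (blinfun_apply G (\<zeta> \<otimes>\<^sub>v ket n)) (\<zeta>' \<otimes>\<^sub>v ket m))"
  with * show "z = adj (kappa m) o\<^sub>L G o\<^sub>L kappa n"
    by (intro blinfun_eqI ell2_eqI) (metis cinner_ket_right)
qed

text \<open>In this form a slice is a product inside the tensor product algebra, so homomorphisms
  and leg embeddings can be applied to it factor by factor.\<close>

lemma munit_slice:
  assumes "G \<in> bops"
  shows "(id_blinfun \<otimes>\<^sub>o munit k m) o\<^sub>L G o\<^sub>L (id_blinfun \<otimes>\<^sub>o munit n l)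
    = vec_slice\<^sub>2 (ket n) (ket m) G \<otimes>\<^sub>o munit k l"
  using assms by (simp add: vec_slice2_ket flip: otensor_munit) (simp add: blinfun_compose_assoc)

lemma column_eqI:
  assumes "x \<in> bops" "y \<in> bops"
    and "\<And>n. x o\<^sub>L (id_blinfun \<otimes>\<^sub>o munit n l) = y o\<^sub>L (id_blinfun \<otimes>\<^sub>o munit n l)"
  shows "x = y"
proof (rule bops_vtensor_eqI[OF assms(1,2)])
  fix i n
  show "blinfun_apply x (ket i \<otimes>\<^sub>v ket n) = blinfun_apply y (ket i \<otimes>\<^sub>v ket n)"
    using arg_cong[OF assms(3)[of n], of "\<lambda>z. blinfun_apply z (ket i \<otimes>\<^sub>v ket l)"]
    by (simp add: munit_ket)
qed

text \<open>Rows are the columns of the adjoint.\<close>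

lemma row_eqI:
  assumes [simp]: "x \<in> bops" "y \<in> bops"
    and *: "\<And>k. (id_blinfun \<otimes>\<^sub>o munit l k) o\<^sub>L x = (id_blinfun \<otimes>\<^sub>o munit l k) o\<^sub>L y"
  shows "x = y"
proof -
  have "adj x = adj y"
    by (rule column_eqI[where l = l]) (use arg_cong[OF *, of adj] in simp_all)
  then show ?thesis by (metis adj_adj assms(1,2))
qed

section \<open>The generators of quantum \<open>SU(2)\<close>\<close>

definition A_op :: "real \<Rightarrow> (nat, nat) opr" where
  "A_op q = on_basis (\<lambda>k. sqrt (1 - q ^ (2 * k)) *\<^sub>R ket (k - 1))"

definition B_op :: "real \<Rightarrow> (nat, nat) opr" where
  "B_op q = on_basis (\<lambda>k. (q ^ k) *\<^sub>R ket k)"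

lemma bishift_eq: "bishift = basis_map (\<lambda>k. k + 1)"
  by (simp add: bishift_def basis_map_def)

lemma bishift_bops [simp]: "bishift \<in> bops"
  and bishift_ket: "blinfun_apply bishift (ket k) = ket (k + 1)"
  and norm_bishift: "norm bishift \<le> 1"
  and bishift_unitary: "adj bishift o\<^sub>L bishift = id_blinfun" "bishift o\<^sub>L adj bishift = id_blinfun"
proof -
  have b: "bij (\<lambda>k::int. k + 1)" by (rule bijI') (auto intro: exI[of _ "_ - 1"] simp: algebra_simps)
  show "bishift \<in> bops" "blinfun_apply bishift (ket k) = ket (k + 1)" "norm bishift \<le> 1"
    "adj bishift o\<^sub>L bishift = id_blinfun" "bishift o\<^sub>L adj bishift = id_blinfun"
    unfolding bishift_eq using b
    by (simp_all add: basis_map_bops basis_map_ket norm_basis_map basis_map_isometry basis_map_unitary bij_is_inj)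
qed

lemma adj_bishift_ket: "blinfun_apply (adj bishift) (ket k) = ket (k - 1)"
  by (rule ell2_eqI) (auto simp: coord_adj_ket bishift_ket coord_ket)

lemma v0_bops [simp]: "v0 \<in> bops"
  and v0_ket: "blinfun_apply v0 (ket (i, k)) = ket (i - 1, k)"
  and v0_unitary: "adj v0 o\<^sub>L v0 = id_blinfun" "v0 o\<^sub>L adj v0 = id_blinfun"
  by (simp_all add: v0_def otensor_ket adj_bishift_ket ket_vtensor otensor_compose bishift_unitary)

context
  fixes q :: real
  assumes q: "0 < q" "q < 1"
begin

lemma qpow_le: "q ^ n \<le> 1" "0 \<le> q ^ n" and qpow_pos: "0 < q ^ n"
  using q by (simp_all add: power_le_one)

lemma qpow_less: "0 < n \<Longrightarrow> q ^ n < 1"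
  using q by (simp add: power_less_one_iff)

text \<open>The weight vanishes exactly at the index where \<open>k - 1\<close> is truncated, hence
  \<open>k - 1\<close> is injective on the support of the weight.\<close>

lemma sqrt_zero_iff: "sqrt (1 - q ^ (2 * k)) = 0 \<longleftrightarrow> k = 0"
  using qpow_less[of "2 * k"] by (cases "k = 0") auto

lemma A_op_bops [simp]: "A_op q \<in> bops"
  and A_op_ket: "blinfun_apply (A_op q) (ket k) = sqrt (1 - q ^ (2 * k)) *\<^sub>R ket (k - 1)"
  unfolding A_op_def
  by (rule on_basis_weighted[where c = "\<lambda>k. sqrt (1 - q ^ (2 * k))" and g = "\<lambda>k. k - 1" and K = 1];
      use sqrt_zero_iff qpow_le in \<open>auto simp: inj_on_def\<close>)+

lemma B_op_bops [simp]: "B_op q \<in> bops"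
  and B_op_ket: "blinfun_apply (B_op q) (ket k) = (q ^ k) *\<^sub>R ket k"
  and norm_B_op: "norm (B_op q) \<le> 1"
  unfolding B_op_def
  by (rule on_basis_weighted[where c = "\<lambda>k. q ^ k" and g = "\<lambda>k. k" and K = 1];
      use qpow_le in \<open>auto simp: q less_imp_le\<close>)+

lemma podles_X_bops [simp]: "podles_X q \<in> bops"
  and podles_X_ket: "blinfun_apply (podles_X q) (ket k) = (q ^ k * sqrt (1 - q ^ (2 * k))) *\<^sub>R ket (k - 1)"
  unfolding podles_X_def
  by (rule on_basis_weighted[where c = "\<lambda>k. q ^ k * sqrt (1 - q ^ (2 * k))" and g = "\<lambda>k. k - 1" and K = 1];
      use sqrt_zero_iff qpow_le q in \<open>auto intro!: mult_le_one simp: abs_mult inj_on_def\<close>)+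

lemma podles_Z_bops [simp]: "podles_Z q \<in> bops"
  and podles_Z_ket: "blinfun_apply (podles_Z q) (ket k) = (q ^ (2 * k)) *\<^sub>R ket k"
  unfolding podles_Z_def
  by (rule on_basis_weighted[where c = "\<lambda>k. q ^ (2 * k)" and g = "\<lambda>k. k" and K = 1];
      use qpow_le in \<open>auto\<close>)+

lemma adj_A_op_ket: "blinfun_apply (adj (A_op q)) (ket k) = sqrt (1 - q ^ (2 * Suc k)) *\<^sub>R ket (Suc k)"
proof (rule ell2_eqI)
  fix i
  show "coord (blinfun_apply (adj (A_op q)) (ket k)) i = coord (sqrt (1 - q ^ (2 * Suc k)) *\<^sub>R ket (Suc k)) i"
    by (cases i) (auto simp: coord_adj_ket A_op_ket coord_ket coord_simps)
qed

lemma adj_B_op [simp]: "adj (B_op q) = B_op q"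
  by (intro bops_eqI ell2_eqI) (auto simp: coord_adj_ket B_op_ket coord_ket coord_simps)

lemma sqrt_square [simp]: "sqrt (1 - q ^ (2 * k)) * sqrt (1 - q ^ (2 * k)) = 1 - q ^ (2 * k)"
  using qpow_le(1)[of "2 * k"] by simp

text \<open>The relations of \<open>a_plus\<close> and \<open>b_plus\<close> with the phase
  \<open>S\<close> removed. The factor \<open>q * q\<close> in the third one arises because
  \<open>A adj A\<close> sees the weight at the raised index. The case distinctions on
  \<open>k\<close> isolate the truncated subtraction at 0.\<close>

lemma AB_relations:
  "A_op q o\<^sub>L B_op q = q *\<^sub>R (B_op q o\<^sub>L A_op q)"
  "B_op q o\<^sub>L adj (A_op q) = q *\<^sub>R (adj (A_op q) o\<^sub>L B_op q)"
  "A_op q o\<^sub>L adj (A_op q) = id_blinfun - (q * q) *\<^sub>R (B_op q o\<^sub>L B_op q)"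
  "adj (A_op q) o\<^sub>L A_op q = id_blinfun - (B_op q o\<^sub>L B_op q)"
proof -
  show "A_op q o\<^sub>L B_op q = q *\<^sub>R (B_op q o\<^sub>L A_op q)"
  proof (rule bops_eqI)
    fix k show "blinfun_apply (A_op q o\<^sub>L B_op q) (ket k) = blinfun_apply (q *\<^sub>R (B_op q o\<^sub>L A_op q)) (ket k)"
      by (cases k) (simp_all add: A_op_ket B_op_ket blinfun.bilinear_simps)
  qed simp_all
  show "B_op q o\<^sub>L adj (A_op q) = q *\<^sub>R (adj (A_op q) o\<^sub>L B_op q)"
    by (rule bops_eqI) (simp_all add: adj_A_op_ket B_op_ket blinfun.bilinear_simps)
  show "A_op q o\<^sub>L adj (A_op q) = id_blinfun - (q * q) *\<^sub>R (B_op q o\<^sub>L B_op q)"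
  proof (rule bops_eqI)
    fix k
    have "sqrt (1 - q ^ (2 * Suc k)) * sqrt (1 - q ^ (2 * Suc k)) = 1 - q * q * (q ^ k * q ^ k)"
      unfolding sqrt_square by (simp add: power_add mult_2)
    then show "blinfun_apply (A_op q o\<^sub>L adj (A_op q)) (ket k) = blinfun_apply (id_blinfun - (q * q) *\<^sub>R (B_op q o\<^sub>L B_op q)) (ket k)"
      by (simp add: A_op_ket adj_A_op_ket B_op_ket blinfun.bilinear_simps scaleR_diff_left del: mult_Suc_right power_Suc)
  qed simp_all
  show "adj (A_op q) o\<^sub>L A_op q = id_blinfun - (B_op q o\<^sub>L B_op q)"
  proof (rule bops_eqI)
    fix k
    show "blinfun_apply (adj (A_op q) o\<^sub>L A_op q) (ket k) = blinfun_apply (id_blinfun - (B_op q o\<^sub>L B_op q)) (ket k)"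
    proof (cases k)
      case (Suc m)
      have "sqrt (1 - q ^ (2 * k)) * sqrt (1 - q ^ (2 * k)) = 1 - q ^ k * q ^ k"
        unfolding sqrt_square by (simp add: power_add mult_2)
      then show ?thesis using Suc
        by (simp add: A_op_ket adj_A_op_ket B_op_ket blinfun.bilinear_simps scaleR_diff_left del: mult_Suc_right power_Suc)
    qed (simp add: A_op_ket adj_A_op_ket B_op_ket blinfun.bilinear_simps)
  qed simp_all
qed

lemma podles_X_eq: "podles_X q = q *\<^sub>R (B_op q o\<^sub>L A_op q)"
proof (rule bops_eqI)
  fix k show "blinfun_apply (podles_X q) (ket k) = blinfun_apply (q *\<^sub>R (B_op q o\<^sub>L A_op q)) (ket k)"
    by (cases k) (simp_all add: A_op_ket B_op_ket podles_X_ket blinfun.bilinear_simps mult_ac)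
qed simp_all

lemma podles_Z_eq: "podles_Z q = B_op q o\<^sub>L B_op q"
  by (rule bops_eqI) (simp_all add: B_op_ket podles_Z_ket blinfun.bilinear_simps power_add mult_2)

lemma a_plus_eq: "a_plus q = A_op q \<otimes>\<^sub>o id_blinfun"
  and b_plus_eq: "b_plus q = B_op q \<otimes>\<^sub>o bishift"
  by (simp_all add: a_plus_def A_op_def b_plus_def B_op_def)

lemma a_plus_bops [simp]: "a_plus q \<in> bops" and b_plus_bops [simp]: "b_plus q \<in> bops"
  by (simp_all add: a_plus_eq b_plus_eq)

lemma ab_relations:
  "a_plus q o\<^sub>L b_plus q = q *\<^sub>R (b_plus q o\<^sub>L a_plus q)"
  "a_plus q o\<^sub>L adj (b_plus q) = q *\<^sub>R (adj (b_plus q) o\<^sub>L a_plus q)"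
  "b_plus q o\<^sub>L adj (a_plus q) = q *\<^sub>R (adj (a_plus q) o\<^sub>L b_plus q)"
  "adj (b_plus q) o\<^sub>L adj (a_plus q) = q *\<^sub>R (adj (a_plus q) o\<^sub>L adj (b_plus q))"
  "b_plus q o\<^sub>L adj (b_plus q) = adj (b_plus q) o\<^sub>L b_plus q"
  "a_plus q o\<^sub>L adj (a_plus q) = id_blinfun - (q * q) *\<^sub>R (adj (b_plus q) o\<^sub>L b_plus q)"
  "adj (a_plus q) o\<^sub>L a_plus q = id_blinfun - (adj (b_plus q) o\<^sub>L b_plus q)"
  by (simp_all add: a_plus_eq b_plus_eq otensor_compose AB_relations bishift_unitary otensor_scaleR
      otensor_linear)

end

context
  fixes q :: real
  assumes q: "0 < q" "q < 1"
begin

section \<open>The q-shifted factorials and the operator \<open>L0plus\<close>\<close>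

lemma qpoch_0 [simp]: "qpoch q 0 = 1"
  and qpoch_Suc: "qpoch q (Suc n) = qpoch q n * (1 - q ^ (2 * Suc n))"
  by (simp_all add: qpoch_def)

lemma qpoch_pos: "0 < qpoch q n"
  using qpow_less[OF q] by (auto simp: qpoch_def intro!: prod_pos)

text \<open>Comparison with the geometric series makes the product absolutely convergent, and no
  factor vanishes, so neither does the limit. The upper bound holds because the partial products
  decrease.\<close>

lemma qpoch_inf_bounds: "0 < qpoch_inf q" "qpoch_inf q \<le> qpoch q n"
proof -
  have "summable (\<lambda>k. q ^ (2 * Suc k))"
    by (rule summable_comparison_test'[of "\<lambda>k. q ^ k" 0]) (use q in \<open>auto intro!: power_decreasing simp del: power_Suc\<close>)
  then have s: "abs_convergent_prod (\<lambda>k. 1 - q ^ (2 * Suc k))"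
    unfolding abs_convergent_prod_conv_summable using q by (simp del: power_Suc mult_Suc_right)
  have nz: "1 - q ^ (2 * Suc k) > 0" for k
    using qpow_less[OF q, of "2 * Suc k"] by simp
  have lim: "(\<lambda>n. \<Prod>k\<le>n. 1 - q ^ (2 * Suc k)) \<longlonglongrightarrow> qpoch_inf q"
    unfolding qpoch_inf_def by (rule convergent_prod_LIMSEQ[OF abs_convergent_prod_imp_convergent_prod[OF s]])
  have eq: "(\<Prod>k\<le>n. 1 - q ^ (2 * Suc k)) = qpoch q (Suc n)" for n
    by (induction n) (simp_all add: qpoch_Suc)
  have dec: "qpoch q n \<le> qpoch q m" if "m \<le> n" for m n
    using that
  proof (induction n rule: dec_induct)
    case (step n)
    have "qpoch q (Suc n) \<le> qpoch q n"
      unfolding qpoch_Suc using qpoch_pos[of n] q by (intro mult_left_le) auto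
    with step show ?case by linarith
  qed simp
  show "qpoch_inf q \<le> qpoch q n"
    by (rule LIMSEQ_le_const2[OF lim]) (auto simp: eq intro!: dec exI[of _ n] simp del: power_Suc mult_Suc_right)
  have "qpoch_inf q \<noteq> 0"
    unfolding qpoch_inf_def
    using abs_convergent_prod_imp_convergent_prod[OF s] nz by (intro prodinf_nonzero) (auto simp: less_le)
  moreover have "0 \<le> qpoch_inf q"
    by (rule LIMSEQ_le_const[OF lim]) (auto simp: eq intro!: less_imp_le qpoch_pos simp del: power_Suc mult_Suc_right)
  ultimately show "0 < qpoch_inf q" by simp
qed

lemma L0plus_bops [simp]: "L0plus q \<in> bops"
  and L0plus_ket: "blinfun_apply (L0plus q) (ket (n, k)) = sqrt (qpoch_inf q / qpoch q n) *\<^sub>R ket (int n, k)"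
  and norm_L0plus: "norm (L0plus q) \<le> 1"
proof -
  define c :: "nat \<times> int \<Rightarrow> real" where "c = (\<lambda>(n, k). sqrt (qpoch_inf q / qpoch q n))"
  define h :: "nat \<times> int \<Rightarrow> int \<times> int" where "h = (\<lambda>(n, k). (int n, k))"
  have "\<bar>c p\<bar> \<le> 1" for p
  proof -
    obtain n k where "p = (n, k)" by fastforce
    moreover have "0 \<le> qpoch_inf q / qpoch q n" "qpoch_inf q / qpoch q n \<le> 1"
      using qpoch_inf_bounds(1) qpoch_inf_bounds(2)[of n] qpoch_pos[of n] by simp_all
    ultimately show ?thesis by (simp add: c_def)
  qed
  moreover have "inj_on h {p. c p \<noteq> 0}" by (auto simp: h_def inj_on_def)
  moreover have "(\<lambda>(n, k). sqrt (qpoch_inf q / qpoch q n) *\<^sub>R ket (int n, k)) p = c p *\<^sub>R ket (h p)" for p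
    by (cases p) (simp add: c_def h_def)
  ultimately have "L0plus q \<in> bops" "blinfun_apply (L0plus q) (ket p) = c p *\<^sub>R ket (h p)" "norm (L0plus q) \<le> 1" for p
    unfolding L0plus_def by (simp_all add: on_basis_weighted[of _ c h 1])
  then show "L0plus q \<in> bops" "norm (L0plus q) \<le> 1"
    "blinfun_apply (L0plus q) (ket (n, k)) = sqrt (qpoch_inf q / qpoch q n) *\<^sub>R ket (int n, k)"
    by (simp_all add: c_def h_def)
qed

text \<open>The weights of \<open>L0plus\<close> are made for this identity: the factor of
  \<open>adj a\<close> at \<open>n\<close> turns \<open>(q^2;q^2)_(n+1)\<close> into
  \<open>(q^2;q^2)_n\<close> under the root, and \<open>v0\<close> undoes the raising of the
  index.\<close>

lemma v0_L0plus_a: "v0 o\<^sub>L L0plus q o\<^sub>L adj (a_plus q) = L0plus q"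
proof (rule bops_eqI)
  fix p :: "nat \<times> int"
  obtain n k where p: "p = (n, k)" by fastforce
  have *: "sqrt (1 - q ^ (2 * Suc n)) * sqrt (qpoch_inf q / qpoch q (Suc n)) = sqrt (qpoch_inf q / qpoch q n)"
    unfolding qpoch_Suc real_sqrt_mult[symmetric] using qpow_less[OF q, of "2 * Suc n"] qpoch_pos[of n]
    by (simp add: field_simps)
  have "blinfun_apply (adj (a_plus q)) (ket p) = sqrt (1 - q ^ (2 * Suc n)) *\<^sub>R ket (Suc n, k)"
    by (simp only: p a_plus_eq[OF q] otensor_adj A_op_bops[OF q] bops_id adj_id otensor_ket bops_adj adj_A_op_ket[OF q]
        vtensor_simps ket_vtensor id_blinfun.rep_eq id_apply)
  then show "blinfun_apply (v0 o\<^sub>L L0plus q o\<^sub>L adj (a_plus q)) (ket p) = blinfun_apply (L0plus q) (ket p)"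
    by (simp add: blinfun.bilinear_simps L0plus_ket v0_ket p * del: mult_Suc_right power_Suc)
qed (simp_all add: q)

lemma opow_b_a:
  "opow (b_plus q) n o\<^sub>L adj (a_plus q) = q ^ n *\<^sub>R (adj (a_plus q) o\<^sub>L opow (b_plus q) n)"
proof (induction n)
  case (Suc n)
  have "opow (b_plus q) (Suc n) o\<^sub>L adj (a_plus q) = b_plus q o\<^sub>L (opow (b_plus q) n o\<^sub>L adj (a_plus q))"
    by (simp add: opow_Suc blinfun_compose_assoc)
  also have "\<dots> = q ^ n *\<^sub>R ((b_plus q o\<^sub>L adj (a_plus q)) o\<^sub>L opow (b_plus q) n)"
    unfolding Suc by (simp add: ocomp_linear blinfun_compose_assoc)
  also have "\<dots> = q ^ Suc n *\<^sub>R (adj (a_plus q) o\<^sub>L opow (b_plus q) (Suc n))"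
    unfolding ab_relations[OF q] by (simp add: ocomp_linear blinfun_compose_assoc opow_Suc)
  finally show ?case .
qed simp

lemma ab_sum:
  "(b_plus q o\<^sub>L adj (b_plus q)) + (adj (a_plus q) o\<^sub>L a_plus q) = id_blinfun"
  by (simp add: ab_relations[OF q])

lemma A_op_munit:
  "adj (A_op q) o\<^sub>L munit n l = sqrt (1 - q ^ (2 * Suc n)) *\<^sub>R munit (Suc n) l"
  "munit l n o\<^sub>L A_op q = sqrt (1 - q ^ (2 * Suc n)) *\<^sub>R munit l (Suc n)"
  "A_op q o\<^sub>L munit 0 l = 0"
  "munit 0 0 o\<^sub>L adj (A_op q) = 0"
proof -
  show 1: "adj (A_op q) o\<^sub>L munit n l = sqrt (1 - q ^ (2 * Suc n)) *\<^sub>R munit (Suc n) l" for n l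
    by (rule bops_eqI)
      (simp_all add: munit_ket adj_A_op_ket[OF q] blinfun.bilinear_simps q del: mult_Suc_right power_Suc)
  from arg_cong[OF this[of n l], of adj]
  show "munit l n o\<^sub>L A_op q = sqrt (1 - q ^ (2 * Suc n)) *\<^sub>R munit l (Suc n)"
    by (simp add: q del: mult_Suc_right power_Suc)
  show 3: "A_op q o\<^sub>L munit 0 l = 0" for l
    by (rule bops_eqI) (simp_all add: munit_ket A_op_ket[OF q] blinfun.bilinear_simps q)
  from arg_cong[OF this[of 0], of adj]
  show "munit 0 0 o\<^sub>L adj (A_op q) = 0"
    \<comment> \<open>With both arguments 0 this says that the adjoint of 0 is 0.\<close>
    using adj_scaleR[of 0 0] by (simp add: q)
qed

lemma B_op_munit:
  "B_op q o\<^sub>L munit n l = q ^ n *\<^sub>R munit n l"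
  "munit l n o\<^sub>L B_op q = q ^ n *\<^sub>R munit l n"
proof -
  show 1: "B_op q o\<^sub>L munit n l = q ^ n *\<^sub>R munit n l" for n l
    by (rule bops_eqI) (simp_all add: munit_ket B_op_ket[OF q] blinfun.bilinear_simps q)
  from arg_cong[OF this[of n l], of adj]
  show "munit l n o\<^sub>L B_op q = q ^ n *\<^sub>R munit l n"
    by (simp add: q)
qed

end

section \<open>Intertwining relations of the corepresentation\<close>

definition C_op :: "real \<Rightarrow> ((nat \<times> int) \<times> nat, (nat \<times> int) \<times> nat) opr" where
  "C_op q = adj (b_plus q) \<otimes>\<^sub>o adj (A_op q) + a_plus q \<otimes>\<^sub>o B_op q"

definition D_op :: "real \<Rightarrow> ((nat \<times> int) \<times> nat, (nat \<times> int) \<times> nat) opr" where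
  "D_op q = a_plus q \<otimes>\<^sub>o A_op q - q *\<^sub>R (adj (b_plus q) \<otimes>\<^sub>o B_op q)"

text \<open>The assumption \<open>intertwining\<close> is
  \<open>(1 \<otimes> X) \<G> = \<G> \<alpha>(X)\<close> with the computed value of
  \<open>\<alpha>(X)\<close> inserted, so that the relations below are pure operator identities for
  \<open>\<G>\<close>.\<close>

locale podles_corepresentation =
  fixes q :: real and \<G> :: "((nat \<times> int) \<times> nat, (int \<times> int) \<times> nat) opr"
  assumes q: "0 < q" "q < 1"
    and unitary: "unitary_op \<G>"
    and intertwining: "(id_blinfun \<otimes>\<^sub>o podles_X q) o\<^sub>L \<G> = q *\<^sub>R (\<G> o\<^sub>L (C_op q o\<^sub>L D_op q))"
    and row_zero: "\<And>n. vec_slice\<^sub>2 (ket n) (ket 0) \<G> =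
      (1 / sqrt (qpoch q n)) *\<^sub>R (opow v0 n o\<^sub>L L0plus q o\<^sub>L opow (b_plus q) n)"
begin

abbreviation "s n \<equiv> sqrt (1 - q ^ (2 * n))"
abbreviation "entry m n \<equiv> vec_slice\<^sub>2 (ket n) (ket m) \<G>"

lemma bops [simp]: "\<G> \<in> bops" "a_plus q \<in> bops" "b_plus q \<in> bops" "A_op q \<in> bops" "B_op q \<in> bops"
  "L0plus q \<in> bops" "v0 \<in> bops" "C_op q \<in> bops" "D_op q \<in> bops" "podles_X q \<in> bops"
  using unitary q by (simp_all add: unitary_op_def C_op_def D_op_def)

lemma entry_bops [simp]: "entry m n \<in> bops"
  by (simp add: vec_slice2_ket)

lemma s_pos: "0 < n \<Longrightarrow> 0 < s n"
  using qpow_less[OF q, of "2 * n"] by simp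

lemma sqrt_qpoch_Suc: "s (Suc n) * (1 / sqrt (qpoch q (Suc n))) = 1 / sqrt (qpoch q n)"
  using s_pos[of "Suc n"] by (simp add: qpoch_Suc[OF q] real_sqrt_mult del: mult_Suc_right power_Suc)

lemma entry_otensor: "entry m n \<otimes>\<^sub>o munit k l = (id_blinfun \<otimes>\<^sub>o munit k m) o\<^sub>L (\<G> o\<^sub>L (id_blinfun \<otimes>\<^sub>o munit n l))"
  using munit_slice[of \<G> k m n l] by (simp add: blinfun_compose_assoc)

text \<open>The coefficient \<open>s (Suc n)\<close> is that of \<open>adj A\<close> on
  \<open>ket n\<close>, and \<open>q ^ n\<close> in the next recursion is that of \<open>B\<close>.
  Together the two recursions let \<open>adj A\<close> and \<open>B\<close> in the second leg of row
  zero be traded for \<open>b\<close> and \<open>adj a\<close> in the first leg, at the price of one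
  \<open>v0\<close>.\<close>

lemma row_zero_b: "v0 o\<^sub>L entry 0 n o\<^sub>L b_plus q = s (Suc n) *\<^sub>R entry 0 (Suc n)"
  by (simp only: row_zero scaleR_scaleR sqrt_qpoch_Suc ocomp_linear)
    (simp add: blinfun_compose_assoc opow_Suc[of v0] opow_Suc2[of "b_plus q"])

lemma row_zero_a: "v0 o\<^sub>L entry 0 n o\<^sub>L adj (a_plus q) = q ^ n *\<^sub>R entry 0 n"
proof -
  have "v0 o\<^sub>L (opow v0 n o\<^sub>L L0plus q o\<^sub>L opow (b_plus q) n) o\<^sub>L adj (a_plus q) =
    opow v0 (Suc n) o\<^sub>L L0plus q o\<^sub>L (opow (b_plus q) n o\<^sub>L adj (a_plus q))"
    by (simp add: opow_Suc blinfun_compose_assoc)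
  also have "\<dots> = q ^ n *\<^sub>R (opow v0 n o\<^sub>L (v0 o\<^sub>L L0plus q o\<^sub>L adj (a_plus q)) o\<^sub>L opow (b_plus q) n)"
    unfolding opow_b_a[OF q] by (simp add: opow_Suc2 blinfun_compose_assoc ocomp_linear)
  finally show ?thesis
    unfolding v0_L0plus_a[OF q] by (simp add: row_zero ocomp_linear mult.commute)
qed

lemma row_zero_A: "(id_blinfun \<otimes>\<^sub>o munit 0 0) o\<^sub>L \<G> o\<^sub>L (id_blinfun \<otimes>\<^sub>o adj (A_op q))
    = (v0 \<otimes>\<^sub>o munit 0 0) o\<^sub>L \<G> o\<^sub>L (b_plus q \<otimes>\<^sub>o id_blinfun)" (is "?l = ?r")
proof (rule column_eqI[where l = 0])
  fix n
  have "?l o\<^sub>L (id_blinfun \<otimes>\<^sub>o munit n 0) = s (Suc n) *\<^sub>R (entry 0 (Suc n) \<otimes>\<^sub>o munit 0 0)"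
    by (simp add: entry_otensor blinfun_compose_assoc otensor_compose A_op_munit[OF q] otensor_scaleR ocomp_linear
        del: mult_Suc_right power_Suc)
  also have "\<dots> = (v0 \<otimes>\<^sub>o id_blinfun) o\<^sub>L (entry 0 n \<otimes>\<^sub>o munit 0 0) o\<^sub>L (b_plus q \<otimes>\<^sub>o id_blinfun)"
    by (simp add: otensor_compose row_zero_b otensor_scaleR del: mult_Suc_right power_Suc)
  also have "\<dots> = ?r o\<^sub>L (id_blinfun \<otimes>\<^sub>o munit n 0)"
    by (simp add: entry_otensor blinfun_compose_assoc otensor_compose otensor_compose[THEN ocomp_cong_tail])
  finally show "?l o\<^sub>L (id_blinfun \<otimes>\<^sub>o munit n 0) = ?r o\<^sub>L (id_blinfun \<otimes>\<^sub>o munit n 0)" .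
qed simp_all

lemma row_zero_B: "(id_blinfun \<otimes>\<^sub>o munit 0 0) o\<^sub>L \<G> o\<^sub>L (id_blinfun \<otimes>\<^sub>o B_op q)
    = (v0 \<otimes>\<^sub>o munit 0 0) o\<^sub>L \<G> o\<^sub>L (adj (a_plus q) \<otimes>\<^sub>o id_blinfun)" (is "?l = ?r")
proof (rule column_eqI[where l = 0])
  fix n
  have "?l o\<^sub>L (id_blinfun \<otimes>\<^sub>o munit n 0) = q ^ n *\<^sub>R (entry 0 n \<otimes>\<^sub>o munit 0 0)"
    by (simp add: entry_otensor blinfun_compose_assoc otensor_compose B_op_munit[OF q] otensor_scaleR ocomp_linear)
  also have "\<dots> = (v0 \<otimes>\<^sub>o id_blinfun) o\<^sub>L (entry 0 n \<otimes>\<^sub>o munit 0 0) o\<^sub>L (adj (a_plus q) \<otimes>\<^sub>o id_blinfun)"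
    by (simp add: otensor_compose row_zero_a otensor_scaleR)
  also have "\<dots> = ?r o\<^sub>L (id_blinfun \<otimes>\<^sub>o munit n 0)"
    by (simp add: entry_otensor blinfun_compose_assoc otensor_compose otensor_compose[THEN ocomp_cong_tail])
  finally show "?l o\<^sub>L (id_blinfun \<otimes>\<^sub>o munit n 0) = ?r o\<^sub>L (id_blinfun \<otimes>\<^sub>o munit n 0)" .
qed simp_all

text \<open>This mirrors \<open>a adj b = q adj b a\<close> under the comultiplication, and lets
  \<open>C\<close> pass to the left of \<open>D\<close> in the induction for
  \<open>phase\<close>.\<close>

lemma D_C: "D_op q o\<^sub>L C_op q = q *\<^sub>R (C_op q o\<^sub>L D_op q)"
  by (simp add: C_op_def D_op_def ocomp_linear otensor_compose ab_relations(1-5)[OF q] AB_relations[OF q]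
      otensor_linear otensor_scaleR algebra_simps)

lemma phase: "(v0 \<otimes>\<^sub>o B_op q) o\<^sub>L \<G> = \<G> o\<^sub>L C_op q"
proof (rule row_eqI[where l = 0])
  fix k
  have "q ^ k *\<^sub>R ((v0 \<otimes>\<^sub>o munit 0 k) o\<^sub>L \<G>) = (id_blinfun \<otimes>\<^sub>o munit 0 k) o\<^sub>L (\<G> o\<^sub>L C_op q)"
  proof (induction k)
    case 0
    \<comment> \<open>The two summands of \<open>C\<close> meet row zero as \<open>adj A\<close> and
      \<open>B\<close>, which become \<open>b\<close> and \<open>adj a\<close>. With their own
      first-leg factors \<open>adj b\<close> and \<open>a\<close> these add up to
      \<open>b adj b + adj a a = 1\<close>.\<close>
    have "(id_blinfun \<otimes>\<^sub>o munit 0 0) o\<^sub>L (\<G> o\<^sub>L C_op q)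
      = ((id_blinfun \<otimes>\<^sub>o munit 0 0) o\<^sub>L \<G> o\<^sub>L (id_blinfun \<otimes>\<^sub>o adj (A_op q)) o\<^sub>L (adj (b_plus q) \<otimes>\<^sub>o id_blinfun))
      + ((id_blinfun \<otimes>\<^sub>o munit 0 0) o\<^sub>L \<G> o\<^sub>L (id_blinfun \<otimes>\<^sub>o B_op q) o\<^sub>L (a_plus q \<otimes>\<^sub>o id_blinfun))"
      by (simp add: C_op_def blinfun_compose_assoc otensor_compose ocomp_linear)
    also have "\<dots> = (v0 \<otimes>\<^sub>o munit 0 0) o\<^sub>L \<G> o\<^sub>L
      (((b_plus q o\<^sub>L adj (b_plus q)) + (adj (a_plus q) o\<^sub>L a_plus q)) \<otimes>\<^sub>o id_blinfun)"
      unfolding row_zero_A row_zero_B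
      by (simp add: blinfun_compose_assoc otensor_compose ocomp_linear otensor_linear)
    finally show ?case by (simp add: ab_sum[OF q])
  next
    case (Suc k)
    \<comment> \<open>The weight with which \<open>podles_X\<close> sends \<open>ket (k + 1)\<close>
      to \<open>ket k\<close>. Since it is nonzero, row \<open>k + 1\<close> can be reached from row
      \<open>k\<close> by multiplication with \<open>X\<close>.\<close>
    define x where "x = q ^ Suc k * s (Suc k)"
    have x: "x \<noteq> 0" using s_pos[of "Suc k"] q by (simp add: x_def del: mult_Suc_right power_Suc)
    have mX: "munit 0 k o\<^sub>L podles_X q = x *\<^sub>R munit 0 (Suc k)"
      by (simp add: podles_X_eq[OF q] ocomp_linear B_op_munit[OF q] A_op_munit[OF q] x_def flip: blinfun_compose_assoc
          del: mult_Suc_right)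
    have X: "(y \<otimes>\<^sub>o munit 0 k) o\<^sub>L ((id_blinfun \<otimes>\<^sub>o podles_X q) o\<^sub>L z) = x *\<^sub>R ((y \<otimes>\<^sub>o munit 0 (Suc k)) o\<^sub>L z)"
      if "y \<in> bops" for y :: "(int \<times> int, int \<times> int) opr" and z :: "((nat \<times> int) \<times> nat, (int \<times> int) \<times> nat) opr"
      using that by (simp add: otensor_compose[THEN ocomp_cong_tail] otensor_compose mX otensor_scaleR ocomp_linear)
    have "x *\<^sub>R ((id_blinfun \<otimes>\<^sub>o munit 0 (Suc k)) o\<^sub>L (\<G> o\<^sub>L C_op q))
      = (id_blinfun \<otimes>\<^sub>o munit 0 k) o\<^sub>L ((id_blinfun \<otimes>\<^sub>o podles_X q) o\<^sub>L \<G>) o\<^sub>L C_op q"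
      by (simp add: X ocomp_linear blinfun_compose_assoc)
    also have "\<dots> = q *\<^sub>R ((id_blinfun \<otimes>\<^sub>o munit 0 k) o\<^sub>L (\<G> o\<^sub>L (C_op q o\<^sub>L (D_op q o\<^sub>L C_op q))))"
      by (simp add: intertwining ocomp_linear blinfun_compose_assoc)
    \<comment> \<open>Replacing \<open>D C\<close> by \<open>q C D\<close> brings \<open>C\<close>
      next to \<open>\<G>\<close>, where the induction hypothesis applies; the remaining
      \<open>C D\<close> is then folded back into \<open>X\<close>.\<close>
    also have "\<dots> = q *\<^sub>R (q *\<^sub>R (((id_blinfun \<otimes>\<^sub>o munit 0 k) o\<^sub>L (\<G> o\<^sub>L C_op q)) o\<^sub>L (C_op q o\<^sub>L D_op q)))"
      unfolding D_C by (simp add: ocomp_linear blinfun_compose_assoc)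
    also have "\<dots> = (q * q ^ k) *\<^sub>R ((v0 \<otimes>\<^sub>o munit 0 k) o\<^sub>L (q *\<^sub>R (\<G> o\<^sub>L (C_op q o\<^sub>L D_op q))))"
      unfolding Suc[symmetric] by (simp add: ocomp_linear blinfun_compose_assoc mult_ac)
    also have "\<dots> = x *\<^sub>R (q ^ Suc k *\<^sub>R ((v0 \<otimes>\<^sub>o munit 0 (Suc k)) o\<^sub>L \<G>))"
      unfolding intertwining[symmetric] by (simp add: X mult_ac)
    finally show ?case by (rule scaleR_left_imp_eq[OF x, THEN sym])
  qed
  then show "(id_blinfun \<otimes>\<^sub>o munit 0 k) o\<^sub>L ((v0 \<otimes>\<^sub>o B_op q) o\<^sub>L \<G>) = (id_blinfun \<otimes>\<^sub>o munit 0 k) o\<^sub>L (\<G> o\<^sub>L C_op q)"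
    by (simp add: otensor_compose[THEN ocomp_cong_tail] otensor_compose B_op_munit[OF q] otensor_scaleR ocomp_linear)
qed simp_all

text \<open>\<open>B\<close> is diagonal with nonzero weights \<open>q ^ k\<close>, so it is
  cancelled one row at a time; its inverse would be unbounded.\<close>

lemma lowering: "(id_blinfun \<otimes>\<^sub>o A_op q) o\<^sub>L \<G> = (v0 \<otimes>\<^sub>o id_blinfun) o\<^sub>L \<G> o\<^sub>L D_op q"
proof (rule row_eqI[where l = 0])
  fix k
  have "q *\<^sub>R ((id_blinfun \<otimes>\<^sub>o B_op q) o\<^sub>L ((id_blinfun \<otimes>\<^sub>o A_op q) o\<^sub>L \<G>)) = (id_blinfun \<otimes>\<^sub>o podles_X q) o\<^sub>L \<G>"
    by (simp add: podles_X_eq[OF q] otensor_compose[THEN ocomp_cong_tail] otensor_compose otensor_scaleR ocomp_linear)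
  also have "\<dots> = q *\<^sub>R ((v0 \<otimes>\<^sub>o B_op q) o\<^sub>L \<G> o\<^sub>L D_op q)"
    by (simp add: intertwining phase blinfun_compose_assoc)
  also have "\<dots> = q *\<^sub>R ((id_blinfun \<otimes>\<^sub>o B_op q) o\<^sub>L ((v0 \<otimes>\<^sub>o id_blinfun) o\<^sub>L \<G> o\<^sub>L D_op q))"
    by (simp add: blinfun_compose_assoc otensor_compose[THEN ocomp_cong_tail] otensor_compose)
  finally have *: "(id_blinfun \<otimes>\<^sub>o B_op q) o\<^sub>L ((id_blinfun \<otimes>\<^sub>o A_op q) o\<^sub>L \<G>)
    = (id_blinfun \<otimes>\<^sub>o B_op q) o\<^sub>L ((v0 \<otimes>\<^sub>o id_blinfun) o\<^sub>L \<G> o\<^sub>L D_op q)"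
    using q by simp
  have B: "(id_blinfun \<otimes>\<^sub>o munit 0 k) o\<^sub>L ((id_blinfun \<otimes>\<^sub>o B_op q) o\<^sub>L z) = q ^ k *\<^sub>R ((id_blinfun \<otimes>\<^sub>o munit 0 k) o\<^sub>L z)"
    for z :: "((nat \<times> int) \<times> nat, (int \<times> int) \<times> nat) opr"
    by (simp add: otensor_compose[THEN ocomp_cong_tail] otensor_compose B_op_munit[OF q] otensor_scaleR ocomp_linear)
  from arg_cong[OF *, of "\<lambda>z. (id_blinfun \<otimes>\<^sub>o munit 0 k) o\<^sub>L z"] q
  show "(id_blinfun \<otimes>\<^sub>o munit 0 k) o\<^sub>L ((id_blinfun \<otimes>\<^sub>o A_op q) o\<^sub>L \<G>)
    = (id_blinfun \<otimes>\<^sub>o munit 0 k) o\<^sub>L ((v0 \<otimes>\<^sub>o id_blinfun) o\<^sub>L \<G> o\<^sub>L D_op q)"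
    by (simp add: B)
qed simp_all

text \<open>Unitarity of \<open>\<G>\<close> and \<open>v0\<close> turns \<open>lowering\<close>
  into a formula for \<open>D\<close> alone, \<open>D = adj \<G> (adj v0 \<otimes> A) \<G>\<close>,
  whose adjoint can be taken and moved back.\<close>

lemma raising: "(v0 \<otimes>\<^sub>o adj (A_op q)) o\<^sub>L \<G> = \<G> o\<^sub>L adj (D_op q)"
proof -
  have u: "adj \<G> o\<^sub>L \<G> = id_blinfun" "\<G> o\<^sub>L adj \<G> = id_blinfun"
    using unitary by (simp_all add: unitary_op_def)
  have "(adj v0 \<otimes>\<^sub>o A_op q) o\<^sub>L \<G> = (adj v0 \<otimes>\<^sub>o id_blinfun) o\<^sub>L ((id_blinfun \<otimes>\<^sub>o A_op q) o\<^sub>L \<G>)"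
    by (simp add: otensor_compose[THEN ocomp_cong_tail] otensor_compose)
  also have "\<dots> = \<G> o\<^sub>L D_op q"
    unfolding lowering
    by (simp add: otensor_compose[THEN ocomp_cong_tail] otensor_compose blinfun_compose_assoc v0_unitary)
  finally have "adj \<G> o\<^sub>L ((adj v0 \<otimes>\<^sub>o A_op q) o\<^sub>L \<G>) = D_op q"
    by (simp add: u[THEN ocomp_cong_tail])
  from arg_cong[OF this, of adj] have "adj (D_op q) = adj \<G> o\<^sub>L ((v0 \<otimes>\<^sub>o adj (A_op q)) o\<^sub>L \<G>)"
    by (simp add: blinfun_compose_assoc)
  then show ?thesis by (simp add: u[THEN ocomp_cong_tail])
qed

text \<open>\<open>adj D\<close> and \<open>C\<close> are combinations of
  \<open>1 \<otimes> adj A\<close> and \<open>1 \<otimes> B\<close> whose first-leg coefficients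
  form a unitary matrix over quantum SU(2). Inverting this matrix expresses
  \<open>1 \<otimes> adj A\<close> here, and \<open>1 \<otimes> B\<close> in
  \<open>column_B\<close>, through \<open>adj D\<close> and \<open>C\<close>, where
  \<open>raising\<close> and \<open>phase\<close> apply.\<close>

lemma column_A: "\<G> o\<^sub>L (id_blinfun \<otimes>\<^sub>o adj (A_op q)) =
    ((v0 \<otimes>\<^sub>o adj (A_op q)) o\<^sub>L \<G> o\<^sub>L (a_plus q \<otimes>\<^sub>o id_blinfun)) + ((v0 \<otimes>\<^sub>o B_op q) o\<^sub>L \<G> o\<^sub>L (b_plus q \<otimes>\<^sub>o id_blinfun))"
proof -
  have "(adj (D_op q) o\<^sub>L (a_plus q \<otimes>\<^sub>o id_blinfun)) + (C_op q o\<^sub>L (b_plus q \<otimes>\<^sub>o id_blinfun)) = id_blinfun \<otimes>\<^sub>o adj (A_op q)"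
    by (simp add: C_op_def D_op_def ocomp_linear otensor_compose ab_relations[OF q] AB_relations[OF q]
      adj_B_op[OF q] otensor_linear otensor_scaleR algebra_simps)
  then show ?thesis
    by (simp add: raising phase blinfun_compose_assoc flip: ocomp_linear(2))
qed

lemma column_B: "\<G> o\<^sub>L (id_blinfun \<otimes>\<^sub>o B_op q) =
    ((v0 \<otimes>\<^sub>o B_op q) o\<^sub>L \<G> o\<^sub>L (adj (a_plus q) \<otimes>\<^sub>o id_blinfun))
    - q *\<^sub>R ((v0 \<otimes>\<^sub>o adj (A_op q)) o\<^sub>L \<G> o\<^sub>L (adj (b_plus q) \<otimes>\<^sub>o id_blinfun))"
proof -
  have "(C_op q o\<^sub>L (adj (a_plus q) \<otimes>\<^sub>o id_blinfun)) - q *\<^sub>R (adj (D_op q) o\<^sub>L (adj (b_plus q) \<otimes>\<^sub>o id_blinfun)) = id_blinfun \<otimes>\<^sub>o B_op q"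
    by (simp add: C_op_def D_op_def ocomp_linear otensor_compose ab_relations[OF q] AB_relations[OF q]
      adj_B_op[OF q] otensor_linear otensor_scaleR algebra_simps)
  then show ?thesis
    by (simp add: raising phase blinfun_compose_assoc flip: ocomp_linear(4) ocomp_linear(8))
qed

lemma column_zero: "entry k 0 = (1 / sqrt (qpoch q k)) *\<^sub>R (opow v0 k o\<^sub>L L0plus q o\<^sub>L opow ((- q) *\<^sub>R adj (b_plus q)) k)"
proof (induction k)
  case 0
  show ?case by (simp add: row_zero)
next
  case (Suc k)
  have "s (Suc k) *\<^sub>R (entry (Suc k) 0 \<otimes>\<^sub>o munit 0 0)
    = (id_blinfun \<otimes>\<^sub>o munit 0 k) o\<^sub>L ((id_blinfun \<otimes>\<^sub>o A_op q) o\<^sub>L \<G>) o\<^sub>L (id_blinfun \<otimes>\<^sub>o munit 0 0)"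
    by (simp add: entry_otensor blinfun_compose_assoc otensor_compose[THEN ocomp_cong_tail] otensor_compose
        A_op_munit[OF q] otensor_scaleR ocomp_linear del: mult_Suc_right power_Suc)
  also have "\<dots> = (v0 \<otimes>\<^sub>o munit 0 k) o\<^sub>L (\<G> o\<^sub>L (D_op q o\<^sub>L (id_blinfun \<otimes>\<^sub>o munit 0 0)))"
    unfolding lowering by (simp add: blinfun_compose_assoc otensor_compose[THEN ocomp_cong_tail] otensor_compose)
  \<comment> \<open>At \<open>ket 0\<close> the operator \<open>A\<close> vanishes and
    \<open>B\<close> is 1, so only \<open>- q adj b\<close> survives in \<open>D\<close>. This is
    the origin of the powers of \<open>- q adj b\<close> in the series.\<close>
  also have "D_op q o\<^sub>L (id_blinfun \<otimes>\<^sub>o munit 0 0)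
    = (id_blinfun \<otimes>\<^sub>o munit 0 0) o\<^sub>L (((- q) *\<^sub>R adj (b_plus q)) \<otimes>\<^sub>o id_blinfun)"
    by (simp add: D_op_def ocomp_linear otensor_compose A_op_munit[OF q] B_op_munit[OF q] otensor_scaleR del: scaleR_minus_left)
      simp
  also have "(v0 \<otimes>\<^sub>o munit 0 k) o\<^sub>L (\<G> o\<^sub>L \<dots>)
    = (v0 \<otimes>\<^sub>o id_blinfun) o\<^sub>L (entry k 0 \<otimes>\<^sub>o munit 0 0) o\<^sub>L (((- q) *\<^sub>R adj (b_plus q)) \<otimes>\<^sub>o id_blinfun)"
    by (simp add: entry_otensor blinfun_compose_assoc otensor_compose[THEN ocomp_cong_tail] otensor_compose)
  finally have "(s (Suc k) *\<^sub>R entry (Suc k) 0) \<otimes>\<^sub>o (munit 0 0 :: (nat, nat) opr) = (v0 o\<^sub>L entry k 0 o\<^sub>L ((- q) *\<^sub>R adj (b_plus q))) \<otimes>\<^sub>o munit 0 0"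
    by (simp add: otensor_compose otensor_scaleR ocomp_linear(7,8) del: mult_Suc_right power_Suc scaleR_minus_left)
  then have "s (Suc k) *\<^sub>R entry (Suc k) 0 = v0 o\<^sub>L entry k 0 o\<^sub>L ((- q) *\<^sub>R adj (b_plus q))"
    by (rule otensor_munit_cancel[rotated 2]) simp_all
  also have "\<dots> = (1 / sqrt (qpoch q k)) *\<^sub>R (opow v0 (Suc k) o\<^sub>L L0plus q o\<^sub>L opow ((- q) *\<^sub>R adj (b_plus q)) (Suc k))"
    unfolding Suc by (simp add: ocomp_linear(7,8) blinfun_compose_assoc opow_Suc[of v0]
        opow_Suc2[of "(- q) *\<^sub>R adj (b_plus q)"] del: scaleR_minus_left)
  finally have "s (Suc k) *\<^sub>R entry (Suc k) 0 = s (Suc k) *\<^sub>R ((1 / sqrt (qpoch q (Suc k))) *\<^sub>R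
      (opow v0 (Suc k) o\<^sub>L L0plus q o\<^sub>L opow ((- q) *\<^sub>R adj (b_plus q)) (Suc k)))"
    unfolding scaleR_scaleR sqrt_qpoch_Suc .
  then show ?case
    by (rule scaleR_left_imp_eq[rotated]) (use s_pos[of "Suc k"] in linarith)
qed

end

section \<open>Closure properties of von Neumann algebras\<close>

lemma commutant_bops: "commutant S \<subseteq> bops"
  by (auto simp: commutant_def)

lemma commutant_closed:
  "id_blinfun \<in> commutant S"
  "x \<in> commutant S \<Longrightarrow> y \<in> commutant S \<Longrightarrow> x + y \<in> commutant S"
  "x \<in> commutant S \<Longrightarrow> y \<in> commutant S \<Longrightarrow> x - y \<in> commutant S"
  "x \<in> commutant S \<Longrightarrow> y \<in> commutant S \<Longrightarrow> x o\<^sub>L y \<in> commutant S"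
  "x \<in> commutant S \<Longrightarrow> r *\<^sub>R x \<in> commutant S"
proof -
  assume x: "x \<in> commutant S" and y: "y \<in> commutant S"
  have "(x o\<^sub>L y) o\<^sub>L z = z o\<^sub>L (x o\<^sub>L y)" if "z \<in> S" for z
    using x y that unfolding commutant_def mem_Collect_eq by (metis blinfun_compose_assoc)
  with x y show "x o\<^sub>L y \<in> commutant S" by (simp add: commutant_def)
qed (auto simp: commutant_def ocomp_linear)

lemma cscale_compose:
  "cscale c (x o\<^sub>L y) = cscale c x o\<^sub>L y"
  "x \<in> bops \<Longrightarrow> x o\<^sub>L cscale c y = cscale c (x o\<^sub>L y)"
  by (rule blinfun_eqI; simp add: bops_apply)+

lemma commutant_cscale:
  assumes "S \<subseteq> bops" "x \<in> commutant S"
  shows "cscale c x \<in> commutant S"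
proof -
  have "cscale c x o\<^sub>L z = z o\<^sub>L cscale c x" if "z \<in> S" for z
    using assms that unfolding commutant_def mem_Collect_eq by (metis cscale_compose subsetD)
  with assms show ?thesis by (simp add: commutant_def)
qed

lemma vna_gen_superset: "A \<subseteq> bops \<Longrightarrow> A \<subseteq> vna_gen A"
  by (auto simp: vna_gen_def commutant_def)

lemma vna_gen_bops: "vna_gen A \<subseteq> bops"
  by (simp add: vna_gen_def commutant_bops)

lemma vna_gen_compose: "x \<in> vna_gen A \<Longrightarrow> y \<in> vna_gen A \<Longrightarrow> x o\<^sub>L y \<in> vna_gen A"
  by (simp add: vna_gen_def commutant_closed)

text \<open>A von Neumann algebra is the commutant of its commutant, and commutants are closed under
  the algebraic operations; closure under \<open>adj\<close> comes directly from the
  definition.\<close>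

lemma von_neumann_algebra_closed:
  assumes "von_neumann_algebra M"
  shows "id_blinfun \<in> M"
    "x \<in> M \<Longrightarrow> y \<in> M \<Longrightarrow> x + y \<in> M" "x \<in> M \<Longrightarrow> y \<in> M \<Longrightarrow> x - y \<in> M"
    "x \<in> M \<Longrightarrow> y \<in> M \<Longrightarrow> x o\<^sub>L y \<in> M" "x \<in> M \<Longrightarrow> r *\<^sub>R x \<in> M"
    "x \<in> M \<Longrightarrow> cscale c x \<in> M" "x \<in> M \<Longrightarrow> adj x \<in> M" "x \<in> M \<Longrightarrow> x \<in> bops"
proof -
  have M: "M = commutant (commutant M)" "M \<subseteq> bops" "adj ` M \<subseteq> M"
    using assms by (auto simp: von_neumann_algebra_def)
  show "id_blinfun \<in> M"
    "x \<in> M \<Longrightarrow> y \<in> M \<Longrightarrow> x + y \<in> M" "x \<in> M \<Longrightarrow> y \<in> M \<Longrightarrow> x - y \<in> M"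
    "x \<in> M \<Longrightarrow> y \<in> M \<Longrightarrow> x o\<^sub>L y \<in> M" "x \<in> M \<Longrightarrow> r *\<^sub>R x \<in> M" "x \<in> M \<Longrightarrow> cscale c x \<in> M"
    using commutant_closed[where S = "commutant M"] commutant_cscale[OF commutant_bops, where S1 = M] M(1) by metis+
  show "x \<in> M \<Longrightarrow> adj x \<in> M" "x \<in> M \<Longrightarrow> x \<in> bops" using M by auto
qed

text \<open>For \<open>t\<close> in the commutant of \<open>M\<close>, the operator
  \<open>t \<otimes> 1\<close> commutes with \<open>M \<otimes> bops\<close>, hence \<open>t\<close>
  commutes with every slice of \<open>y\<close>. The slice thus lies in the bicommutant, which is
  \<open>M\<close>.\<close>

lemma tensor_slice_mem:
  assumes M: "von_neumann_algebra M" and y: "y \<in> M \<otimes>\<^sub>N bops"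
    and s: "s \<in> bops" "(id_blinfun \<otimes>\<^sub>o munit k m) o\<^sub>L y o\<^sub>L (id_blinfun \<otimes>\<^sub>o munit n l) = s \<otimes>\<^sub>o munit k l"
  shows "s \<in> M"
proof -
  have "s \<in> commutant (commutant M)"
    unfolding commutant_def[of "commutant M"]
  proof (intro CollectI conjI ballI s(1))
    fix t assume t: "t \<in> commutant M"
    then have tb [simp]: "t \<in> bops" and tc: "\<And>x. x \<in> M \<Longrightarrow> t o\<^sub>L x = x o\<^sub>L t"
      by (auto simp: commutant_def)
    let ?G = "{x \<otimes>\<^sub>o y | x y. x \<in> M \<and> y \<in> bops}"
    have "t \<otimes>\<^sub>o id_blinfun \<in> commutant (?G \<union> adj ` ?G)"
      using von_neumann_algebra_closed(7,8)[OF M] by (auto simp: commutant_def otensor_compose tc)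
    with y have yt: "y o\<^sub>L (t \<otimes>\<^sub>o id_blinfun) = (t \<otimes>\<^sub>o id_blinfun) o\<^sub>L y" and yb: "y \<in> bops"
      by (auto simp: vna_tensor_def vna_gen_def commutant_def[of "commutant _"])
    have "(s o\<^sub>L t) \<otimes>\<^sub>o munit k l = (s \<otimes>\<^sub>o munit k l) o\<^sub>L (t \<otimes>\<^sub>o id_blinfun)"
      using s by (simp add: otensor_compose)
    also have "\<dots> = (id_blinfun \<otimes>\<^sub>o munit k m) o\<^sub>L (y o\<^sub>L (t \<otimes>\<^sub>o id_blinfun)) o\<^sub>L (id_blinfun \<otimes>\<^sub>o munit n l)"
      by (simp add: s(2)[symmetric] blinfun_compose_assoc otensor_compose)
    also have "\<dots> = (t \<otimes>\<^sub>o id_blinfun) o\<^sub>L (s \<otimes>\<^sub>o munit k l)"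
      unfolding yt by (simp add: s(2)[symmetric] blinfun_compose_assoc otensor_compose[THEN ocomp_cong_tail])
    also have "\<dots> = (t o\<^sub>L s) \<otimes>\<^sub>o munit k l"
      using s by (simp add: otensor_compose)
    finally show "s o\<^sub>L t = t o\<^sub>L s"
      by (rule otensor_munit_cancel[rotated 2]) (simp_all add: s)
  qed
  then show ?thesis using M by (simp add: von_neumann_algebra_def)
qed

section \<open>The Podles action\<close>

lemma star_alg_bops: "x \<in> star_alg A \<Longrightarrow> A \<subseteq> bops \<Longrightarrow> x \<in> bops"
  by (induction rule: star_alg.induct) auto

lemma star_homD:
  assumes "star_hom M N \<pi>"
  shows "x \<in> M \<Longrightarrow> \<pi> x \<in> N" "x \<in> M \<Longrightarrow> y \<in> M \<Longrightarrow> \<pi> (x + y) = \<pi> x + \<pi> y"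
    "x \<in> M \<Longrightarrow> \<pi> (cscale c x) = cscale c (\<pi> x)" "x \<in> M \<Longrightarrow> y \<in> M \<Longrightarrow> \<pi> (x o\<^sub>L y) = \<pi> x o\<^sub>L \<pi> y"
    "x \<in> M \<Longrightarrow> \<pi> (adj x) = adj (\<pi> x)" "x \<in> M \<Longrightarrow> \<pi> (r *\<^sub>R x) = r *\<^sub>R \<pi> x"
  using assms unfolding cscale_of_real[symmetric] star_hom_def by blast+

lemma star_hom_sum:
  assumes j: "star_hom (star_alg A) N j" and I: "finite I" "\<And>i. i \<in> I \<Longrightarrow> d i \<in> star_alg A"
  shows "(\<Sum>i\<in>I. cscale (c i) (d i)) \<in> star_alg A \<and>
    j (\<Sum>i\<in>I. cscale (c i) (d i)) = (\<Sum>i\<in>I. cscale (c i) (j (d i)))"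
  using I
proof (induction I)
  case empty
  have z: "cscale 0 x = 0" for x :: "('i, 'j) opr" by (rule blinfun_eqI) simp
  have 0: "0 \<in> star_alg A" using star_alg.scale[OF star_alg.one, of 0 A] by (simp add: z)
  with j have "j (cscale 0 0) = cscale 0 (j 0)" by (simp add: star_hom_def)
  with 0 show ?case by (simp add: z)
next
  case (insert i I)
  then have "cscale (c i) (d i) \<in> star_alg A" "j (cscale (c i) (d i)) = cscale (c i) (j (d i))"
    using j by (auto simp: star_hom_def intro: star_alg.scale)
  with insert j show ?case by (auto simp: star_hom_def intro: star_alg.add)
qed

lemma coord_sum_otensor:
  assumes "\<And>i. i \<in> I \<Longrightarrow> c i \<in> bops" "\<And>i. i \<in> I \<Longrightarrow> d i \<in> bops"
  shows "coord (blinfun_apply (\<Sum>i\<in>I. c i \<otimes>\<^sub>o d i) (ket x \<otimes>\<^sub>v \<eta>)) (x', y')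
    = coord (blinfun_apply (\<Sum>i\<in>I. cscale (coord (blinfun_apply (c i) (ket x)) x') (d i)) \<eta>) y'"
  using assms by (simp add: blinfun.sum_left coord_sum)

text \<open>Slicing the first leg with \<open>\<omega>\<^bsub>\<delta> x, \<delta> x'\<^esub>\<close> reduces the injectivity of \<open>\<iota> \<otimes> j\<close> on the algebraic
  tensor product to that of \<open>j\<close>.\<close>

lemma tensor_star_hom_inj:
  assumes j: "star_hom (star_alg A) N j" "inj_on j (star_alg A)" and A: "A \<subseteq> bops" "N \<subseteq> bops"
    and fin: "finite I" "finite K"
    and c: "\<And>i. i \<in> I \<Longrightarrow> c i \<in> bops" "\<And>i. i \<in> K \<Longrightarrow> c' i \<in> bops"
    and d: "\<And>i. i \<in> I \<Longrightarrow> d i \<in> star_alg A" "\<And>i. i \<in> K \<Longrightarrow> d' i \<in> star_alg A"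
    and eq: "(\<Sum>i\<in>I. c i \<otimes>\<^sub>o j (d i)) = (\<Sum>i\<in>K. c' i \<otimes>\<^sub>o j (d' i))"
  shows "(\<Sum>i\<in>I. c i \<otimes>\<^sub>o d i) = (\<Sum>i\<in>K. c' i \<otimes>\<^sub>o d' i)"
proof -
  have jN: "j x \<in> bops" if "x \<in> star_alg A" for x using j(1) A(2) that by (auto simp: star_hom_def)
  have db: "d i \<in> bops" "d' k \<in> bops" if "i \<in> I" "k \<in> K" for i k using d that star_alg_bops[OF _ A(1)] by auto
  have db': "x \<in> bops" if "x \<in> star_alg A" for x using that star_alg_bops[OF _ A(1)] by auto
  have *: "(\<Sum>i\<in>I. cscale (coord (blinfun_apply (c i) (ket x)) x') (d i))
      = (\<Sum>i\<in>K. cscale (coord (blinfun_apply (c' i) (ket x)) x') (d' i))" for x x'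
  proof -
    have "(\<Sum>i\<in>I. cscale (coord (blinfun_apply (c i) (ket x)) x') (j (d i)))
      = (\<Sum>i\<in>K. cscale (coord (blinfun_apply (c' i) (ket x)) x') (j (d' i)))"
    proof (intro blinfun_eqI ell2_eqI)
      fix \<eta> y
      show "coord (blinfun_apply (\<Sum>i\<in>I. cscale (coord (blinfun_apply (c i) (ket x)) x') (j (d i))) \<eta>) y
        = coord (blinfun_apply (\<Sum>i\<in>K. cscale (coord (blinfun_apply (c' i) (ket x)) x') (j (d' i))) \<eta>) y"
        using eq by (subst (1 2) coord_sum_otensor[symmetric]) (auto simp: c d jN)
    qed
    then show ?thesis
      by (intro inj_onD[OF j(2)]) (simp_all add: star_hom_sum[OF j(1) fin(1) d(1)] star_hom_sum[OF j(1) fin(2) d(2)])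
  qed
  show ?thesis
  proof (rule bops_vtensor_eqI)
    fix x y
    show "blinfun_apply (\<Sum>i\<in>I. c i \<otimes>\<^sub>o d i) (ket x \<otimes>\<^sub>v ket y) = blinfun_apply (\<Sum>i\<in>K. c' i \<otimes>\<^sub>o d' i) (ket x \<otimes>\<^sub>v ket y)"
      by (rule ell2_eqI, clarify) (subst (1 2) coord_sum_otensor; simp add: c d db' *)
  qed (auto intro!: bops_sum otensor_bops simp: c d db')
qed

lemma L_SUq2_generators:
  assumes q: "0 < q" "q < 1"
  shows "a_plus q \<in> L_SUq2 q" "b_plus q \<in> L_SUq2 q"
  using vna_gen_superset[of "{a_plus q, b_plus q}"] q by (auto simp: L_SUq2_def)

text \<open>\<open>\<alpha>(X)\<close> is known only as some finite sum of elementary tensors whose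
  image under \<open>\<iota> \<otimes> j\<close> is \<open>\<Delta>_+(j X)\<close>. Since
  \<open>\<iota> \<otimes> j\<close> is injective on such sums, it suffices to exhibit another one
  with the same image.\<close>

lemma podles_action_X:
  assumes q: "0 < q" "q < 1"
    and vN: "von_neumann_algebra (L_SUq2 q)"
    and SUq2: "SUq2_comultiplication q \<Delta>\<^sub>p"
    and podles: "podles_embedding q j" "podles_action q \<Delta>\<^sub>p j \<alpha>"
  shows "\<alpha> (podles_X q) = q *\<^sub>R (C_op q o\<^sub>L D_op q)"
proof -
  let ?a = "a_plus q" and ?b = "b_plus q" and ?X = "podles_X q" and ?Z = "podles_Z q"
  note L = von_neumann_algebra_closed[OF vN] L_SUq2_generators[OF q]
  have [simp]: "?a \<in> bops" "?b \<in> bops" "?X \<in> bops" "?Z \<in> bops" "A_op q \<in> bops" "B_op q \<in> bops"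
    using q by simp_all
  have \<Delta>: "star_hom (L_SUq2 q) (L_SUq2 q \<otimes>\<^sub>N L_SUq2 q) \<Delta>\<^sub>p"
    and \<Delta>a: "\<Delta>\<^sub>p ?a = ?a \<otimes>\<^sub>o ?a - q *\<^sub>R (adj ?b \<otimes>\<^sub>o ?b)"
    and \<Delta>b: "\<Delta>\<^sub>p ?b = ?b \<otimes>\<^sub>o ?a + adj ?a \<otimes>\<^sub>o ?b"
    using SUq2 by (auto simp: SUq2_comultiplication_def normal_star_hom_def)
  have j: "star_hom (podles_alg q) (L_SUq2 q) j" "inj_on j (podles_alg q)" "j id_blinfun = id_blinfun"
    "j ?X = q *\<^sub>R (adj ?b o\<^sub>L ?a)" "j ?Z = adj ?b o\<^sub>L ?b"
    using podles(1) by (auto simp: podles_embedding_def)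
  have P: "id_blinfun \<in> podles_alg q" "?X \<in> podles_alg q" "?Z \<in> podles_alg q" "adj ?X \<in> podles_alg q"
    "cscale (- 1) ?Z \<in> podles_alg q" "id_blinfun + cscale (- 1) ?Z \<in> podles_alg q"
    unfolding podles_alg_def by (blast intro: star_alg.intros)+
  have mz: "cscale (- 1) x = - x" for x :: "('i, 'k) opr"
    using cscale_of_real[of "- 1" x] by simp
  have jX': "j (adj ?X) = q *\<^sub>R (adj ?a o\<^sub>L ?b)"
    using j P by (simp add: star_hom_def)
  have "j (id_blinfun + cscale (- 1) ?Z) = j id_blinfun + cscale (- 1) (j ?Z)"
    using j(1) P by (simp add: star_hom_def)
  then have j1Z: "j (id_blinfun - ?Z) = adj ?a o\<^sub>L ?a"
    by (simp add: mz j(3,5) ab_relations[OF q])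
  have \<Delta>X: "\<Delta>\<^sub>p (j ?X) = q *\<^sub>R (adj (\<Delta>\<^sub>p ?b) o\<^sub>L \<Delta>\<^sub>p ?a)"
    unfolding j using L by (simp add: star_homD[OF \<Delta>])
  \<comment> \<open>The product \<open>q (adj b \<otimes> adj a + a \<otimes> adj b) (a \<otimes> a
    - q adj b \<otimes> b)\<close> has the second legs \<open>adj a a\<close>,
    \<open>adj a b\<close>, \<open>adj b a\<close> and \<open>adj b b\<close>. Up to factors
    \<open>q\<close>, absorbed into \<open>c'\<close>, these are the images under \<open>j\<close>
    of \<open>1 - Z\<close>, \<open>adj X\<close>, \<open>X\<close> and \<open>Z\<close>.\<close>
  define c' where "c' k = [q *\<^sub>R (adj ?b o\<^sub>L ?a), (- q) *\<^sub>R (adj ?b o\<^sub>L adj ?b), ?a o\<^sub>L ?a,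
    (- q * q) *\<^sub>R (?a o\<^sub>L adj ?b)] ! k" for k
  define d' where "d' k = [id_blinfun - ?Z, adj ?X, ?X, ?Z] ! k" for k
  have s4: "sum f {..<4::nat} = f 0 + f 1 + f 2 + f 3" for f :: "nat \<Rightarrow> 'z::comm_monoid_add"
    by (simp add: numeral_eq_Suc add_ac)
  have "\<Delta>\<^sub>p (j ?X) = (\<Sum>k<4. c' k \<otimes>\<^sub>o j (d' k))"
    unfolding s4 c'_def d'_def
    unfolding \<Delta>X \<Delta>a \<Delta>b
    by (simp add: j jX' j1Z otensor_uminus ocomp_linear otensor_compose otensor_scaleR algebra_simps)
  moreover obtain n :: nat and c d where cd: "\<And>i. i < n \<Longrightarrow> c i \<in> L_SUq2 q \<and> d i \<in> podles_alg q"
    "\<alpha> ?X = (\<Sum>i<n. c i \<otimes>\<^sub>o d i)" "(\<Sum>i<n. c i \<otimes>\<^sub>o j (d i)) = \<Delta>\<^sub>p (j ?X)"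
    using bspec[OF conjunct2[OF podles(2)[unfolded podles_action_def]] P(2)] by blast
  ultimately have "(\<Sum>i<n. c i \<otimes>\<^sub>o d i) = (\<Sum>k<4. c' k \<otimes>\<^sub>o d' k)"
  proof (intro tensor_star_hom_inj[OF j(1,2)[unfolded podles_alg_def]])
    show "d' k \<in> star_alg {?X, ?Z}" if "k \<in> {..<4}" for k
      using that P by (auto simp: d'_def numeral_eq_Suc less_Suc_eq mz podles_alg_def)
    show "c' k \<in> bops" if "k \<in> {..<4}" for k
      using that by (auto simp: c'_def numeral_eq_Suc less_Suc_eq)
    show "c k \<in> bops" if "k \<in> {..<n}" for k using cd(1)[of k] that L by simp
    show "d k \<in> star_alg {?X, ?Z}" if "k \<in> {..<n}" for k using cd(1)[of k] that by (simp add: podles_alg_def)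
  qed (use L in auto)
  \<comment> \<open>In terms of \<open>A\<close> and \<open>B\<close> the second legs factor again,
    for instance \<open>1 - Z = adj A A\<close>, and the four terms recombine into one
    product.\<close>
  also have "\<dots> = q *\<^sub>R (C_op q o\<^sub>L D_op q)"
    unfolding s4 c'_def d'_def
    by (simp add: C_op_def D_op_def podles_X_eq[OF q] podles_Z_eq[OF q] otensor_uminus adj_B_op[OF q] AB_relations[OF q] ocomp_linear
        otensor_linear otensor_compose otensor_scaleR algebra_simps)
  finally show ?thesis using cd(2) by simp
qed

section \<open>Leg numbering\<close>

lemma bij_assoc: "bij (\<lambda>(i, (j, k)). ((i, j), k))"
  by (rule bij_betw_byWitness[where f' = "\<lambda>((i, j), k). (i, (j, k))"]) auto

lemma bij_swap23: "bij (\<lambda>((i, k), j). ((i, j), k))"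
  by (rule bij_betw_byWitness[where f' = "\<lambda>((i, j), k). ((i, k), j)"]) auto

lemma reindex_bops [simp]: "inj f \<Longrightarrow> x \<in> bops \<Longrightarrow> reindex f x \<in> bops"
  by (simp add: reindex_def basis_map_bops)

lemma reindex_compose: "inj f \<Longrightarrow> reindex f x o\<^sub>L reindex f y = reindex f (x o\<^sub>L y)"
  by (simp add: reindex_def blinfun_compose_assoc basis_map_isometry[THEN ocomp_cong_tail])

lemma reindex_linear:
  "reindex f (x + y) = reindex f x + reindex f y" "reindex f (x - y) = reindex f x - reindex f y"
  "reindex f (r *\<^sub>R x) = r *\<^sub>R reindex f x"
  by (simp_all add: reindex_def ocomp_linear)

lemma reindex_eqI:
  assumes f: "bij f" and y: "y o\<^sub>L basis_map f = basis_map f o\<^sub>L x"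
  shows "reindex f x = y"
  by (simp add: reindex_def y[symmetric] blinfun_compose_assoc basis_map_unitary[OF f])

lemma basis_map_assoc:
  "blinfun_apply (basis_map (\<lambda>(i, (j, k)). ((i, j), k))) (\<xi> \<otimes>\<^sub>v (\<eta> \<otimes>\<^sub>v \<zeta>)) = (\<xi> \<otimes>\<^sub>v \<eta>) \<otimes>\<^sub>v \<zeta>"
proof (rule ell2_eqI, clarify)
  fix i j k
  show "coord (blinfun_apply (basis_map (\<lambda>(i, (j, k)). ((i, j), k))) (\<xi> \<otimes>\<^sub>v (\<eta> \<otimes>\<^sub>v \<zeta>))) ((i, j), k)
    = coord ((\<xi> \<otimes>\<^sub>v \<eta>) \<otimes>\<^sub>v \<zeta>) ((i, j), k)"
    using coord_basis_map[OF bij_is_inj[OF bij_assoc], of "\<xi> \<otimes>\<^sub>v (\<eta> \<otimes>\<^sub>v \<zeta>)" "(i, (j, k))"] by simp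
qed

lemma basis_map_swap23:
  "blinfun_apply (basis_map (\<lambda>((i, k), j). ((i, j), k))) ((\<xi> \<otimes>\<^sub>v \<zeta>) \<otimes>\<^sub>v \<eta>) = (\<xi> \<otimes>\<^sub>v \<eta>) \<otimes>\<^sub>v \<zeta>"
proof (rule ell2_eqI, clarify)
  fix i j k
  show "coord (blinfun_apply (basis_map (\<lambda>((i, k), j). ((i, j), k))) ((\<xi> \<otimes>\<^sub>v \<zeta>) \<otimes>\<^sub>v \<eta>)) ((i, j), k)
    = coord ((\<xi> \<otimes>\<^sub>v \<eta>) \<otimes>\<^sub>v \<zeta>) ((i, j), k)"
    using coord_basis_map[OF bij_is_inj[OF bij_swap23], of "(\<xi> \<otimes>\<^sub>v \<zeta>) \<otimes>\<^sub>v \<eta>" "((i, k), j)"] by simp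
qed

lemma reindex_assoc:
  assumes [simp]: "x \<in> bops" "y \<in> bops" "z \<in> bops"
  shows "reindex (\<lambda>(i, (j, k)). ((i, j), k)) (x \<otimes>\<^sub>o (y \<otimes>\<^sub>o z)) = (x \<otimes>\<^sub>o y) \<otimes>\<^sub>o z"
proof (rule reindex_eqI[OF bij_assoc], rule bops_eqI)
  fix p :: "'a \<times> ('b \<times> 'c)"
  obtain i j k where "ket p = ket i \<otimes>\<^sub>v (ket j \<otimes>\<^sub>v ket k)" by (metis ket_vtensor prod.collapse)
  then show "blinfun_apply ((x \<otimes>\<^sub>o y) \<otimes>\<^sub>o z o\<^sub>L basis_map (\<lambda>(i, (j, k)). ((i, j), k))) (ket p)
    = blinfun_apply (basis_map (\<lambda>(i, (j, k)). ((i, j), k)) o\<^sub>L x \<otimes>\<^sub>o (y \<otimes>\<^sub>o z)) (ket p)"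
    by (simp add: basis_map_assoc)
qed (simp_all add: basis_map_bops bij_is_inj[OF bij_assoc])

lemma reindex_swap23:
  assumes [simp]: "x \<in> bops" "y \<in> bops" "z \<in> bops"
  shows "reindex (\<lambda>((i, k), j). ((i, j), k)) ((x \<otimes>\<^sub>o z) \<otimes>\<^sub>o y) = (x \<otimes>\<^sub>o y) \<otimes>\<^sub>o z"
proof (rule reindex_eqI[OF bij_swap23], rule bops_eqI)
  fix p :: "('a \<times> 'c) \<times> 'b"
  obtain i j k where "ket p = (ket i \<otimes>\<^sub>v ket k) \<otimes>\<^sub>v ket j" by (metis ket_vtensor prod.collapse)
  then show "blinfun_apply ((x \<otimes>\<^sub>o y) \<otimes>\<^sub>o z o\<^sub>L basis_map (\<lambda>((i, k), j). ((i, j), k))) (ket p)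
    = blinfun_apply (basis_map (\<lambda>((i, k), j). ((i, j), k)) o\<^sub>L (x \<otimes>\<^sub>o z) \<otimes>\<^sub>o y) (ket p)"
    by (simp add: basis_map_swap23)
qed (simp_all add: basis_map_bops bij_is_inj[OF bij_swap23])

lemma leg_otensor:
  assumes "x \<in> bops" "y \<in> bops"
  shows "leg23 (x \<otimes>\<^sub>o y) = (id_blinfun \<otimes>\<^sub>o x) \<otimes>\<^sub>o y" "leg13 (x \<otimes>\<^sub>o y) = (x \<otimes>\<^sub>o id_blinfun) \<otimes>\<^sub>o y"
  using assms by (simp_all add: leg23_def leg13_def assoc_left_def reindex_assoc reindex_swap23)

lemma leg_bops [simp]:
  assumes "x \<in> bops"
  shows "leg23 x \<in> bops" "leg13 x \<in> bops"
  using assms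
  by (simp_all add: bij_is_inj[OF bij_assoc] bij_is_inj[OF bij_swap23] leg23_def leg13_def assoc_left_def)

lemma leg_compose:
  assumes "x \<in> bops" "y \<in> bops"
  shows "leg23 (x o\<^sub>L y) = leg23 x o\<^sub>L leg23 y" "leg13 (x o\<^sub>L y) = leg13 x o\<^sub>L leg13 y"
  using assms
  by (simp_all add: bij_is_inj[OF bij_assoc] bij_is_inj[OF bij_swap23] leg23_def leg13_def assoc_left_def reindex_compose otensor_compose)

lemma leg_linear:
  assumes "x \<in> bops" "y \<in> bops"
  shows "leg23 (x + y) = leg23 x + leg23 y" "leg23 (x - y) = leg23 x - leg23 y"
  using assms by (simp_all add: leg23_def assoc_left_def reindex_linear otensor_linear)

lemma leg23_scaleR: "x \<in> bops \<Longrightarrow> leg23 (r *\<^sub>R x) = r *\<^sub>R leg23 x"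
  by (simp add: leg23_def assoc_left_def reindex_linear otensor_scaleR)

text \<open>Here \<open>u\<close> need not be an elementary tensor: before reindexing, the claim is
  that \<open>1 \<otimes> u\<close> commutes with
  \<open>y \<otimes> (1 \<otimes> 1)\<close>.\<close>

lemma leg23_commute:
  fixes u :: "('j \<times> 'k, 'j \<times> 'k) opr" and y :: "('i, 'i) opr"
  assumes [simp]: "u \<in> bops" "y \<in> bops"
  shows "leg23 u o\<^sub>L ((y \<otimes>\<^sub>o id_blinfun) \<otimes>\<^sub>o id_blinfun) = ((y \<otimes>\<^sub>o id_blinfun) \<otimes>\<^sub>o id_blinfun) o\<^sub>L leg23 u"
  by (simp add: leg23_def assoc_left_def reindex_compose otensor_compose bij_is_inj[OF bij_assoc]
      flip: reindex_assoc[OF _ bops_id bops_id])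

lemma leg13_commute:
  fixes u :: "('i \<times> 'k, 'i \<times> 'k) opr" and y :: "('j, 'j) opr"
  assumes [simp]: "u \<in> bops" "y \<in> bops"
  shows "leg13 u o\<^sub>L ((id_blinfun \<otimes>\<^sub>o y) \<otimes>\<^sub>o id_blinfun) = ((id_blinfun \<otimes>\<^sub>o y) \<otimes>\<^sub>o id_blinfun) o\<^sub>L leg13 u"
  by (simp add: leg13_def reindex_compose otensor_compose bij_is_inj[OF bij_swap23]
      flip: reindex_swap23[OF bops_id _ bops_id])

section \<open>Corners of the linking algebra\<close>

lemma iota_bops [simp]: "\<iota>\<^sub>H \<in> bops" "\<iota>\<^sub>G \<in> bops"
  by (simp_all add: basis_map_bops)

lemma iota_isometry [simp]: "adj \<iota>\<^sub>H o\<^sub>L \<iota>\<^sub>H = id_blinfun" "adj \<iota>\<^sub>G o\<^sub>L \<iota>\<^sub>G = id_blinfun"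
  by (simp_all add: basis_map_isometry)

lemma iota_tail [simp]: "adj \<iota>\<^sub>H o\<^sub>L (\<iota>\<^sub>H o\<^sub>L z) = z" "adj \<iota>\<^sub>G o\<^sub>L (\<iota>\<^sub>G o\<^sub>L z) = z"
  by (simp_all flip: blinfun_compose_assoc)

lemma iota_orthogonal [simp]: "adj \<iota>\<^sub>H o\<^sub>L \<iota>\<^sub>G = 0" "adj \<iota>\<^sub>G o\<^sub>L \<iota>\<^sub>H = 0"
  by (rule bops_eqI; (rule ell2_eqI)?; simp add: basis_map_ket coord_adj_ket coord_ket coord_simps)+

lemma iota_orthogonal_tail [simp]: "adj \<iota>\<^sub>H o\<^sub>L (\<iota>\<^sub>G o\<^sub>L z) = 0" "adj \<iota>\<^sub>G o\<^sub>L (\<iota>\<^sub>H o\<^sub>L z) = 0"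
  by (simp_all flip: blinfun_compose_assoc)

lemma e_proj_bops [simp]: "e_proj \<in> bops"
  by (simp add: e_proj_def)

lemma one_minus_e_proj: "id_blinfun - e_proj = \<iota>\<^sub>G o\<^sub>L adj \<iota>\<^sub>G"
proof (rule bops_eqI)
  fix i :: "'a + 'b"
  have z: "blinfun_apply (adj \<iota>\<^sub>H) (ket (Inr j)) = (0 :: 'a ell2)" "blinfun_apply (adj \<iota>\<^sub>G) (ket (Inl k)) = (0 :: 'b ell2)"
    for j :: 'b and k :: 'a
    by (rule ell2_eqI; simp add: basis_map_ket coord_adj_ket coord_ket coord_simps)+
  show "blinfun_apply (id_blinfun - e_proj) (ket i) = blinfun_apply (\<iota>\<^sub>G o\<^sub>L adj \<iota>\<^sub>G) (ket i)"
    by (cases i) (simp_all add: e_proj_def blinfun.bilinear_simps z adj_basis_map_ket basis_map_ket)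
qed simp_all

text \<open>Extends an operator between two corners by zero to the whole space, and is inverted by
  compression with the same isometries. Thus \<open>hatX y \<in> Q\<close> below expresses that
  \<open>y\<close> belongs to the upper right corner \<open>L(X)\<close>.\<close>

definition hat :: "('k, 'i) opr \<Rightarrow> ('l, 'i) opr \<Rightarrow> ('l, 'k) opr \<Rightarrow> ('i, 'i) opr" where
  "hat U V y = U o\<^sub>L y o\<^sub>L adj V"

lemma hat_bops [simp]: "U \<in> bops \<Longrightarrow> V \<in> bops \<Longrightarrow> y \<in> bops \<Longrightarrow> hat U V y \<in> bops"
  by (simp add: hat_def)

lemma hat_compose: "adj V o\<^sub>L V = id_blinfun \<Longrightarrow> hat U V y o\<^sub>L hat V W z = hat U W (y o\<^sub>L z)"
  by (simp add: hat_def blinfun_compose_assoc ocomp_cong_tail[of "adj V" V])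

lemma adj_hat [simp]: "U \<in> bops \<Longrightarrow> V \<in> bops \<Longrightarrow> y \<in> bops \<Longrightarrow> adj (hat U V y) = hat V U (adj y)"
  by (simp add: hat_def blinfun_compose_assoc)

locale linking_corepresentation = podles_corepresentation q \<G>
  for q :: real and \<G> :: "((nat \<times> int) \<times> nat, (int \<times> int) \<times> nat) opr" +
  fixes Q :: "(int \<times> int + nat \<times> int, int \<times> int + nat \<times> int) opr set"
    and \<Delta> :: "(int \<times> int + nat \<times> int, int \<times> int + nat \<times> int) opr \<Rightarrow>
      ((int \<times> int + nat \<times> int) \<times> (int \<times> int + nat \<times> int),
       (int \<times> int + nat \<times> int) \<times> (int \<times> int + nat \<times> int)) opr"
    and \<Delta>\<^sub>p :: "(nat \<times> int, nat \<times> int) opr \<Rightarrow>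
      ((nat \<times> int) \<times> (nat \<times> int), (nat \<times> int) \<times> (nat \<times> int)) opr"
  assumes SUq2: "SUq2_comultiplication q \<Delta>\<^sub>p"
    and linking: "linking_quantum_groupoid Q \<Delta> (L_SUq2 q) \<Delta>\<^sub>p"
    and mem: "upper_right \<G> \<in> Q \<otimes>\<^sub>N bops"
    and corep: "\<exists>\<Psi>. is_tensor_hom Q bops (Q \<otimes>\<^sub>N Q) bops \<Delta> (\<lambda>y. y) \<Psi> \<and>
      \<Psi> (upper_right \<G>) = leg13 (upper_right \<G>) o\<^sub>L leg23 (upper_right \<G>)"
begin

abbreviation "hatX \<equiv> hat \<iota>\<^sub>H \<iota>\<^sub>G :: (nat \<times> int, int \<times> int) opr \<Rightarrow> _"
abbreviation "hatG \<equiv> hat \<iota>\<^sub>G \<iota>\<^sub>G :: (nat \<times> int, nat \<times> int) opr \<Rightarrow> (int \<times> int + nat \<times> int, int \<times> int + nat \<times> int) opr"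
abbreviation "hatH \<equiv> hat \<iota>\<^sub>H \<iota>\<^sub>H :: (int \<times> int, int \<times> int) opr \<Rightarrow> (int \<times> int + nat \<times> int, int \<times> int + nat \<times> int) opr"
abbreviation "\<Delta>\<^sub>0 \<equiv> corner_comult \<iota>\<^sub>H \<iota>\<^sub>G \<Delta>"

section \<open>Restriction of the comultiplication to the corners\<close>

lemma Q_vN: "von_neumann_algebra Q" and N_vN: "von_neumann_algebra (L_SUq2 q)"
  and e_mem: "e_proj \<in> Q" and corner_Q: "corner \<iota>\<^sub>G \<iota>\<^sub>G Q = L_SUq2 q"
  and \<Delta>_hom: "star_hom Q (Q \<otimes>\<^sub>N Q) \<Delta>"
  and \<Delta>_e: "\<Delta> e_proj = e_proj \<otimes>\<^sub>o e_proj"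
  and \<Delta>_f: "\<Delta> (id_blinfun - e_proj) = (id_blinfun - e_proj) \<otimes>\<^sub>o (id_blinfun - e_proj)"
  and \<Delta>_corner: "y \<in> L_SUq2 q \<Longrightarrow> corner_comult \<iota>\<^sub>G \<iota>\<^sub>G \<Delta> y = \<Delta>\<^sub>p y"
  using linking by (auto simp: linking_quantum_groupoid_def linking_vna_def vN_quantum_group_def normal_star_hom_def)

lemma \<Delta>p_hom: "star_hom (L_SUq2 q) (L_SUq2 q \<otimes>\<^sub>N L_SUq2 q) \<Delta>\<^sub>p"
  and \<Delta>p_a: "\<Delta>\<^sub>p (a_plus q) = a_plus q \<otimes>\<^sub>o a_plus q - q *\<^sub>R (adj (b_plus q) \<otimes>\<^sub>o b_plus q)"
  and \<Delta>p_b: "\<Delta>\<^sub>p (b_plus q) = b_plus q \<otimes>\<^sub>o a_plus q + adj (a_plus q) \<otimes>\<^sub>o b_plus q"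
  and \<Delta>p_id: "\<Delta>\<^sub>p id_blinfun = id_blinfun"
  using SUq2 by (auto simp: SUq2_comultiplication_def normal_star_hom_def)

lemmas Q_closed = von_neumann_algebra_closed[OF Q_vN]
lemmas N_closed = von_neumann_algebra_closed[OF N_vN] L_SUq2_generators[OF q]

lemma \<Delta>_bops: "x \<in> Q \<Longrightarrow> \<Delta> x \<in> bops"
  using star_homD(1)[OF \<Delta>_hom] vna_gen_bops by (auto simp: vna_tensor_def)

lemma hatG_mem: "x \<in> L_SUq2 q \<Longrightarrow> hatG x \<in> Q"
proof -
  assume "x \<in> L_SUq2 q"
  then obtain z where z: "z \<in> Q" "x = adj \<iota>\<^sub>G o\<^sub>L z o\<^sub>L \<iota>\<^sub>G"
    unfolding corner_Q[symmetric] corner_def by blast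
  then have "hatG x = (id_blinfun - e_proj) o\<^sub>L z o\<^sub>L (id_blinfun - e_proj)"
    by (simp add: hat_def one_minus_e_proj blinfun_compose_assoc)
  then show ?thesis using z by (simp add: Q_closed e_mem)
qed

text \<open>\<open>hatG x\<close> is unchanged by compression with \<open>1 - e\<close>, and
  \<open>\<Delta>\<close> maps \<open>1 - e\<close> to \<open>(1 - e) \<otimes> (1 - e)\<close>.
  Hence \<open>\<Delta> (hatG x)\<close> lives in the lower right corner of the tensor square and is
  recovered from its compression.\<close>

lemma \<Delta>_hatG:
  assumes x: "x \<in> L_SUq2 q"
  shows "\<Delta> (hatG x) = hat (\<iota>\<^sub>G \<otimes>\<^sub>o \<iota>\<^sub>G) (\<iota>\<^sub>G \<otimes>\<^sub>o \<iota>\<^sub>G) (\<Delta>\<^sub>p x)"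
proof -
  let ?f = "id_blinfun - e_proj :: (int \<times> int + nat \<times> int, int \<times> int + nat \<times> int) opr"
  have f: "?f \<in> Q" by (simp add: Q_closed e_mem)
  have ff: "?f \<otimes>\<^sub>o ?f = (\<iota>\<^sub>G \<otimes>\<^sub>o \<iota>\<^sub>G) o\<^sub>L adj (\<iota>\<^sub>G \<otimes>\<^sub>o \<iota>\<^sub>G)"
    by (simp add: one_minus_e_proj otensor_compose)
  have "hatG x = ?f o\<^sub>L (hatG x o\<^sub>L ?f)"
    by (simp add: one_minus_e_proj hat_def blinfun_compose_assoc)
  then have "\<Delta> (hatG x) = \<Delta> (?f o\<^sub>L (hatG x o\<^sub>L ?f))" by simp
  also have "\<dots> = (?f \<otimes>\<^sub>o ?f) o\<^sub>L (\<Delta> (hatG x) o\<^sub>L (?f \<otimes>\<^sub>o ?f))"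
    using hatG_mem[OF x] f by (simp add: star_homD[OF \<Delta>_hom] Q_closed \<Delta>_f)
  also have "\<dots> = hat (\<iota>\<^sub>G \<otimes>\<^sub>o \<iota>\<^sub>G) (\<iota>\<^sub>G \<otimes>\<^sub>o \<iota>\<^sub>G) (\<Delta>\<^sub>p x)"
    unfolding ff \<Delta>_corner[OF x, symmetric] corner_comult_def
    by (simp add: hat_def blinfun_compose_assoc)
  finally show ?thesis .
qed

lemma hatX_compose: "x \<in> bops \<Longrightarrow> hatX (y o\<^sub>L x) = hatX y o\<^sub>L hatG x"
  by (simp add: hat_compose)

lemma hatX_mem_compose: "hatX y \<in> Q \<Longrightarrow> x \<in> L_SUq2 q \<Longrightarrow> hatX (y o\<^sub>L x) \<in> Q"
  by (simp add: hatX_compose N_closed Q_closed hatG_mem)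

text \<open>The module property is multiplicativity of \<open>\<Delta>\<close> on
  \<open>hatX y\<close> and \<open>hatG x\<close>: the image of the second factor lies in the lower
  right corner, so the right compression acts on it alone.\<close>

lemma \<Delta>0_compose:
  assumes y: "hatX y \<in> Q" and x: "x \<in> L_SUq2 q"
  shows "\<Delta>\<^sub>0 (y o\<^sub>L x) = \<Delta>\<^sub>0 y o\<^sub>L \<Delta>\<^sub>p x"
proof -
  have i: "adj (\<iota>\<^sub>G \<otimes>\<^sub>o \<iota>\<^sub>G) o\<^sub>L (\<iota>\<^sub>G \<otimes>\<^sub>o \<iota>\<^sub>G) = id_blinfun" by (simp add: otensor_compose)
  have "\<Delta> (hatX (y o\<^sub>L x)) = \<Delta> (hatX y) o\<^sub>L hat (\<iota>\<^sub>G \<otimes>\<^sub>o \<iota>\<^sub>G) (\<iota>\<^sub>G \<otimes>\<^sub>o \<iota>\<^sub>G) (\<Delta>\<^sub>p x)"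
    using x y by (simp add: hatX_compose N_closed star_homD[OF \<Delta>_hom] hatG_mem \<Delta>_hatG)
  then have "\<Delta>\<^sub>0 (y o\<^sub>L x) = adj (\<iota>\<^sub>H \<otimes>\<^sub>o \<iota>\<^sub>H) o\<^sub>L (\<Delta> (hatX y) o\<^sub>L hat (\<iota>\<^sub>G \<otimes>\<^sub>o \<iota>\<^sub>G) (\<iota>\<^sub>G \<otimes>\<^sub>o \<iota>\<^sub>G) (\<Delta>\<^sub>p x)) o\<^sub>L (\<iota>\<^sub>G \<otimes>\<^sub>o \<iota>\<^sub>G)"
    unfolding corner_comult_def hat_def[symmetric] by simp
  also have "\<dots> = \<Delta>\<^sub>0 y o\<^sub>L \<Delta>\<^sub>p x"
    unfolding corner_comult_def hat_def[symmetric]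
    by (simp only: hat_def[of "\<iota>\<^sub>G \<otimes>\<^sub>o \<iota>\<^sub>G"] blinfun_compose_assoc i blinfun_compose_id)
  finally show ?thesis .
qed

lemma \<Delta>0_add:
  assumes "hatX x \<in> Q" "hatX y \<in> Q"
  shows "\<Delta>\<^sub>0 (x + y) = \<Delta>\<^sub>0 x + \<Delta>\<^sub>0 y" "hatX (x + y) \<in> Q"
proof -
  have h: "hatX (x + y) = hatX x + hatX y"
    by (simp add: hat_def ocomp_linear)
  with assms show "hatX (x + y) \<in> Q" by (simp add: Q_closed)
  show "\<Delta>\<^sub>0 (x + y) = \<Delta>\<^sub>0 x + \<Delta>\<^sub>0 y"
    unfolding corner_comult_def hat_def[symmetric]
    using assms by (simp add: h star_homD[OF \<Delta>_hom] ocomp_linear)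
qed

lemma \<Delta>0_scale:
  assumes "hatX x \<in> Q"
  shows "\<Delta>\<^sub>0 (r *\<^sub>R x) = r *\<^sub>R \<Delta>\<^sub>0 x" "\<Delta>\<^sub>0 (cscale c x) = cscale c (\<Delta>\<^sub>0 x)"
    "hatX (r *\<^sub>R x) \<in> Q" "hatX (cscale c x) \<in> Q"
proof -
  have h: "hatX (r *\<^sub>R x) = r *\<^sub>R hatX x" "hatX (cscale c x) = cscale c (hatX x)"
    by (simp_all add: hat_def ocomp_linear cscale_compose(2) flip: cscale_compose(1))
  with assms show "hatX (r *\<^sub>R x) \<in> Q" "hatX (cscale c x) \<in> Q"
    by (simp_all add: Q_closed)
  show "\<Delta>\<^sub>0 (r *\<^sub>R x) = r *\<^sub>R \<Delta>\<^sub>0 x" "\<Delta>\<^sub>0 (cscale c x) = cscale c (\<Delta>\<^sub>0 x)"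
    unfolding corner_comult_def hat_def[symmetric]
    using assms by (simp_all add: h star_homD[OF \<Delta>_hom] ocomp_linear cscale_compose(2) flip: cscale_compose(1))
qed

section \<open>The corepresentation inside the linking algebra\<close>

abbreviation "U \<equiv> upper_right \<G> ::
  ((int \<times> int + nat \<times> int) \<times> nat, (int \<times> int + nat \<times> int) \<times> nat) opr"

lemma U_eq: "U = (\<iota>\<^sub>H \<otimes>\<^sub>o id_blinfun) o\<^sub>L \<G> o\<^sub>L (adj \<iota>\<^sub>G \<otimes>\<^sub>o id_blinfun)"
  by (simp add: upper_right_def)

lemma U_bops [simp]: "U \<in> bops"
  by (simp add: U_eq)

text \<open>The isometries in \<open>U\<close> absorb the hats, so the row and column relations of
  \<open>\<G>\<close> transfer to \<open>U\<close>, where the leg notation makes sense for square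
  operators.\<close>

lemma U_sandwich:
  assumes [simp]: "x \<in> bops" "y \<in> bops" "w \<in> bops" "t \<in> bops"
  shows "(hatH x \<otimes>\<^sub>o w) o\<^sub>L U o\<^sub>L (hatG y \<otimes>\<^sub>o t)
      = (\<iota>\<^sub>H \<otimes>\<^sub>o id_blinfun) o\<^sub>L ((x \<otimes>\<^sub>o w) o\<^sub>L \<G> o\<^sub>L (y \<otimes>\<^sub>o t)) o\<^sub>L (adj \<iota>\<^sub>G \<otimes>\<^sub>o id_blinfun)"
  by (simp add: U_eq hat_def blinfun_compose_assoc otensor_compose otensor_compose[THEN ocomp_cong_tail])

lemma U_sandwich_id:
  assumes [simp]: "w \<in> bops" "t \<in> bops"
  shows "(id_blinfun \<otimes>\<^sub>o w) o\<^sub>L U o\<^sub>L (id_blinfun \<otimes>\<^sub>o t)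
      = (\<iota>\<^sub>H \<otimes>\<^sub>o id_blinfun) o\<^sub>L ((id_blinfun \<otimes>\<^sub>o w) o\<^sub>L \<G> o\<^sub>L (id_blinfun \<otimes>\<^sub>o t)) o\<^sub>L (adj \<iota>\<^sub>G \<otimes>\<^sub>o id_blinfun)"
  by (simp add: U_eq blinfun_compose_assoc otensor_compose otensor_compose[THEN ocomp_cong_tail])

lemma U_slice: "(id_blinfun \<otimes>\<^sub>o munit k m) o\<^sub>L U o\<^sub>L (id_blinfun \<otimes>\<^sub>o munit n l) = hatX (entry m n) \<otimes>\<^sub>o munit k l"
  unfolding U_sandwich_id[OF munit_bops munit_bops]
  by (subst munit_slice) (simp_all add: hat_def otensor_compose)

text \<open>The source of the later membership facts in the upper right corner: the other elements
  are reached from entries of \<open>\<G>\<close> by sums, scalars and the module action.\<close>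

lemma entry_mem: "hatX (entry m n) \<in> Q"
  by (rule tensor_slice_mem[OF Q_vN mem _ U_slice[of 0 m n 0]]) simp

lemma U_column_A: "U o\<^sub>L (id_blinfun \<otimes>\<^sub>o adj (A_op q)) =
    ((hatH v0 \<otimes>\<^sub>o adj (A_op q)) o\<^sub>L U o\<^sub>L (hatG (a_plus q) \<otimes>\<^sub>o id_blinfun))
    + ((hatH v0 \<otimes>\<^sub>o B_op q) o\<^sub>L U o\<^sub>L (hatG (b_plus q) \<otimes>\<^sub>o id_blinfun))"
  using U_sandwich_id[of id_blinfun "adj (A_op q)"] by (simp add: U_sandwich column_A ocomp_linear)

lemma U_column_B: "U o\<^sub>L (id_blinfun \<otimes>\<^sub>o B_op q) =
    ((hatH v0 \<otimes>\<^sub>o B_op q) o\<^sub>L U o\<^sub>L (hatG (adj (a_plus q)) \<otimes>\<^sub>o id_blinfun))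
    - q *\<^sub>R ((hatH v0 \<otimes>\<^sub>o adj (A_op q)) o\<^sub>L U o\<^sub>L (hatG (adj (b_plus q)) \<otimes>\<^sub>o id_blinfun))"
  using U_sandwich_id[of id_blinfun "B_op q"] by (simp add: U_sandwich column_B ocomp_linear)

lemma U_row_zero:
  "(id_blinfun \<otimes>\<^sub>o munit 0 0) o\<^sub>L U o\<^sub>L (id_blinfun \<otimes>\<^sub>o adj (A_op q))
    = (hatH v0 \<otimes>\<^sub>o munit 0 0) o\<^sub>L U o\<^sub>L (hatG (b_plus q) \<otimes>\<^sub>o id_blinfun)"
  "(id_blinfun \<otimes>\<^sub>o munit 0 0) o\<^sub>L U o\<^sub>L (id_blinfun \<otimes>\<^sub>o B_op q)
    = (hatH v0 \<otimes>\<^sub>o munit 0 0) o\<^sub>L U o\<^sub>L (hatG (adj (a_plus q)) \<otimes>\<^sub>o id_blinfun)"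
  by (simp_all add: U_sandwich U_sandwich_id row_zero_A row_zero_B)

abbreviation "U13 \<equiv> leg13 U ::
  (((int \<times> int + nat \<times> int) \<times> (int \<times> int + nat \<times> int)) \<times> nat, ((int \<times> int + nat \<times> int) \<times> (int \<times> int + nat \<times> int)) \<times> nat) opr"
abbreviation "U23 \<equiv> leg23 U ::
  (((int \<times> int + nat \<times> int) \<times> (int \<times> int + nat \<times> int)) \<times> nat, ((int \<times> int + nat \<times> int) \<times> (int \<times> int + nat \<times> int)) \<times> nat) opr"

lemma U23_column:
  "U23 o\<^sub>L (id_blinfun \<otimes>\<^sub>o adj (A_op q)) =
    (((id_blinfun \<otimes>\<^sub>o hatH v0) \<otimes>\<^sub>o adj (A_op q)) o\<^sub>L U23 o\<^sub>L ((id_blinfun \<otimes>\<^sub>o hatG (a_plus q)) \<otimes>\<^sub>o id_blinfun))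
    + (((id_blinfun \<otimes>\<^sub>o hatH v0) \<otimes>\<^sub>o B_op q) o\<^sub>L U23 o\<^sub>L ((id_blinfun \<otimes>\<^sub>o hatG (b_plus q)) \<otimes>\<^sub>o id_blinfun))"
  "U23 o\<^sub>L (id_blinfun \<otimes>\<^sub>o B_op q) =
    (((id_blinfun \<otimes>\<^sub>o hatH v0) \<otimes>\<^sub>o B_op q) o\<^sub>L U23 o\<^sub>L ((id_blinfun \<otimes>\<^sub>o hatG (adj (a_plus q))) \<otimes>\<^sub>o id_blinfun))
    - q *\<^sub>R (((id_blinfun \<otimes>\<^sub>o hatH v0) \<otimes>\<^sub>o adj (A_op q)) o\<^sub>L U23 o\<^sub>L ((id_blinfun \<otimes>\<^sub>o hatG (adj (b_plus q))) \<otimes>\<^sub>o id_blinfun))"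
  using arg_cong[OF U_column_A, of leg23] arg_cong[OF U_column_B, of leg23]
  by (simp_all add: leg_compose leg_linear leg23_scaleR leg_otensor)

lemma U13_row_zero:
  "(id_blinfun \<otimes>\<^sub>o munit 0 0) o\<^sub>L U13 o\<^sub>L (id_blinfun \<otimes>\<^sub>o adj (A_op q))
    = ((hatH v0 \<otimes>\<^sub>o id_blinfun) \<otimes>\<^sub>o munit 0 0) o\<^sub>L U13 o\<^sub>L ((hatG (b_plus q) \<otimes>\<^sub>o id_blinfun) \<otimes>\<^sub>o id_blinfun)"
  "(id_blinfun \<otimes>\<^sub>o munit 0 0) o\<^sub>L U13 o\<^sub>L (id_blinfun \<otimes>\<^sub>o B_op q)
    = ((hatH v0 \<otimes>\<^sub>o id_blinfun) \<otimes>\<^sub>o munit 0 0) o\<^sub>L U13 o\<^sub>L ((hatG (adj (a_plus q)) \<otimes>\<^sub>o id_blinfun) \<otimes>\<^sub>o id_blinfun)"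
  using arg_cong[OF U_row_zero(1), of leg13] arg_cong[OF U_row_zero(2), of leg13]
  by (simp_all add: leg_compose leg_otensor)

text \<open>\<open>hatH v0\<close> in the second leg commutes with \<open>U13\<close>, and
  \<open>x\<close> in the first leg commutes with \<open>U23\<close>. After these exchanges only the
  third-leg factor \<open>w\<close> stands between the two, and it is consumed by row zero of
  \<open>U13\<close>.\<close>

lemma U13_U23_step:
  assumes [simp]: "x \<in> bops" "y \<in> bops" "w \<in> bops"
    and row: "(id_blinfun \<otimes>\<^sub>o munit 0 0) o\<^sub>L U13 o\<^sub>L (id_blinfun \<otimes>\<^sub>o w)
      = ((hatH v0 \<otimes>\<^sub>o id_blinfun) \<otimes>\<^sub>o munit 0 0) o\<^sub>L U13 o\<^sub>L ((x \<otimes>\<^sub>o id_blinfun) \<otimes>\<^sub>o id_blinfun)"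
  shows "(id_blinfun \<otimes>\<^sub>o munit 0 0) o\<^sub>L U13 o\<^sub>L
      (((id_blinfun \<otimes>\<^sub>o hatH v0) \<otimes>\<^sub>o w) o\<^sub>L U23 o\<^sub>L ((id_blinfun \<otimes>\<^sub>o y) \<otimes>\<^sub>o id_blinfun))
    = ((hatH v0 \<otimes>\<^sub>o hatH v0) \<otimes>\<^sub>o munit 0 0) o\<^sub>L (U13 o\<^sub>L U23) o\<^sub>L ((x \<otimes>\<^sub>o y) \<otimes>\<^sub>o id_blinfun)"
proof -
  let ?v = "(id_blinfun \<otimes>\<^sub>o hatH v0) \<otimes>\<^sub>o (id_blinfun :: (nat, nat) opr)"
  have "(id_blinfun \<otimes>\<^sub>o munit 0 0) o\<^sub>L U13 o\<^sub>L
      (((id_blinfun \<otimes>\<^sub>o hatH v0) \<otimes>\<^sub>o w) o\<^sub>L U23 o\<^sub>L ((id_blinfun \<otimes>\<^sub>o y) \<otimes>\<^sub>o id_blinfun))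
    = (id_blinfun \<otimes>\<^sub>o munit 0 0) o\<^sub>L (U13 o\<^sub>L ?v) o\<^sub>L (id_blinfun \<otimes>\<^sub>o w) o\<^sub>L U23 o\<^sub>L ((id_blinfun \<otimes>\<^sub>o y) \<otimes>\<^sub>o id_blinfun)"
    by (simp add: blinfun_compose_assoc otensor_compose otensor_compose[THEN ocomp_cong_tail])
  also have "\<dots> = ?v o\<^sub>L ((id_blinfun \<otimes>\<^sub>o munit 0 0) o\<^sub>L U13 o\<^sub>L (id_blinfun \<otimes>\<^sub>o w)) o\<^sub>L U23 o\<^sub>L ((id_blinfun \<otimes>\<^sub>o y) \<otimes>\<^sub>o id_blinfun)"
    by (simp add: leg13_commute blinfun_compose_assoc otensor_compose otensor_compose[THEN ocomp_cong_tail])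
  also have "\<dots> = ((hatH v0 \<otimes>\<^sub>o hatH v0) \<otimes>\<^sub>o munit 0 0) o\<^sub>L U13 o\<^sub>L (((x \<otimes>\<^sub>o id_blinfun) \<otimes>\<^sub>o id_blinfun) o\<^sub>L U23) o\<^sub>L ((id_blinfun \<otimes>\<^sub>o y) \<otimes>\<^sub>o id_blinfun)"
    unfolding row
    by (simp add: blinfun_compose_assoc otensor_compose otensor_compose[THEN ocomp_cong_tail])
  also have "\<dots> = ((hatH v0 \<otimes>\<^sub>o hatH v0) \<otimes>\<^sub>o munit 0 0) o\<^sub>L (U13 o\<^sub>L U23) o\<^sub>L ((x \<otimes>\<^sub>o y) \<otimes>\<^sub>o id_blinfun)"
    by (simp add: leg23_commute[symmetric] blinfun_compose_assoc otensor_compose)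
  finally show ?thesis .
qed

text \<open>A third-leg operator passes \<open>U23\<close> by the column relations, which leave
  second-leg coefficients, and is then absorbed by row zero of \<open>U13\<close>, which leaves
  first-leg ones. They combine to \<open>b \<otimes> a + adj a \<otimes> b\<close> and
  \<open>adj a \<otimes> adj a - q b \<otimes> adj b\<close>, the comultiplications of
  \<open>b\<close> and \<open>adj a\<close>.\<close>

lemma U13_U23_column:
  "(id_blinfun \<otimes>\<^sub>o munit 0 0) o\<^sub>L (U13 o\<^sub>L U23) o\<^sub>L (id_blinfun \<otimes>\<^sub>o adj (A_op q))
    = ((hatH v0 \<otimes>\<^sub>o hatH v0) \<otimes>\<^sub>o munit 0 0) o\<^sub>L (U13 o\<^sub>L U23) o\<^sub>L
      ((hatG (b_plus q) \<otimes>\<^sub>o hatG (a_plus q) + hatG (adj (a_plus q)) \<otimes>\<^sub>o hatG (b_plus q)) \<otimes>\<^sub>o id_blinfun)"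
  "(id_blinfun \<otimes>\<^sub>o munit 0 0) o\<^sub>L (U13 o\<^sub>L U23) o\<^sub>L (id_blinfun \<otimes>\<^sub>o B_op q)
    = ((hatH v0 \<otimes>\<^sub>o hatH v0) \<otimes>\<^sub>o munit 0 0) o\<^sub>L (U13 o\<^sub>L U23) o\<^sub>L
      ((hatG (adj (a_plus q)) \<otimes>\<^sub>o hatG (adj (a_plus q)) - q *\<^sub>R (hatG (b_plus q) \<otimes>\<^sub>o hatG (adj (b_plus q)))) \<otimes>\<^sub>o id_blinfun)"
proof -
  have r: "(id_blinfun \<otimes>\<^sub>o munit 0 0) o\<^sub>L (U13 o\<^sub>L U23) o\<^sub>L w = (id_blinfun \<otimes>\<^sub>o munit 0 0) o\<^sub>L U13 o\<^sub>L (U23 o\<^sub>L w)" for w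
    by (simp add: blinfun_compose_assoc)
  show "(id_blinfun \<otimes>\<^sub>o munit 0 0) o\<^sub>L (U13 o\<^sub>L U23) o\<^sub>L (id_blinfun \<otimes>\<^sub>o adj (A_op q))
    = ((hatH v0 \<otimes>\<^sub>o hatH v0) \<otimes>\<^sub>o munit 0 0) o\<^sub>L (U13 o\<^sub>L U23) o\<^sub>L
      ((hatG (b_plus q) \<otimes>\<^sub>o hatG (a_plus q) + hatG (adj (a_plus q)) \<otimes>\<^sub>o hatG (b_plus q)) \<otimes>\<^sub>o id_blinfun)"
    unfolding r U23_column ocomp_linear
    by (subst (1 2) U13_U23_step) (simp_all add: U13_row_zero otensor_linear ocomp_linear)
  show "(id_blinfun \<otimes>\<^sub>o munit 0 0) o\<^sub>L (U13 o\<^sub>L U23) o\<^sub>L (id_blinfun \<otimes>\<^sub>o B_op q)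
    = ((hatH v0 \<otimes>\<^sub>o hatH v0) \<otimes>\<^sub>o munit 0 0) o\<^sub>L (U13 o\<^sub>L U23) o\<^sub>L
      ((hatG (adj (a_plus q)) \<otimes>\<^sub>o hatG (adj (a_plus q)) - q *\<^sub>R (hatG (b_plus q) \<otimes>\<^sub>o hatG (adj (b_plus q)))) \<otimes>\<^sub>o id_blinfun)"
    unfolding r U23_column ocomp_linear
    by (subst (1 2) U13_U23_step) (simp_all add: U13_row_zero otensor_linear otensor_scaleR ocomp_linear)
qed

text \<open>The operators \<open>1 \<otimes> munit k l\<close> lie in
  \<open>Q \<otimes> bops\<close>, so \<open>\<Psi>\<close> applies to the slice of \<open>U\<close>
  factor by factor and the corepresentation property takes over.\<close>

lemma \<Delta>0_entry:
  "\<Delta>\<^sub>0 (entry 0 n) \<otimes>\<^sub>o munit 0 0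
    = (adj (\<iota>\<^sub>H \<otimes>\<^sub>o \<iota>\<^sub>H) \<otimes>\<^sub>o munit 0 0) o\<^sub>L (U13 o\<^sub>L U23) o\<^sub>L ((\<iota>\<^sub>G \<otimes>\<^sub>o \<iota>\<^sub>G) \<otimes>\<^sub>o munit n 0)"
proof -
  obtain \<Psi> where \<Psi>: "star_hom (Q \<otimes>\<^sub>N bops) ((Q \<otimes>\<^sub>N Q) \<otimes>\<^sub>N bops) \<Psi>"
    "\<And>x y. x \<in> Q \<Longrightarrow> y \<in> bops \<Longrightarrow> \<Psi> (x \<otimes>\<^sub>o y) = \<Delta> x \<otimes>\<^sub>o y" "\<Psi> U = U13 o\<^sub>L U23"
    using corep by (auto simp: is_tensor_hom_def normal_star_hom_def)
  let ?\<Delta>1 = "\<Delta> id_blinfun"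
  have id: "id_blinfun \<in> Q" by (rule Q_closed)
  have m: "id_blinfun \<otimes>\<^sub>o munit k l \<in> Q \<otimes>\<^sub>N bops" for k l :: nat
  proof -
    let ?G = "{x \<otimes>\<^sub>o y | x y. x \<in> Q \<and> y \<in> bops} :: ((int \<times> int + nat \<times> int) \<times> nat, (int \<times> int + nat \<times> int) \<times> nat) opr set"
    have "?G \<subseteq> bops" by (auto simp: Q_closed)
    moreover have "id_blinfun \<otimes>\<^sub>o munit k l \<in> ?G" 
      unfolding mem_Collect_eq by (intro exI[of _ id_blinfun] exI[of _ "munit k l"] conjI refl id munit_bops)
    ultimately show ?thesis unfolding vna_tensor_def by (rule subsetD[OF vna_gen_superset])
  qed
  note c = vna_gen_compose[of _ "{x \<otimes>\<^sub>o y | x y. x \<in> Q \<and> y \<in> bops}", folded vna_tensor_def]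
  have "\<Delta> (hatX (entry 0 n)) \<otimes>\<^sub>o munit 0 0 = \<Psi> ((id_blinfun \<otimes>\<^sub>o munit 0 0) o\<^sub>L U o\<^sub>L (id_blinfun \<otimes>\<^sub>o munit n 0))"
    by (simp add: U_slice \<Psi>(2) entry_mem)
  also have "\<dots> = (?\<Delta>1 \<otimes>\<^sub>o munit 0 0) o\<^sub>L (U13 o\<^sub>L U23) o\<^sub>L (?\<Delta>1 \<otimes>\<^sub>o munit n 0)"
    by (simp only: star_homD(4)[OF \<Psi>(1)] c m mem \<Psi>(2)[OF id munit_bops] \<Psi>(3))
  finally have *: "\<Delta> (hatX (entry 0 n)) \<otimes>\<^sub>o munit 0 0 = (?\<Delta>1 \<otimes>\<^sub>o munit 0 0) o\<^sub>L (U13 o\<^sub>L U23) o\<^sub>L (?\<Delta>1 \<otimes>\<^sub>o munit n 0)" .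
  \<comment> \<open>\<open>\<Delta>\<close> is not unital: \<open>\<Delta> 1\<close> is only the sum
    of \<open>e \<otimes> e\<close> and \<open>(1 - e) \<otimes> (1 - e)\<close>. The isometries
    into the two diagonal corners absorb it.\<close>
  have "?\<Delta>1 = \<Delta> (e_proj + (id_blinfun - e_proj))" by simp
  also have "\<dots> = e_proj \<otimes>\<^sub>o e_proj + (id_blinfun - e_proj) \<otimes>\<^sub>o (id_blinfun - e_proj)"
    by (subst star_homD(2)[OF \<Delta>_hom]) (auto simp: \<Delta>_e \<Delta>_f e_mem Q_closed)
  finally have d: "adj (\<iota>\<^sub>H \<otimes>\<^sub>o \<iota>\<^sub>H) o\<^sub>L ?\<Delta>1 = adj (\<iota>\<^sub>H \<otimes>\<^sub>o \<iota>\<^sub>H)" "?\<Delta>1 o\<^sub>L (\<iota>\<^sub>G \<otimes>\<^sub>o \<iota>\<^sub>G) = \<iota>\<^sub>G \<otimes>\<^sub>o \<iota>\<^sub>G"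
    by (simp_all add: one_minus_e_proj ocomp_linear otensor_compose blinfun_compose_assoc) (simp_all add: e_proj_def otensor_compose blinfun_compose_assoc)
  have [simp]: "?\<Delta>1 \<in> bops" "\<Delta> (hatX (entry 0 n)) \<in> bops" by (simp_all add: \<Delta>_bops id entry_mem)
  have "\<Delta>\<^sub>0 (entry 0 n) \<otimes>\<^sub>o munit 0 0
    = (adj (\<iota>\<^sub>H \<otimes>\<^sub>o \<iota>\<^sub>H) \<otimes>\<^sub>o id_blinfun) o\<^sub>L (\<Delta> (hatX (entry 0 n)) \<otimes>\<^sub>o munit 0 0) o\<^sub>L ((\<iota>\<^sub>G \<otimes>\<^sub>o \<iota>\<^sub>G) \<otimes>\<^sub>o id_blinfun)"
    unfolding corner_comult_def hat_def[symmetric] by (simp add: otensor_compose)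
  also have "\<dots> = ((adj (\<iota>\<^sub>H \<otimes>\<^sub>o \<iota>\<^sub>H) o\<^sub>L ?\<Delta>1) \<otimes>\<^sub>o munit 0 0) o\<^sub>L (U13 o\<^sub>L U23) o\<^sub>L ((?\<Delta>1 o\<^sub>L (\<iota>\<^sub>G \<otimes>\<^sub>o \<iota>\<^sub>G)) \<otimes>\<^sub>o munit n 0)"
    unfolding * by (simp add: otensor_compose[THEN ocomp_cong_tail] otensor_compose blinfun_compose_assoc)
  finally show ?thesis unfolding d .
qed

lemma \<Delta>0_bops: "hatX y \<in> Q \<Longrightarrow> \<Delta>\<^sub>0 y \<in> bops"
  unfolding corner_comult_def hat_def[symmetric] by (simp add: \<Delta>_bops)

text \<open>The recursions of row zero survive under \<open>\<Delta>\<^sub>0\<close>, with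
  \<open>v0 \<otimes> v0\<close> in place of \<open>v0\<close>. Slicing
  \<open>U13_U23_column\<close> at \<open>ket n\<close> turns the third-leg operator into the scalar
  \<open>s (Suc n)\<close> or \<open>q ^ n\<close>, and the corner isometries strip the
  hats.\<close>

lemma \<Delta>0_entry_Suc: "s (Suc n) *\<^sub>R \<Delta>\<^sub>0 (entry 0 (Suc n)) = (v0 \<otimes>\<^sub>o v0) o\<^sub>L \<Delta>\<^sub>0 (entry 0 n) o\<^sub>L \<Delta>\<^sub>p (b_plus q)"
  and \<Delta>0_entry_a: "q ^ n *\<^sub>R \<Delta>\<^sub>0 (entry 0 n) = (v0 \<otimes>\<^sub>o v0) o\<^sub>L \<Delta>\<^sub>0 (entry 0 n) o\<^sub>L \<Delta>\<^sub>p (adj (a_plus q))"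
proof -
  have step: "r *\<^sub>R \<Delta>\<^sub>0 (entry 0 m) = (v0 \<otimes>\<^sub>o v0) o\<^sub>L \<Delta>\<^sub>0 (entry 0 n) o\<^sub>L y"
    if t: "t \<in> bops" "t o\<^sub>L munit n 0 = r *\<^sub>R munit m 0"
      and y: "y \<in> bops" "z \<in> bops" "z o\<^sub>L (\<iota>\<^sub>G \<otimes>\<^sub>o \<iota>\<^sub>G) = (\<iota>\<^sub>G \<otimes>\<^sub>o \<iota>\<^sub>G) o\<^sub>L y"
      and eq: "(id_blinfun \<otimes>\<^sub>o munit 0 0) o\<^sub>L (U13 o\<^sub>L U23) o\<^sub>L (id_blinfun \<otimes>\<^sub>o t)
        = ((hatH v0 \<otimes>\<^sub>o hatH v0) \<otimes>\<^sub>o munit 0 0) o\<^sub>L (U13 o\<^sub>L U23) o\<^sub>L (z \<otimes>\<^sub>o id_blinfun)"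
    for r m t y z
  proof (rule otensor_munit_cancel)
    let ?H = "adj (\<iota>\<^sub>H \<otimes>\<^sub>o \<iota>\<^sub>H)" and ?G = "\<iota>\<^sub>G \<otimes>\<^sub>o \<iota>\<^sub>G"
    have v: "?H o\<^sub>L (hatH v0 \<otimes>\<^sub>o hatH v0) = (v0 \<otimes>\<^sub>o v0) o\<^sub>L ?H"
      by (simp add: otensor_compose hat_def blinfun_compose_assoc)
    have \<Delta>b: "\<Delta>\<^sub>0 (entry 0 k) \<in> bops" for k by (rule \<Delta>0_bops[OF entry_mem])
    show "r *\<^sub>R \<Delta>\<^sub>0 (entry 0 m) \<in> bops" "(v0 \<otimes>\<^sub>o v0) o\<^sub>L \<Delta>\<^sub>0 (entry 0 n) o\<^sub>L y \<in> bops"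
      using y by (simp_all add: \<Delta>b)
    have "(r *\<^sub>R \<Delta>\<^sub>0 (entry 0 m)) \<otimes>\<^sub>o munit 0 0 = r *\<^sub>R ((?H \<otimes>\<^sub>o munit 0 0) o\<^sub>L (U13 o\<^sub>L U23) o\<^sub>L (?G \<otimes>\<^sub>o munit m 0))"
      by (simp only: otensor_scaleR \<Delta>b munit_bops \<Delta>0_entry)
    also have "\<dots> = (?H \<otimes>\<^sub>o id_blinfun) o\<^sub>L ((id_blinfun \<otimes>\<^sub>o munit 0 0) o\<^sub>L (U13 o\<^sub>L U23) o\<^sub>L (id_blinfun \<otimes>\<^sub>o t)) o\<^sub>L (?G \<otimes>\<^sub>o munit n 0)"
      using t by (simp add: blinfun_compose_assoc otensor_compose otensor_compose[THEN ocomp_cong_tail] otensor_scaleR ocomp_linear)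
    also have "\<dots> = ((?H o\<^sub>L (hatH v0 \<otimes>\<^sub>o hatH v0)) \<otimes>\<^sub>o munit 0 0) o\<^sub>L (U13 o\<^sub>L U23) o\<^sub>L ((z o\<^sub>L ?G) \<otimes>\<^sub>o munit n 0)"
      unfolding eq using y by (simp add: blinfun_compose_assoc otensor_compose otensor_compose[THEN ocomp_cong_tail])
    also have "\<dots> = ((v0 \<otimes>\<^sub>o v0) \<otimes>\<^sub>o id_blinfun) o\<^sub>L ((?H \<otimes>\<^sub>o munit 0 0) o\<^sub>L (U13 o\<^sub>L U23) o\<^sub>L (?G \<otimes>\<^sub>o munit n 0)) o\<^sub>L (y \<otimes>\<^sub>o id_blinfun)"
      unfolding v y(3) using y(1) by (simp add: blinfun_compose_assoc otensor_compose otensor_compose[THEN ocomp_cong_tail])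
    also have "\<dots> = ((v0 \<otimes>\<^sub>o v0) o\<^sub>L \<Delta>\<^sub>0 (entry 0 n) o\<^sub>L y) \<otimes>\<^sub>o munit 0 0"
      unfolding \<Delta>0_entry[symmetric] using y(1) by (simp add: otensor_compose \<Delta>b)
    finally show "(r *\<^sub>R \<Delta>\<^sub>0 (entry 0 m)) \<otimes>\<^sub>o (munit 0 0 :: (nat, nat) opr)
      = ((v0 \<otimes>\<^sub>o v0) o\<^sub>L \<Delta>\<^sub>0 (entry 0 n) o\<^sub>L y) \<otimes>\<^sub>o munit 0 0" .
  qed
  show "s (Suc n) *\<^sub>R \<Delta>\<^sub>0 (entry 0 (Suc n)) = (v0 \<otimes>\<^sub>o v0) o\<^sub>L \<Delta>\<^sub>0 (entry 0 n) o\<^sub>L \<Delta>\<^sub>p (b_plus q)"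
    by (rule step[OF _ A_op_munit(1)[OF q] _ _ _ U13_U23_column(1)])
      (simp_all add: \<Delta>p_b ocomp_linear otensor_compose hat_def blinfun_compose_assoc)
  have "\<Delta>\<^sub>p (adj (a_plus q)) = adj (a_plus q) \<otimes>\<^sub>o adj (a_plus q) - q *\<^sub>R (b_plus q \<otimes>\<^sub>o adj (b_plus q))"
    by (simp add: star_homD[OF \<Delta>p_hom] N_closed \<Delta>p_a)
  then show "q ^ n *\<^sub>R \<Delta>\<^sub>0 (entry 0 n) = (v0 \<otimes>\<^sub>o v0) o\<^sub>L \<Delta>\<^sub>0 (entry 0 n) o\<^sub>L \<Delta>\<^sub>p (adj (a_plus q))"
    by (intro step[OF _ B_op_munit(1)[OF q] _ _ _ U13_U23_column(2)])
      (simp_all add: ocomp_linear otensor_compose hat_def blinfun_compose_assoc)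
qed

end

section \<open>Norm convergence of the series\<close>

text \<open>At each vector the tail is bounded by the tail of the sum of \<open>g\<close> times the
  norm of the vector, which is a bound in operator norm. As the limit is known in advance,
  completeness of the target space does not enter.\<close>

lemma strong_sums_imp_sums:
  fixes f :: "nat \<Rightarrow> 'a::real_normed_vector \<Rightarrow>\<^sub>L 'b::real_normed_vector"
  assumes T: "\<And>\<xi>. (\<lambda>p. blinfun_apply (f p) \<xi>) sums blinfun_apply T \<xi>"
    and f: "\<And>p. norm (f p) \<le> g p" and g: "summable g"
  shows "f sums T"
proof -
  have g0: "0 \<le> g p" for p using f[of p] norm_ge_zero order.trans by blast
  have "norm (T - (\<Sum>p<N. f p)) \<le> (\<Sum>p. g (p + N))" for N
  proof (rule norm_blinfun_bound)
    show "0 \<le> (\<Sum>p. g (p + N))" by (intro suminf_nonneg summable_ignore_initial_segment g g0)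
    fix \<xi>
    have "(\<lambda>M. norm (\<Sum>p<M. blinfun_apply (f (p + N)) \<xi>)) \<longlonglongrightarrow> norm (blinfun_apply T \<xi> - (\<Sum>p<N. blinfun_apply (f p) \<xi>))"
      using sums_split_initial_segment[OF T[of \<xi>], of N] unfolding sums_def by (rule tendsto_norm)
    then have "(\<lambda>M. norm (\<Sum>p<M. blinfun_apply (f (p + N)) \<xi>)) \<longlonglongrightarrow> norm (blinfun_apply (T - (\<Sum>p<N. f p)) \<xi>)"
      by (simp add: blinfun.bilinear_simps blinfun.sum_left)
    moreover have "norm (\<Sum>p<M. blinfun_apply (f (p + N)) \<xi>) \<le> (\<Sum>p. g (p + N)) * norm \<xi>" for M
    proof -
      have "norm (\<Sum>p<M. blinfun_apply (f (p + N)) \<xi>) \<le> (\<Sum>p<M. g (p + N) * norm \<xi>)"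
        by (rule sum_norm_le) (meson f mult_right_mono norm_blinfun norm_ge_zero order.trans)
      also have "\<dots> \<le> (\<Sum>p. g (p + N)) * norm \<xi>"
        unfolding sum_distrib_right[symmetric]
        by (intro mult_right_mono sum_le_suminf summable_ignore_initial_segment g g0) auto
      finally show ?thesis .
    qed
    ultimately show "norm (blinfun_apply (T - (\<Sum>p<N. f p)) \<xi>) \<le> (\<Sum>p. g (p + N)) * norm \<xi>"
      by (auto intro: LIMSEQ_le_const2)
  qed
  then have "(\<lambda>N. T - (\<Sum>p<N. f p)) \<longlonglongrightarrow> 0"
    by (intro Lim_null_comparison[OF always_eventually suminf_exist_split2[OF g]]) simp
  from tendsto_diff[OF tendsto_const this, of T]
  show ?thesis by (simp add: sums_def)
qed

lemma norm_opow_le: "norm x \<le> c \<Longrightarrow> norm (opow x n) \<le> c ^ n"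
proof (induction n)
  case 0
  have "norm (id_blinfun :: 'a ell2 \<Rightarrow>\<^sub>L 'a ell2) \<le> 1" by (rule norm_blinfun_bound) simp_all
  then show ?case by simp
next
  case (Suc n)
  have "0 \<le> c" using Suc.prems norm_ge_zero order.trans by blast
  have "norm (opow x (Suc n)) \<le> norm x * norm (opow x n)"
    unfolding opow_Suc by (rule norm_blinfun_compose)
  also have "\<dots> \<le> c * c ^ n" using Suc \<open>0 \<le> c\<close> by (intro mult_mono) auto
  finally show ?case by simp
qed

text \<open>The squared norm of the image of \<eta> under \<open>adj x\<close> is the inner product
  of \<open>x (adj x \<eta>)\<close> with \<eta>; Cauchy-Schwarz and one cancellation give the
  bound.\<close>

lemma norm_adj_le: "x \<in> bops \<Longrightarrow> norm (adj x) \<le> norm x"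
proof (rule norm_blinfun_bound)
  fix \<eta> assume x: "x \<in> bops"
  have "of_real ((norm (blinfun_apply (adj x) \<eta>))\<^sup>2) = cinner (blinfun_apply x (blinfun_apply (adj x) \<eta>)) \<eta>"
    using x by (simp add: cinner_self[symmetric] cinner_adj del: of_real_power)
  then have "(norm (blinfun_apply (adj x) \<eta>))\<^sup>2 \<le> norm (blinfun_apply x (blinfun_apply (adj x) \<eta>)) * norm \<eta>"
    by (metis cinner_cauchy_schwarz norm_of_real abs_power2 real_norm_def abs_of_nonneg zero_le_power2)
  also have "\<dots> \<le> (norm x * norm (blinfun_apply (adj x) \<eta>)) * norm \<eta>"
    by (intro mult_right_mono norm_blinfun) simp
  finally show "norm (blinfun_apply (adj x) \<eta>) \<le> norm x * norm \<eta>"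
    by (cases "norm (blinfun_apply (adj x) \<eta>) = 0") (auto simp: power2_eq_square mult_ac)
qed simp

text \<open>The truncations are contractions that eventually fix each finite combination of basis
  vectors, and these are dense. They do not converge in operator norm, which is why the series is
  treated strongly at this stage.\<close>

lemma munit_truncation:
  fixes \<Phi> :: "('i \<times> nat) ell2"
  shows "(\<lambda>N. blinfun_apply (id_blinfun \<otimes>\<^sub>o (\<Sum>k<N. munit k k)) \<Phi>) \<longlonglongrightarrow> \<Phi>"
proof (rule LIMSEQ_I)
  define F :: "nat \<Rightarrow> ('i \<times> nat, 'i \<times> nat) opr" where "F N = id_blinfun \<otimes>\<^sub>o (\<Sum>k<N. munit k k)" for N
  have Fk: "blinfun_apply (F N) (ket (i, k)) = of_bool (k < N) *\<^sub>R ket (i, k)" for N i k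
  proof -
    have "blinfun_apply (\<Sum>k<N. munit k k) (ket k) = of_bool (k < N) *\<^sub>R ket k"
      by (simp add: blinfun.sum_left munit_ket of_bool_def if_distrib if_distribR cong: if_cong)
    then show ?thesis by (simp add: F_def otensor_ket vtensor_simps ket_vtensor)
  qed
  have Fb: "F N \<in> bops" for N by (simp add: F_def)
  have nF: "norm (F N) \<le> 1" for N
  proof -
    obtain x :: "('i \<times> nat, 'i \<times> nat) opr" where x: "x \<in> bops" "\<And>p. blinfun_apply x (ket p) = of_bool (snd p < N) *\<^sub>R ket p" "norm x \<le> 1"
      using weighted_basis_map_exists[of "\<lambda>p. p" "\<lambda>p. of_bool (snd p < N)" 1] by (auto simp: inj_on_def)
    have "F N = x" by (rule bops_eqI) (auto simp: Fb x Fk)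
    with x show ?thesis by simp
  qed
  fix e :: real assume e: "0 < e"
  obtain S where S: "finite S" "norm ((\<Sum>p\<in>S. cmul (coord \<Phi> p) (ket p)) - \<Phi>) < e / 2"
    using ket_expansion[of \<Phi>] e unfolding has_sum_def
    by (auto simp: tendsto_iff dist_norm eventually_finite_subsets_at_top dest!: spec[of _ "e / 2"])
  define \<Psi> where "\<Psi> = (\<Sum>p\<in>S. cmul (coord \<Phi> p) (ket p))"
  obtain M where M: "\<And>p. p \<in> S \<Longrightarrow> snd p < M"
    using S(1) finite_nat_set_iff_bounded[of "snd ` S"] by auto
  have "norm (blinfun_apply (F N) \<Phi> - \<Phi>) < e" if "M \<le> N" for N
  proof -
    have "blinfun_apply (F N) (cmul (coord \<Phi> p) (ket p)) = cmul (coord \<Phi> p) (ket p)" if "p \<in> S" for p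
      using M[OF that] \<open>M \<le> N\<close> by (cases p) (simp add: bops_apply[OF Fb] Fk)
    then have "blinfun_apply (F N) \<Psi> = \<Psi>" by (simp add: \<Psi>_def blinfun.sum_right)
    then have eq: "blinfun_apply (F N) \<Phi> - \<Phi> = blinfun_apply (F N) (\<Phi> - \<Psi>) + (\<Psi> - \<Phi>)"
      by (simp add: blinfun.diff_right)
    have "norm (blinfun_apply (F N) \<Phi> - \<Phi>) \<le> norm (blinfun_apply (F N) (\<Phi> - \<Psi>)) + norm (\<Psi> - \<Phi>)"
      unfolding eq by (rule norm_triangle_ineq)
    also have "norm (blinfun_apply (F N) (\<Phi> - \<Psi>)) \<le> norm (F N) * norm (\<Phi> - \<Psi>)" by (rule norm_blinfun)
    also have "\<dots> \<le> 1 * norm (\<Phi> - \<Psi>)" by (intro mult_right_mono nF) simp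
    finally show ?thesis using S(2) by (simp add: \<Psi>_def[symmetric] norm_minus_commute)
  qed
  then show "\<exists>M. \<forall>N\<ge>M. norm (blinfun_apply (id_blinfun \<otimes>\<^sub>o (\<Sum>k<N. munit k k)) \<Phi> - \<Phi>) < e"
    unfolding F_def by blast
qed

lemma v0_pow_int [simp]: "v0_pow (int n) = opow v0 n"
  by (simp add: v0_pow_def)

context linking_corepresentation
begin

abbreviation "\<Gamma> \<equiv> \<Delta>\<^sub>0 (L0plus q)"

lemma entry_00: "entry 0 0 = L0plus q"
  using q by (simp add: row_zero)

text \<open>The coefficient of the series splits into two equal square roots, one normalizing an
  entry of row zero and the other an entry of column zero.\<close>

lemma Delta_term_eq: "Delta_term q k = entry 0 k \<otimes>\<^sub>o entry k 0"
  by (simp add: Delta_term_def row_zero column_zero otensor_scaleR qpoch_pos[OF q] less_imp_le del: scaleR_minus_left)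

text \<open>Inserting \<open>1 \<otimes> munit k k\<close> between \<open>U13\<close> and
  \<open>U23\<close> isolates one term of the series. The truncated sums of these insertions tend
  strongly to 1 and are multiplied on the left by a fixed bounded operator; \<open>kappa 0\<close>
  removes the auxiliary third leg.\<close>

lemma Delta_term_strong_sums: "(\<lambda>k. blinfun_apply (Delta_term q k) \<xi>) sums blinfun_apply \<Gamma> \<xi>"
proof -
  let ?H = "adj (\<iota>\<^sub>H \<otimes>\<^sub>o \<iota>\<^sub>H) \<otimes>\<^sub>o (munit 0 0 :: (nat, nat) opr)" and ?G = "(\<iota>\<^sub>G \<otimes>\<^sub>o \<iota>\<^sub>G) \<otimes>\<^sub>o (munit 0 0 :: (nat, nat) opr)"
  have \<Gamma>b: "\<Gamma> \<in> bops" using \<Delta>0_bops[OF entry_mem[of 0 0]] by (simp add: entry_00)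
  have unit: "?H o\<^sub>L (U13 o\<^sub>L ((id_blinfun \<otimes>\<^sub>o munit k k) o\<^sub>L U23)) o\<^sub>L ?G = Delta_term q k \<otimes>\<^sub>o munit 0 0" for k
  proof -
    have "?H o\<^sub>L (U13 o\<^sub>L ((id_blinfun \<otimes>\<^sub>o munit k k) o\<^sub>L U23)) o\<^sub>L ?G
      = (adj (\<iota>\<^sub>H \<otimes>\<^sub>o \<iota>\<^sub>H) \<otimes>\<^sub>o id_blinfun)
        o\<^sub>L leg13 ((id_blinfun \<otimes>\<^sub>o munit 0 0) o\<^sub>L U o\<^sub>L (id_blinfun \<otimes>\<^sub>o munit k 0))
        o\<^sub>L leg23 ((id_blinfun \<otimes>\<^sub>o munit 0 k) o\<^sub>L U o\<^sub>L (id_blinfun \<otimes>\<^sub>o munit 0 0))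
        o\<^sub>L ((\<iota>\<^sub>G \<otimes>\<^sub>o \<iota>\<^sub>G) \<otimes>\<^sub>o id_blinfun)"
      by (simp add: leg_compose leg_otensor blinfun_compose_assoc otensor_compose otensor_compose[THEN ocomp_cong_tail] munit_compose)
    also have "\<dots> = (entry 0 k \<otimes>\<^sub>o entry k 0) \<otimes>\<^sub>o munit 0 0"
      unfolding U_slice by (simp add: leg_otensor otensor_compose munit_compose hat_def blinfun_compose_assoc)
    finally show ?thesis by (simp add: Delta_term_eq)
  qed
  have Db: "Delta_term q k \<in> bops" for k by (simp add: Delta_term_eq)
  have sum: "(\<Sum>k<N. blinfun_apply (Delta_term q k) \<xi>) = blinfun_apply (adj (kappa 0) o\<^sub>L ?H o\<^sub>L U13)
      (blinfun_apply (id_blinfun \<otimes>\<^sub>o (\<Sum>k<N. munit k k)) (blinfun_apply (U23 o\<^sub>L ?G o\<^sub>L kappa 0) \<xi>))" for N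
  proof -
    have k: "adj (kappa 0) o\<^sub>L (Delta_term q k \<otimes>\<^sub>o munit 0 0) o\<^sub>L kappa 0 = Delta_term q k" for k
      by (simp add: Db blinfun_compose_assoc adj_kappa_kappa[THEN ocomp_cong_tail] flip: otensor_munit)
    have "blinfun_apply (Delta_term q k) \<xi> = blinfun_apply (adj (kappa 0) o\<^sub>L ?H o\<^sub>L U13)
      (blinfun_apply (id_blinfun \<otimes>\<^sub>o munit k k) (blinfun_apply (U23 o\<^sub>L ?G o\<^sub>L kappa 0) \<xi>))" for k
      by (subst k[symmetric], subst unit[symmetric]) simp
    then show ?thesis by (simp add: otensor_sum_right blinfun.sum_left blinfun.sum_right)
  qed
  have "\<Gamma> = adj (kappa 0) o\<^sub>L (\<Gamma> \<otimes>\<^sub>o munit 0 0) o\<^sub>L kappa 0"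
    by (simp add: \<Gamma>b blinfun_compose_assoc adj_kappa_kappa[THEN ocomp_cong_tail] flip: otensor_munit)
  also have "\<Gamma> \<otimes>\<^sub>o munit 0 0 = ?H o\<^sub>L (U13 o\<^sub>L U23) o\<^sub>L ?G"
    using \<Delta>0_entry[of 0] by (simp add: entry_00)
  finally have g: "\<Gamma> = adj (kappa 0) o\<^sub>L (?H o\<^sub>L (U13 o\<^sub>L U23) o\<^sub>L ?G) o\<^sub>L kappa 0" .
  have \<Gamma>: "blinfun_apply \<Gamma> \<xi> = blinfun_apply (adj (kappa 0) o\<^sub>L ?H o\<^sub>L U13) (blinfun_apply (U23 o\<^sub>L ?G o\<^sub>L kappa 0) \<xi>)"
    unfolding g by simp
  show ?thesis
    unfolding sums_def sum \<Gamma> by (intro blinfun.tendsto tendsto_const munit_truncation)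
qed

text \<open>All factors are contractions except the power of \<open>- q adj b\<close>, which
  contributes \<open>q ^ p\<close>; the coefficient \<open>1 / qpoch q p\<close> is at most
  \<open>1 / qpoch_inf q\<close>.\<close>

lemma norm_Delta_term: "norm (Delta_term q p) \<le> (1 / qpoch_inf q) * q ^ p"
proof -
  have nB: "norm (b_plus q) \<le> 1"
    unfolding b_plus_eq[OF q]
    by (rule order.trans[OF norm_otensor]) (auto intro!: mult_le_one norm_B_op[OF q] norm_bishift)
  have nv: "norm v0 \<le> 1"
    unfolding v0_def
    by (rule order.trans[OF norm_otensor])
      (auto intro!: mult_le_one norm_blinfun_bound order.trans[OF norm_adj_le norm_bishift])
  have nb: "norm ((- q) *\<^sub>R adj (b_plus q)) \<le> q"
    using order.trans[OF norm_adj_le[OF bops(3)] nB] q by (simp add: mult_left_le)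
  let ?x = "opow v0 p o\<^sub>L L0plus q" 
  have nx: "norm ?x \<le> 1"
    by (rule order.trans[OF norm_blinfun_compose mult_le_one])
      (use norm_opow_le[OF nv, of p] norm_L0plus[OF q] in auto)
  have 1: "norm (?x o\<^sub>L opow (b_plus q) p) \<le> 1"
    by (rule order.trans[OF norm_blinfun_compose mult_le_one]) (use nx norm_opow_le[OF nB, of p] in auto)
  have "norm (?x o\<^sub>L opow ((- q) *\<^sub>R adj (b_plus q)) p) \<le> norm ?x * norm (opow ((- q) *\<^sub>R adj (b_plus q)) p)"
    by (rule norm_blinfun_compose)
  also have "\<dots> \<le> 1 * q ^ p" by (intro mult_mono nx norm_opow_le[OF nb]) auto
  finally have 2: "norm (?x o\<^sub>L opow ((- q) *\<^sub>R adj (b_plus q)) p) \<le> q ^ p" by simp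
  have "norm ((?x o\<^sub>L opow (b_plus q) p) \<otimes>\<^sub>o (?x o\<^sub>L opow ((- q) *\<^sub>R adj (b_plus q)) p))
    \<le> norm (?x o\<^sub>L opow (b_plus q) p) * norm (?x o\<^sub>L opow ((- q) *\<^sub>R adj (b_plus q)) p)"
    by (rule norm_otensor) simp_all
  also have "\<dots> \<le> 1 * q ^ p" by (intro mult_mono 1 2) auto
  finally have 3: "norm ((?x o\<^sub>L opow (b_plus q) p) \<otimes>\<^sub>o (?x o\<^sub>L opow ((- q) *\<^sub>R adj (b_plus q)) p)) \<le> q ^ p" by simp
  have "norm (Delta_term q p) = (1 / qpoch q p) * norm ((?x o\<^sub>L opow (b_plus q) p) \<otimes>\<^sub>o (?x o\<^sub>L opow ((- q) *\<^sub>R adj (b_plus q)) p))"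
    using qpoch_pos[OF q, of p] by (simp add: Delta_term_def del: scaleR_minus_left)
  also have "\<dots> \<le> (1 / qpoch_inf q) * q ^ p"
    using 3 qpoch_inf_bounds(2)[OF q, of p] qpoch_inf_bounds(1)[OF q] q
    by (intro mult_mono) (auto intro!: frac_le)
  finally show ?thesis .
qed

lemma Delta_term_sums: "Delta_term q sums \<Gamma>"
  by (rule strong_sums_imp_sums[OF Delta_term_strong_sums norm_Delta_term])
    (use q in \<open>auto intro!: summable_mult summable_geometric\<close>)

section \<open>The comultiplication on \<open>v\<^sub>0\<^sup>r L\<^sub>0\<^sub>+\<close>\<close>

abbreviation "mon n j \<equiv> opow v0 n o\<^sub>L L0plus q o\<^sub>L opow (b_plus q) j"
abbreviation "vv \<equiv> v0 \<otimes>\<^sub>o v0"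

lemma opow_mem: "x \<in> L_SUq2 q \<Longrightarrow> opow x n \<in> L_SUq2 q"
  by (induction n) (simp_all add: opow_Suc N_closed)

lemma mon_entry: "mon n n = sqrt (qpoch q n) *\<^sub>R entry 0 n"
  using qpoch_pos[OF q, of n] by (simp add: row_zero)

text \<open>The image of \<open>v0 L0plus adj a = L0plus\<close> under the comultiplication. It
  allows a factor \<open>v0 \<otimes> v0\<close> to be created or absorbed next to
  \<open>\<Gamma>\<close>.\<close>

lemma \<Gamma>_a: "vv o\<^sub>L \<Gamma> o\<^sub>L \<Delta>\<^sub>p (adj (a_plus q)) = \<Gamma>"
  using \<Delta>0_entry_a[of 0] by (simp add: entry_00)

text \<open>Inserting \<open>1 = adj a a + b adj b\<close> on the right: in the first part
  \<open>adj a\<close> moves left through the powers of \<open>b\<close> to \<open>L0plus\<close>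
  and removes one \<open>v0\<close>, in the second part the power of \<open>b\<close> grows.\<close>

lemma mon_step: "mon (Suc n) j = q ^ j *\<^sub>R (mon n j o\<^sub>L a_plus q) + (mon (Suc n) (Suc j) o\<^sub>L adj (b_plus q))"
proof -
  have 1: "mon (Suc n) j o\<^sub>L (adj (a_plus q) o\<^sub>L a_plus q)
      = opow v0 n o\<^sub>L (v0 o\<^sub>L L0plus q o\<^sub>L (opow (b_plus q) j o\<^sub>L adj (a_plus q))) o\<^sub>L a_plus q"
    by (simp add: opow_Suc2[of v0] blinfun_compose_assoc)
  also have "\<dots> = q ^ j *\<^sub>R (opow v0 n o\<^sub>L (v0 o\<^sub>L L0plus q o\<^sub>L adj (a_plus q)) o\<^sub>L opow (b_plus q) j o\<^sub>L a_plus q)"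
    unfolding opow_b_a[OF q] by (simp add: ocomp_linear blinfun_compose_assoc)
  finally have a: "mon (Suc n) j o\<^sub>L (adj (a_plus q) o\<^sub>L a_plus q) = q ^ j *\<^sub>R (mon n j o\<^sub>L a_plus q)"
    unfolding v0_L0plus_a[OF q] .
  have "mon (Suc n) j = mon (Suc n) j o\<^sub>L ((adj (a_plus q) o\<^sub>L a_plus q) + (b_plus q o\<^sub>L adj (b_plus q)))"
    using ab_sum[OF q] by (simp add: add.commute)
  also have "\<dots> = (mon (Suc n) j o\<^sub>L (adj (a_plus q) o\<^sub>L a_plus q)) + (mon (Suc n) j o\<^sub>L (b_plus q o\<^sub>L adj (b_plus q)))"
    by (simp only: ocomp_linear)
  also have "mon (Suc n) j o\<^sub>L (b_plus q o\<^sub>L adj (b_plus q)) = mon (Suc n) (Suc j) o\<^sub>L adj (b_plus q)"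
    by (simp add: opow_Suc2[of "b_plus q"] blinfun_compose_assoc)
  finally show ?thesis unfolding a .
qed

text \<open>The entries give the diagonal \<open>j = n\<close>. For fixed \<open>n + 1\<close> the
  exponent \<open>j\<close> is then lowered from the diagonal to 0: \<open>mon_step\<close>
  expresses \<open>mon (n + 1) j\<close> through \<open>mon n j\<close>, known from the outer
  induction, and \<open>mon (n + 1) (j + 1)\<close>, known from the inner one.\<close>

lemma \<Delta>0_mon:
  assumes "j \<le> n"
  shows "hatX (mon n j) \<in> Q \<and> \<Delta>\<^sub>0 (mon n j) = opow vv n o\<^sub>L \<Gamma> o\<^sub>L \<Delta>\<^sub>p (opow (b_plus q) j)"
  using assms
proof (induction n arbitrary: j)
  case 0
  then show ?case using entry_mem[of 0 0] by (simp add: entry_00 \<Delta>p_id)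
next
  case (Suc n)
  from Suc.prems show ?case
  proof (induction j rule: inc_induct)
    case base
    have "\<Delta>\<^sub>0 (mon (Suc n) (Suc n)) = sqrt (qpoch q (Suc n)) *\<^sub>R \<Delta>\<^sub>0 (entry 0 (Suc n))"
      unfolding mon_entry by (rule \<Delta>0_scale(1)[OF entry_mem])
    also have "sqrt (qpoch q (Suc n)) = sqrt (qpoch q n) * s (Suc n)"
      by (simp add: qpoch_Suc[OF q] real_sqrt_mult del: mult_Suc_right power_Suc)
    also have "\<dots> *\<^sub>R \<Delta>\<^sub>0 (entry 0 (Suc n)) = vv o\<^sub>L (sqrt (qpoch q n) *\<^sub>R \<Delta>\<^sub>0 (entry 0 n)) o\<^sub>L \<Delta>\<^sub>p (b_plus q)"
      unfolding scaleR_scaleR[symmetric] \<Delta>0_entry_Suc by (simp add: ocomp_linear)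
    also have "sqrt (qpoch q n) *\<^sub>R \<Delta>\<^sub>0 (entry 0 n) = \<Delta>\<^sub>0 (mon n n)"
      unfolding mon_entry by (rule \<Delta>0_scale(1)[OF entry_mem, symmetric])
    also have "vv o\<^sub>L \<Delta>\<^sub>0 (mon n n) o\<^sub>L \<Delta>\<^sub>p (b_plus q) = opow vv (Suc n) o\<^sub>L \<Gamma> o\<^sub>L \<Delta>\<^sub>p (opow (b_plus q) (Suc n))"
      using Suc.IH[of n]
      by (simp add: opow_Suc[of vv] opow_Suc2[of "b_plus q"] star_homD[OF \<Delta>p_hom] opow_mem N_closed blinfun_compose_assoc)
    finally show ?case
      using \<Delta>0_scale(3)[OF entry_mem] unfolding mon_entry by blast
  next
    case (step j)
    let ?b = "b_plus q" and ?a = "a_plus q"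
    have IH: "hatX (mon n j) \<in> Q" "\<Delta>\<^sub>0 (mon n j) = opow vv n o\<^sub>L \<Gamma> o\<^sub>L \<Delta>\<^sub>p (opow ?b j)"
      using Suc.IH[of j] step by auto
    note IH' = step.IH[THEN conjunct1] step.IH[THEN conjunct2]
    have m1: "hatX (mon n j o\<^sub>L ?a) \<in> Q" and m2: "hatX (mon (Suc n) (Suc j) o\<^sub>L adj ?b) \<in> Q"
      using IH IH' by (auto intro!: hatX_mem_compose N_closed)
    have m1': "hatX (q ^ j *\<^sub>R (mon n j o\<^sub>L ?a)) \<in> Q" by (rule \<Delta>0_scale(3)[OF m1])
    have "\<Delta>\<^sub>0 (mon (Suc n) j) = q ^ j *\<^sub>R \<Delta>\<^sub>0 (mon n j o\<^sub>L ?a) + \<Delta>\<^sub>0 (mon (Suc n) (Suc j) o\<^sub>L adj ?b)"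
      unfolding mon_step[of n j] by (simp only: \<Delta>0_add(1)[OF m1' m2] \<Delta>0_scale(1)[OF m1])
    also have "\<dots> = q ^ j *\<^sub>R (opow vv n o\<^sub>L \<Gamma> o\<^sub>L \<Delta>\<^sub>p (opow ?b j) o\<^sub>L \<Delta>\<^sub>p ?a)
        + (opow vv (Suc n) o\<^sub>L \<Gamma> o\<^sub>L \<Delta>\<^sub>p (opow ?b (Suc j)) o\<^sub>L \<Delta>\<^sub>p (adj ?b))"
      by (subst (1 2) \<Delta>0_compose) (simp_all add: IH IH' N_closed)
    \<comment> \<open>Writing \<open>\<Gamma>\<close> as in \<open>\<Gamma>_a\<close> supplies the
      missing \<open>v0 \<otimes> v0\<close>, so that both summands share a prefix; the arguments of
      \<open>\<Delta>\<^sub>p\<close> then add up to \<open>opow b j\<close>.\<close>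
    also have "opow vv n o\<^sub>L \<Gamma> o\<^sub>L \<Delta>\<^sub>p (opow ?b j) o\<^sub>L \<Delta>\<^sub>p ?a
        = opow vv n o\<^sub>L (vv o\<^sub>L \<Gamma> o\<^sub>L \<Delta>\<^sub>p (adj ?a)) o\<^sub>L \<Delta>\<^sub>p (opow ?b j) o\<^sub>L \<Delta>\<^sub>p ?a"
      unfolding \<Gamma>_a ..
    also have "q ^ j *\<^sub>R (opow vv n o\<^sub>L (vv o\<^sub>L \<Gamma> o\<^sub>L \<Delta>\<^sub>p (adj ?a)) o\<^sub>L \<Delta>\<^sub>p (opow ?b j) o\<^sub>L \<Delta>\<^sub>p ?a)
        + (opow vv (Suc n) o\<^sub>L \<Gamma> o\<^sub>L \<Delta>\<^sub>p (opow ?b (Suc j)) o\<^sub>L \<Delta>\<^sub>p (adj ?b))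
        = opow vv (Suc n) o\<^sub>L \<Gamma> o\<^sub>L \<Delta>\<^sub>p ((q ^ j *\<^sub>R (adj ?a o\<^sub>L opow ?b j) o\<^sub>L ?a) + (opow ?b (Suc j) o\<^sub>L adj ?b))"
      by (simp add: opow_Suc2[of vv] star_homD[OF \<Delta>p_hom] N_closed opow_mem ocomp_linear blinfun_compose_assoc)
    also have "(q ^ j *\<^sub>R (adj ?a o\<^sub>L opow ?b j) o\<^sub>L ?a) + (opow ?b (Suc j) o\<^sub>L adj ?b)
        = opow ?b j o\<^sub>L ((?b o\<^sub>L adj ?b) + (adj ?a o\<^sub>L ?a))"
      unfolding opow_b_a[OF q, symmetric] by (simp add: opow_Suc2[of ?b] ocomp_linear blinfun_compose_assoc)
    finally show ?case
      using \<Delta>0_add(2)[OF m1' m2] mon_step[of n j] by (simp add: ab_sum[OF q])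
  qed
qed

lemma vv_unitary: "adj vv o\<^sub>L vv = id_blinfun" "vv o\<^sub>L adj vv = id_blinfun"
  by (simp_all add: otensor_compose v0_unitary)

lemma \<Delta>0_v0_pow:
  "hatX (v0_pow r o\<^sub>L L0plus q) \<in> Q \<and> \<Delta>\<^sub>0 (v0_pow r o\<^sub>L L0plus q) = (v0_pow r \<otimes>\<^sub>o v0_pow r) o\<^sub>L \<Gamma>"
proof (cases "0 \<le> r")
  case True
  then obtain n where "r = int n" by (metis nonneg_int_cases)
  then show ?thesis using \<Delta>0_mon[of 0 n] by (simp add: \<Delta>p_id otensor_opow)
next
  case False
  then obtain n where n: "- r = int n" by (metis nonneg_int_cases neg_0_le_iff_le linear)
  then have r: "v0_pow r = opow (adj v0) n" using False by (simp add: v0_pow_def)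
  have L: "adj v0 o\<^sub>L L0plus q = L0plus q o\<^sub>L adj (a_plus q)"
    by (subst v0_L0plus_a[OF q, symmetric]) (simp add: blinfun_compose_assoc v0_unitary[THEN ocomp_cong_tail])
  \<comment> \<open>The counterpart for \<open>\<Gamma>\<close> of the preceding relation for
    \<open>L0plus\<close>: on both sides one inverse power is exchanged for a right factor,
    \<open>adj a\<close> or its comultiplication.\<close>
  have \<Gamma>: "adj vv o\<^sub>L \<Gamma> = \<Gamma> o\<^sub>L \<Delta>\<^sub>p (adj (a_plus q))"
    by (subst \<Gamma>_a[symmetric]) (simp add: blinfun_compose_assoc vv_unitary[THEN ocomp_cong_tail] del: otensor_adj)
  have "hatX (opow (adj v0) n o\<^sub>L L0plus q) \<in> Q \<and> \<Delta>\<^sub>0 (opow (adj v0) n o\<^sub>L L0plus q) = opow (adj vv) n o\<^sub>L \<Gamma>"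
  proof (induction n)
    case 0
    then show ?case using entry_mem[of 0 0] by (simp add: entry_00)
  next
    case (Suc n)
    have "opow (adj v0) (Suc n) o\<^sub>L L0plus q = (opow (adj v0) n o\<^sub>L L0plus q) o\<^sub>L adj (a_plus q)"
      by (simp add: opow_Suc2 L blinfun_compose_assoc)
    moreover have "opow (adj vv) (Suc n) o\<^sub>L \<Gamma> = (opow (adj vv) n o\<^sub>L \<Gamma>) o\<^sub>L \<Delta>\<^sub>p (adj (a_plus q))"
      by (simp add: opow_Suc2 \<Gamma> blinfun_compose_assoc del: otensor_adj)
    ultimately show ?case
      using Suc by (auto intro!: hatX_mem_compose simp: \<Delta>0_compose N_closed)
  qed
  then show ?thesis by (simp add: r otensor_opow)
qed

section \<open>Uniqueness of the comultiplication on \<open>C_X\<close>\<close>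

lemma star_alg_mem: "x \<in> pol_SUq2 q \<Longrightarrow> x \<in> L_SUq2 q"
  unfolding pol_SUq2_def by (induction rule: star_alg.induct) (auto simp: N_closed)

lemma C_X_generator_in:
  "cscale c (v0_pow r o\<^sub>L L0plus q o\<^sub>L opow (b_plus q) m o\<^sub>L opow (adj (b_plus q)) t) \<in> C_X q"
  unfolding C_X_def by (rule span_base) blast

text \<open>Each generator of \<open>C_X\<close> is \<open>v0_pow r L0plus\<close> times a
  polynomial in \<open>b\<close> and \<open>adj b\<close>, so \<open>base\<close> and
  \<open>module\<close> determine \<open>D\<close> there. The rest is span induction, carried out
  together with membership in \<open>Q\<close>, which the additivity of
  \<open>\<Delta>\<^sub>0\<close> requires.\<close>

lemma comultiplication_unique:
  assumes add: "\<And>x y. x \<in> C_X q \<Longrightarrow> y \<in> C_X q \<Longrightarrow> D (x + y) = D x + D y"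
    and scale: "\<And>c x. x \<in> C_X q \<Longrightarrow> D (cscale c x) = cscale c (D x)"
    and module: "\<And>x y. x \<in> C_X q \<Longrightarrow> y \<in> pol_SUq2 q \<Longrightarrow> D (x o\<^sub>L y) = D x o\<^sub>L \<Delta>\<^sub>p y"
    and base: "\<And>r. D (v0_pow r o\<^sub>L L0plus q) = (v0_pow r \<otimes>\<^sub>o v0_pow r) o\<^sub>L \<Gamma>"
    and x: "x \<in> C_X q"
  shows "D x = \<Delta>\<^sub>0 x"
proof -
  let ?g = "\<lambda>r m t. v0_pow r o\<^sub>L L0plus q o\<^sub>L opow (b_plus q) m o\<^sub>L opow (adj (b_plus q)) t"
  have c1: "cscale 1 y = y" for y :: "('i, 'j) opr" by (rule blinfun_eqI) simp
  have gC: "?g r m t \<in> C_X q" for r m t using C_X_generator_in[of 1 r m t] by (simp add: c1)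
  have pol: "opow (b_plus q) m \<in> pol_SUq2 q" "opow (adj (b_plus q)) m \<in> pol_SUq2 q" for m
    unfolding pol_SUq2_def by (induction m) (auto simp: opow_Suc intro: star_alg.intros)
  have gen: "hatX (?g r m t) \<in> Q \<and> D (?g r m t) = \<Delta>\<^sub>0 (?g r m t)" for r m t
  proof -
    let ?y = "opow (b_plus q) m o\<^sub>L opow (adj (b_plus q)) t"
    have y: "?y \<in> pol_SUq2 q" using pol unfolding pol_SUq2_def by (auto intro: star_alg.mult)
    have "D ((v0_pow r o\<^sub>L L0plus q) o\<^sub>L ?y) = \<Delta>\<^sub>0 ((v0_pow r o\<^sub>L L0plus q) o\<^sub>L ?y)"
      using module[OF _ y, of "v0_pow r o\<^sub>L L0plus q"] gC[of r 0 0] \<Delta>0_v0_pow[of r] star_alg_mem[OF y]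
      by (simp add: base \<Delta>0_compose)
    moreover have "hatX ((v0_pow r o\<^sub>L L0plus q) o\<^sub>L ?y) \<in> Q"
      using \<Delta>0_v0_pow[of r] star_alg_mem[OF y] by (auto intro: hatX_mem_compose)
    ultimately show ?thesis by (simp add: blinfun_compose_assoc)
  qed
  \<comment> \<open>Zero is a scalar multiple of a generator, so its image comes from complex
    homogeneity.\<close>
  have D0: "D 0 = 0"
  proof -
    have z: "cscale 0 y = 0" for y :: "('i, 'j) opr" by (rule blinfun_eqI) simp
    show ?thesis using scale[OF gC[of 0 0 0], of 0] by (simp add: z)
  qed
  have Dr: "D (r *\<^sub>R y) = r *\<^sub>R D y" if "y \<in> C_X q" for r y
    using scale[OF that, of "of_real r"] by (simp add: cscale_of_real)
  have "x \<in> C_X q \<and> hatX x \<in> Q \<and> D x = \<Delta>\<^sub>0 x"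
    using x unfolding C_X_def
  proof (induction rule: span_induct_alt)
    case base
    have "hatX 0 \<in> Q" "\<Delta>\<^sub>0 0 = 0"
      using \<Delta>0_scale(1,3)[of 0 0] Q_closed(5)[OF Q_closed(1), of 0] by (auto simp: hat_def)
    then show ?case by (simp add: D0 span_zero)
  next
    case (step r x y)
    then obtain c k m t where xx: "x = cscale c (?g k m t)" by blast
    have x: "x \<in> C_X q" "hatX x \<in> Q" "D x = \<Delta>\<^sub>0 x"
      using gen[of k m t] gC by (auto simp: xx C_X_generator_in scale \<Delta>0_scale)
    then have rx: "r *\<^sub>R x \<in> C_X q" "hatX (r *\<^sub>R x) \<in> Q" "D (r *\<^sub>R x) = \<Delta>\<^sub>0 (r *\<^sub>R x)"
      by (auto simp: Dr \<Delta>0_scale C_X_def span_scale)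
    with step.IH show ?case
      using add[of "r *\<^sub>R x" y] by (auto simp: C_X_def \<Delta>0_add span_add)
  qed
  then show ?thesis by blast
qed

end

text \<open>The last conjunct makes "determined on \<open>C_X\<close>" precise: the corner of
  \<open>\<Delta>\<close> is the only complex-linear right module map, relative to
  \<open>\<Delta>\<^sub>p\<close>, with the stated values on all
  \<open>v0_pow r o L0plus q\<close>.\<close>

theorem theorem3p13:
  fixes q :: real
    and \<Delta> :: "(int \<times> int + nat \<times> int, int \<times> int + nat \<times> int) opr \<Rightarrow>
      ((int \<times> int + nat \<times> int) \<times> (int \<times> int + nat \<times> int),
       (int \<times> int + nat \<times> int) \<times> (int \<times> int + nat \<times> int)) opr"
    and \<Delta>\<^sub>p :: "(nat \<times> int, nat \<times> int) opr \<Rightarrow>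
      ((nat \<times> int) \<times> (nat \<times> int), (nat \<times> int) \<times> (nat \<times> int)) opr"
    and j :: "(nat, nat) opr \<Rightarrow> (nat \<times> int, nat \<times> int) opr"
    and \<alpha> :: "(nat, nat) opr \<Rightarrow> ((nat \<times> int) \<times> nat, (nat \<times> int) \<times> nat) opr"
    and \<G> :: "((nat \<times> int) \<times> nat, (int \<times> int) \<times> nat) opr"
  assumes "0 < q" "q < 1"
    and SUq2: "SUq2_comultiplication q \<Delta>\<^sub>p"
    and podles: "podles_embedding q j" "podles_action q \<Delta>\<^sub>p j \<alpha>"
    and linking: "linking_quantum_groupoid Qtilde \<Delta> (L_SUq2 q) \<Delta>\<^sub>p"
    and G_unitary: "unitary_op \<G>" "upper_right \<G> \<in> Qtilde \<otimes>\<^sub>N bops"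
    and G_corep: "\<exists>\<Psi>. is_tensor_hom Qtilde bops (Qtilde \<otimes>\<^sub>N Qtilde) bops \<Delta> (\<lambda>y. y) \<Psi> \<and>
      \<Psi> (upper_right \<G>) = leg13 (upper_right \<G>) o\<^sub>L leg23 (upper_right \<G>)"
    and G_implements: "\<forall>x\<in>bops. \<alpha> x = adj \<G> o\<^sub>L (id_blinfun \<otimes>\<^sub>o x) o\<^sub>L \<G>"
    and identification: "\<forall>n. vec_slice\<^sub>2 (ket n) (ket 0) \<G> =
      (1 / sqrt (qpoch q n)) *\<^sub>R (v0_pow (int n) o\<^sub>L L0plus q o\<^sub>L opow (b_plus q) n)"
  shows "summable (Delta_term q) \<and>
    (\<forall>r. corner_comult \<iota>\<^sub>H \<iota>\<^sub>G \<Delta> (v0_pow r o\<^sub>L L0plus q) =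
       (v0_pow r \<otimes>\<^sub>o v0_pow r) o\<^sub>L (\<Sum>p. Delta_term q p)) \<and>
    (\<forall>D. (\<forall>x\<in>C_X q. \<forall>y\<in>C_X q. D (x + y) = D x + D y) \<and>
         (\<forall>c. \<forall>x\<in>C_X q. D (cscale c x) = cscale c (D x)) \<and>
         (\<forall>x\<in>C_X q. \<forall>y\<in>pol_SUq2 q. D (x o\<^sub>L y) = D x o\<^sub>L \<Delta>\<^sub>p y) \<and>
         (\<forall>r. D (v0_pow r o\<^sub>L L0plus q) =
            (v0_pow r \<otimes>\<^sub>o v0_pow r) o\<^sub>L (\<Sum>p. Delta_term q p))
       \<longrightarrow> (\<forall>x\<in>C_X q. D x = corner_comult \<iota>\<^sub>H \<iota>\<^sub>G \<Delta> x))"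
proof -
  note q = \<open>0 < q\<close> \<open>q < 1\<close>
  have vN: "von_neumann_algebra (L_SUq2 q)"
    using linking by (simp add: linking_quantum_groupoid_def vN_quantum_group_def)
  have "adj \<G> o\<^sub>L \<G> = id_blinfun" "\<G> o\<^sub>L adj \<G> = id_blinfun"
    using G_unitary(1) by (simp_all add: unitary_op_def)
  moreover have "\<alpha> (podles_X q) = adj \<G> o\<^sub>L (id_blinfun \<otimes>\<^sub>o podles_X q) o\<^sub>L \<G>"
    using G_implements podles_X_bops[OF q] by blast
  \<comment> \<open>Multiplying the implementation formula by \<open>\<G>\<close> on the left and
    using unitarity turns it into an intertwining relation.\<close>
  ultimately have "(id_blinfun \<otimes>\<^sub>o podles_X q) o\<^sub>L \<G> = \<G> o\<^sub>L \<alpha> (podles_X q)"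
    by (simp add: blinfun_compose_assoc ocomp_cong_tail[of \<G> "adj \<G>"])
  then have X: "(id_blinfun \<otimes>\<^sub>o podles_X q) o\<^sub>L \<G> = q *\<^sub>R (\<G> o\<^sub>L (C_op q o\<^sub>L D_op q))"
    by (simp add: podles_action_X[OF q vN SUq2 podles] ocomp_linear)
  interpret linking_corepresentation q \<G> Qtilde \<Delta> \<Delta>\<^sub>p
    by unfold_locales (use q X SUq2 linking G_unitary G_corep identification in simp_all)
  have sums: "summable (Delta_term q)" "(\<Sum>p. Delta_term q p) = corner_comult \<iota>\<^sub>H \<iota>\<^sub>G \<Delta> (L0plus q)"
    using Delta_term_sums by (simp_all add: sums_iff)
  show ?thesis
    unfolding sums(2) using sums(1) \<Delta>0_v0_pow comultiplication_unique by blast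
qed

end
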